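(* (i) Let $\mathbf{Z}$ be a random matrix from the $N\times N$ Gaussian symplectic ensemble, and let $j_1,\dots,j_m$ be positive integers with $j_1+j_2+\dots+j_m=2n$. Then $$\frac{1}{(4N)^{n-m}}\,\mathbb{E}\Big(\Re(\mathrm{tr}(\mathbf{Z}^{j_1}))\,\Re(\mathrm{tr}(\mathbf{Z}^{j_2}))\cdots\Re(\mathrm{tr}(\mathbf{Z}^{j_m}))\Big)=\sum_{\Gamma}(-2N)^{\chi(\Gamma)},$$ where the sum is over labeled Möbius graphs $\Gamma$ with $m$ vertices of degrees $j_1,j_2,\dots,j_m$, and $\chi(\Gamma)$ is the Euler characteristic. (ii) More generally, let $\mathbf{Z}_1,\dots,\mathbf{Z}_s$ be independent $N\times N$ Gaussian symplectic ensembles, let $j_1,\dots,j_m$ be positive integers with $j_1+\dots+j_m=2n$, and let $t:\{1,\dots,2n\}\to\{1,\dots,s\}$ be fixed. Put $\alpha_1=1$, $\alpha_k=j_1+\dots+j_{k-1}+1$, $\beta_k=j_1+\dots+j_k$. Then $$\frac{1}{(4N)^{n-m}}\,\mathbb{E}\Big(\Re(\mathrm{tr}(\mathbf{Z}_{t(1)}\cdots\mathbf{Z}_{t(\beta_1)}))\,\Re(\mathrm{tr}(\mathbf{Z}_{t(\alpha_2)}\cdots\mathbf{Z}_{t(\beta_2)}))\times\cdots\times\Re(\mathrm{tr}(\mathbf{Z}_{t(\alpha_m)}\cdots\mathbf{Z}_{t(\beta_m)}))\Big)=\sum_{\Gamma}(-2N)^{\chi(\Gamma)},$$ where the sum is over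 labeled color-preserving Möbius graphs $\Gamma$ with vertices of degrees $j_1,\dots,j_m$ that are colored with $s$ colors by the mapping $t$. (If there are no $\Gamma$ consistent with the coloring $t$, the sum is interpreted as $0$.)
   Context: Quaternions: $\mathbb{H}\ni q=x_0+ix_1+jx_2+kx_3$ with $i^2=j^2=k^2=ijk=-1$, $x_0,\dots,x_3\in\mathbb{R}$; $\overline q=x_0-ix_1-jx_2-kx_3$; $\Re(q)=(q+\overline q)/2=x_0$. For an $N\times N$ quaternionic matrix $\mathbf{A}$, $\mathrm{tr}(\mathbf{A})=\sum_{j=1}^N A_{jj}$. A standard quaternion Gaussian random variable is $Z=\xi_0+i\xi_1+j\xi_2+k\xi_3$ with $\xi_0,\xi_1,\xi_2,\xi_3$ independent real $N(0,1)$ random variables. Gaussian symplectic ensemble (GSE): the random $N\times N$ self-adjoint quaternionic matrix $\mathbf{Z}=[Z_{i,j}]$ in which $Z_{i,j}$, $i<j$, are standard quaternion Gaussian random variables, $Z_{i,i}$ are real centered Gaussian random variables of variance $2$, all the variables $Z_{i,j}$, $i\le j$, are independent, and $Z_{j,i}=\overline{Z}_{i,j}$. Möbius graphs: vertices are disks with a local orientation; edges are ribbons joining vertices, each either untwisted (preserving the local orientations) or twisted (reversing the local orientations). Faces are the disjoint cycles of sides of ribbons found by following the sides of the ribbons and the vertex boundaries. The vertices are labeled, and the half-edges emanating from each vertex are labeled, so graphs differing by rotation of a vertex are distinct. Concretely, a labeled Möbius graph with vertices of degrees $j_1,\dots,j_m$, $j_1+\dots+j_m=2n$, is a partition of the set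 of half-edges $\{1,\dots,2n\}$ into $n$ two-element sets (the edges), together with an arbitrary designation of each edge as untwisted or twisted; the half-edges at the $r$-th vertex, in cyclic order, are $j_1+\dots+j_{r-1}+1,\dots,j_1+\dots+j_r$. To count faces: each half-edge $i$ has two sides $i^L,i^R$; let $\mathrm{next}(i)$ be the cyclic successor of $i$ at its vertex; join $i^L$ to $\mathrm{next}(i)^R$ for every $i$; for every untwisted edge $\{i,j\}$ join $i^L$ to $j^R$ and $i^R$ to $j^L$; for every twisted edge $\{i,j\}$ join $i^L$ to $j^L$ and $i^R$ to $j^R$. The result is a 2-regular (multi)graph on $4n$ points, and the number of faces $f(\Gamma)$ is its number of cycles. Euler characteristic: $\chi(\Gamma)=v(\Gamma)-e(\Gamma)+f(\Gamma)$, where $v(\Gamma)=m$, $e(\Gamma)=n$ and $f(\Gamma)$ are the numbers of vertices, edges and faces. (The graph need not be connected.) A labeled Möbius graph is color-preserving with respect to $t$ (half-edge $i$ having color $t(i)$) if $t(i)=t(j)$ for every edge $\{i,j\}$. *)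

theory Defs
  imports "HOL-Probability.Probability"
begin

section \<open>Quaternions\<close>

datatype quat = Quat (qRe: real) (qI: real) (qJ: real) (qK: real)

instantiation quat :: ring_1
begin

definition "0 = Quat 0 0 0 0"

definition "1 = Quat 1 0 0 0"

definition "p + q = Quat (qRe p + qRe q) (qI p + qI q) (qJ p + qJ q) (qK p + qK q)"

definition "- q = Quat (- qRe q) (- qI q) (- qJ q) (- qK q)"

definition "p - q = Quat (qRe p - qRe q) (qI p - qI q) (qJ p - qJ q) (qK p - qK q)"

definition "p * q =
  Quat (qRe p * qRe q - qI p * qI q - qJ p * qJ q - qK p * qK q)
       (qRe p * qI q + qI p * qRe q + qJ p * qK q - qK p * qJ q)
       (qRe p * qJ q - qI p * qK q + qJ p * qRe q + qK p * qI q)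
       (qRe p * qK q + qI p * qJ q - qJ p * qI q + qK p * qRe q)"

instance
  by standard
    (simp_all add: zero_quat_def one_quat_def plus_quat_def uminus_quat_def minus_quat_def
      times_quat_def quat.expand algebra_simps)

end

lemma quat_units:
  "Quat 0 1 0 0 * Quat 0 1 0 0 = - 1"
  "Quat 0 0 1 0 * Quat 0 0 1 0 = - 1"
  "Quat 0 0 0 1 * Quat 0 0 0 1 = - 1"
  "Quat 0 1 0 0 * Quat 0 0 1 0 * Quat 0 0 0 1 = - 1"
  by (simp_all add: one_quat_def uminus_quat_def times_quat_def)

type_synonym 'n quat_matrix = "((quat, 'n) vec, 'n) vec"

definition qcnj :: "quat \<Rightarrow> quat"
  where "qcnj q = Quat (qRe q) (- qI q) (- qJ q) (- qK q)"

lemma quat_add_qcnj: "q + qcnj q = Quat (2 * qRe q) 0 0 0"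
  by (simp add: plus_quat_def qcnj_def)

text \<open>
  The topology of \<open>\<real>\<^sup>4\<close>.  It determines \<open>borel\<close> on quaternions and, through the product topology
  on vectors, on quaternionic matrices.
\<close>

instantiation quat :: topological_space
begin

definition open_quat_def:
  "open (S :: quat set) \<longleftrightarrow> open ((\<lambda>(a, b, c, d). Quat a b c d) -` S)"

instance
  by standard (auto simp: open_quat_def vimage_Int vimage_Union)

end

section \<open>Products of matrices\<close>

text \<open>On vectors, \<open>*\<close> and \<open>^\<close> act componentwise, so powers are built from \<open>**\<close> here.\<close>

primrec mat_pow :: "'a::semiring_1^'n^'n \<Rightarrow> nat \<Rightarrow> 'a^'n^'n"
  where
    "mat_pow A 0 = mat 1"
  | "mat_pow A (Suc k) = A ** mat_pow A k"

definition mat_prod_list :: "('a::semiring_1^'n^'n) list \<Rightarrow> 'a^'n^'n"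
  where "mat_prod_list As = foldr (**) As (mat 1)"

section \<open>The Gaussian symplectic ensemble\<close>

context prob_space
begin

definition std_quat_gaussian :: "('a \<Rightarrow> quat) \<Rightarrow> bool"
  where "std_quat_gaussian Z \<longleftrightarrow>
    (\<forall>c\<in>{qRe, qI, qJ, qK}. distributed M lborel (\<lambda>\<omega>. c (Z \<omega>)) (normal_density 0 1)) \<and>
    indep_vars (\<lambda>_. borel) (\<lambda>c \<omega>. c (Z \<omega>)) {qRe, qI, qJ, qK}"

text \<open>
  The second parameter of \<open>normal_density\<close> is the standard deviation.  For \<open>i = j\<close> the first
  condition says that the diagonal entries are real.
\<close>

definition gse :: "('a \<Rightarrow> 'n::{finite,linorder} quat_matrix) \<Rightarrow> bool"
  where "gse Z \<longleftrightarrow>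
    (\<forall>\<omega>\<in>space M. \<forall>i j. Z \<omega> $ j $ i = qcnj (Z \<omega> $ i $ j)) \<and>
    (\<forall>i j. i < j \<longrightarrow> std_quat_gaussian (\<lambda>\<omega>. Z \<omega> $ i $ j)) \<and>
    (\<forall>i. distributed M lborel (\<lambda>\<omega>. qRe (Z \<omega> $ i $ i)) (normal_density 0 (sqrt 2))) \<and>
    indep_vars (\<lambda>_. borel) (\<lambda>(i, j) \<omega>. Z \<omega> $ i $ j) {(i, j). i \<le> j}"

end

section \<open>Labeled Moebius graphs\<close>

text \<open>
  The vertices are \<open>1, \<dots>, m\<close>; vertex \<open>r\<close> has degree \<open>j r\<close>, and its half-edges in cyclic order are
  \<open>first_he j r, \<dots>, last_he j r\<close>.
\<close>

definition half_edges :: "nat \<Rightarrow> (nat \<Rightarrow> nat) \<Rightarrow> nat set"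
  where "half_edges m j = {1..(\<Sum>r=1..m. j r)}"

definition first_he :: "(nat \<Rightarrow> nat) \<Rightarrow> nat \<Rightarrow> nat"
  where "first_he j k = (\<Sum>r=1..<k. j r) + 1"

definition last_he :: "(nat \<Rightarrow> nat) \<Rightarrow> nat \<Rightarrow> nat"
  where "last_he j k = (\<Sum>r=1..k. j r)"

definition vertex_of :: "(nat \<Rightarrow> nat) \<Rightarrow> nat \<Rightarrow> nat"
  where "vertex_of j i = (LEAST k. i \<le> last_he j k)"

definition next_he :: "(nat \<Rightarrow> nat) \<Rightarrow> nat \<Rightarrow> nat"
  where "next_he j i =
    (if i = last_he j (vertex_of j i) then first_he j (vertex_of j i) else i + 1)"

text \<open>A graph is the pair of its set of edges and its set of twisted edges.\<close>

type_synonym moebius_graph = "nat set set \<times> nat set set"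

definition moebius_graphs :: "nat \<Rightarrow> (nat \<Rightarrow> nat) \<Rightarrow> moebius_graph set"
  where "moebius_graphs m j =
    {(E, T). partition_on (half_edges m j) E \<and> (\<forall>e\<in>E. card e = 2) \<and> T \<subseteq> E}"

definition color_preserving :: "(nat \<Rightarrow> nat) \<Rightarrow> moebius_graph \<Rightarrow> bool"
  where "color_preserving t = (\<lambda>(E, T). \<forall>e\<in>E. \<forall>i\<in>e. \<forall>i'\<in>e. t i = t i')"

datatype side = LeftSide | RightSide

definition side_joins :: "nat \<Rightarrow> (nat \<Rightarrow> nat) \<Rightarrow> moebius_graph \<Rightarrow> ((nat \<times> side) \<times> (nat \<times> side)) set"
  where "side_joins m j = (\<lambda>(E, T).
    {((i, LeftSide), (next_he j i, RightSide)) | i. i \<in> half_edges m j} \<union>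
    {((i, a), (i', b)) | i a i' b. i \<noteq> i' \<and> {i, i'} \<in> E \<and> (a = b \<longleftrightarrow> {i, i'} \<in> T)})"

text \<open>
  Every point lies on exactly one vertex join and one ribbon side, so the points with these joins
  form a 2-regular multigraph (two points may be joined twice, giving a cycle of length 2).  Its
  cycles are its connected components, each given here as the set of its points.
\<close>

definition faces :: "nat \<Rightarrow> (nat \<Rightarrow> nat) \<Rightarrow> moebius_graph \<Rightarrow> (nat \<times> side) set set"
  where "faces m j \<Gamma> =
    (half_edges m j \<times> UNIV) // (side_joins m j \<Gamma> \<union> (side_joins m j \<Gamma>)\<inverse>)\<^sup>*"

definition euler_char :: "nat \<Rightarrow> (nat \<Rightarrow> nat) \<Rightarrow> moebius_graph \<Rightarrow> int"
  where "euler_char m j \<Gamma> = int m - int (card (fst \<Gamma>)) + int (card (faces m j \<Gamma>))"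

end

theory Submission
  imports Defs "HOL-Combinatorics.Combinatorics"
begin

text \<open>
  Let the quaternions act as \<open>2 \<times> 2\<close> complex matrices, so that the real part is half the trace.  A
  product of real parts of traces then expands into a sum over labels \<open>s\<close> of the half-edges by pairs
  of a matrix index and a boolean: the half-edge \<open>l\<close> contributes the complex entry in row \<open>s l\<close> and
  column \<open>s (next_he j l)\<close> (\<open>prod_qRe_trace\<close>).  Each entry is a linear form in independent standard
  normal variables, so by Wick's formula (\<open>wick_linear\<close>) the expectation is a sum over pairings of
  the half-edges, in which a pair contributes the covariance of its two entries.

  That covariance is twice a sum of two terms (\<open>entry_covariance\<close>).  The first says that the row
  of each entry equals the column of the other: the labels agree along the two sides of an untwisted
  ribbon.  The second joins row to row and column to column, with equal indices and opposite
  booleans, and with a sign: this is a twisted ribbon.  Multiplying out gives one sum over labels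
  for each Moebius graph (\<open>expectation_trace_product\<close>), with a common factor \<open>2\<^sup>n / 2\<^sup>m\<close>.

  To evaluate the sum of one graph, carry the labels to the sides of the half-edges and negate the
  boolean on every left side.  Now all joins, at vertices and along both kinds of ribbons, ask for the
  same thing: equal indices and opposite booleans.  The faces are cycles along which vertex joins and
  ribbon joins alternate, hence of even length, so a graph with \<open>f\<close> faces has \<open>(2 N)\<^sup>f\<close> admissible
  labels (\<open>card_alternating_labels\<close>).

  What remains is that every admissible label contributes the same sign \<open>(-1)\<^sup>n\<^sup>+\<^sup>m\<^sup>+\<^sup>f\<close>
  (\<open>ribbon_graph_sign\<close>); this is where the dimension becomes negative.  The booleans colour the sides
  so that joined sides have different colours.  Walking two steps along the faces permutes the
  \<open>2 n\<close> sides of one colour, with one cycle for each face, so this permutation has sign \<open>(-1)\<^sup>f\<close>.  Its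
  sign can also be found without knowing the faces.  The vertex joins arise from the pairs
  \<open>{(l, LeftSide), (l, RightSide)}\<close> through a permutation of sign \<open>(-1)\<^sup>m\<close>, namely the rotation at
  the vertices applied to the right sides, which has \<open>m\<close> cycles on \<open>2 n\<close> points.  The ribbon joins
  arise from the same pairs through a product of \<open>n\<close> transpositions, one for each ribbon.  Exchanging
  the two sides of suitable half-edges makes both permutations send the left sides to the sides of
  the chosen colour; they then differ by a permutation that respects the colours and takes vertex
  joins to ribbon joins, and such a permutation has the sign of the two-step walk
  (\<open>sign_eq_classes\<close>).  The exchanges made for the two permutations cancel except at the twisted
  ribbons, where they produce exactly the sign in the weight of the ribbon.
\<close>

section \<open>Pairings and the Wick formula\<close>

definition pairings :: "'a set \<Rightarrow> 'a set set set"
  where "pairings H = {P. partition_on H P \<and> (\<forall>e\<in>P. card e = 2)}"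

lemma finite_pairings: "finite H \<Longrightarrow> finite (pairings H)"
  unfolding pairings_def by (rule finite_subset[OF _ finitely_many_partition_on[of H]]) auto

lemma pairingsD:
  assumes "P \<in> pairings H"
  shows "partition_on H P" "\<And>e. e \<in> P \<Longrightarrow> card e = 2" "\<And>e. e \<in> P \<Longrightarrow> e \<subseteq> H" "\<And>e. e \<in> P \<Longrightarrow> finite e"
    "\<Union>P = H"
  using assms by (auto simp: pairings_def partition_on_def intro: card_ge_0_finite)

lemma pairings_empty: "pairings {} = {{}}"
  by (auto simp: pairings_def partition_on_empty)

lemma insert_pair_pairings:
  assumes "P \<in> pairings (H - {h, h'})" "h \<in> H" "h' \<in> H" "h \<noteq> h'"
  shows "insert {h, h'} P \<in> pairings H" "{h, h'} \<notin> P"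
proof -
  have P: "partition_on (H - {h,h'}) P" "\<forall>e\<in>P. card e = 2"
    using assms(1) by (auto simp: pairings_def)
  have "partition_on (insert h (insert h' (H - {h,h'}))) (insert {h,h'} P)"
    using P(1) assms by (auto simp: partition_on_def disjoint_def)
  moreover have "insert h (insert h' (H - {h,h'})) = H" using assms by auto
  ultimately show "insert {h, h'} P \<in> pairings H" using P(2) assms by (auto simp: pairings_def)
  show "{h,h'} \<notin> P" using P(1) by (auto simp: partition_on_def)
qed

text \<open>
  A fixed point \<open>h\<close> has a unique partner \<open>h'\<close>, and the other pairs form a pairing of the rest.
\<close>

lemma sum_pairings_rec:
  fixes C :: "'a set \<Rightarrow> 'b::comm_semiring_1"
  assumes "finite H" "h \<in> H"
  shows "(\<Sum>P\<in>pairings H. \<Prod>e\<in>P. C e) =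
    (\<Sum>h'\<in>H - {h}. C {h, h'} * (\<Sum>P\<in>pairings (H - {h, h'}). \<Prod>e\<in>P. C e))"
proof -
  let ?S = "Sigma (H - {h}) (\<lambda>h'. pairings (H - {h, h'}))"
  let ?f = "\<lambda>(h', P). insert {h, h'} P"
  have bij: "bij_betw ?f ?S (pairings H)"
    unfolding bij_betw_def
  proof
    show "inj_on ?f ?S"
    proof (rule inj_onI)
      fix x y assume xy: "x \<in> ?S" "y \<in> ?S" "?f x = ?f y"
      obtain a P b Q where xy_eq: "x = (a, P)" "y = (b, Q)" by (cases x, cases y) auto
      have a: "a \<in> H" "a \<noteq> h" "P \<in> pairings (H - {h, a})" and b: "b \<in> H" "b \<noteq> h" "Q \<in> pairings (H - {h, b})"
        and eq: "insert {h, a} P = insert {h, b} Q"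
        using xy unfolding xy_eq by auto
      have hP: "\<And>e. e \<in> P \<Longrightarrow> h \<notin> e" "\<And>e. e \<in> Q \<Longrightarrow> h \<notin> e"
        using pairingsD(3)[OF a(3)] pairingsD(3)[OF b(3)] by auto
      then have "{h,a} = {h,b}" using eq by blast
      then have "a = b" using a b by (auto simp: doubleton_eq_iff)
      moreover have "P = Q" using hP eq \<open>a = b\<close> by blast
      ultimately show "x = y" using xy_eq by simp
    qed
    show "?f ` ?S = pairings H"
    proof (intro equalityI subsetI)
      fix P assume "P \<in> ?f ` ?S"
      then obtain h' Q where "P = insert {h, h'} Q" "h' \<in> H" "h' \<noteq> h" "Q \<in> pairings (H - {h, h'})"
        by auto
      then show "P \<in> pairings H" using insert_pair_pairings(1)[of Q H h h'] assms(2) by simp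
    next
      fix P assume P: "P \<in> pairings H"
      obtain e where e: "e \<in> P" "h \<in> e" using pairingsD(5)[OF P] assms by blast
      then obtain h' where h': "e = {h, h'}" "h' \<noteq> h"
        using pairingsD(2)[OF P e(1)] by (auto simp: card_2_iff doubleton_eq_iff)
      have "partition_on (H - e) (P - {e})"
        using pairingsD(1)[OF P] e by (auto simp: partition_on_def disjoint_def)
      then have "P - {e} \<in> pairings (H - {h,h'})"
        using pairingsD(2)[OF P] h' by (auto simp: pairings_def)
      moreover have "h' \<in> H" using pairingsD(3)[OF P e(1)] h' by auto
      moreover have "P = insert {h,h'} (P - {e})" using e h' by auto
      ultimately show "P \<in> ?f ` ?S" using h'(2) by (intro image_eqI[of _ _ "(h', P - {e})"]) auto
    qed
  qed
  have "(\<Sum>P\<in>pairings H. \<Prod>e\<in>P. C e) = (\<Sum>x\<in>?S. \<Prod>e\<in>?f x. C e)"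
    using sum.reindex_bij_betw[OF bij, of "\<lambda>P. \<Prod>e\<in>P. C e"] by simp
  also have "\<dots> = (\<Sum>x\<in>?S. C {h, fst x} * (\<Prod>e\<in>snd x. C e))"
  proof (rule sum.cong[OF refl])
    fix x assume "x \<in> ?S"
    then obtain h' P where x: "x = (h', P)" and *: "h' \<in> H" "h \<noteq> h'" "P \<in> pairings (H - {h, h'})"
      by auto
    have "finite P" using *(3) assms finite_elements pairingsD(1) by (meson finite_Diff)
    then show "(\<Prod>e\<in>?f x. C e) = C {h, fst x} * (\<Prod>e\<in>snd x. C e)"
      using insert_pair_pairings(2)[OF *(3) assms(2) *(1,2)] x by simp
  qed
  also have "\<dots> = (\<Sum>h'\<in>H - {h}. \<Sum>P\<in>pairings (H - {h, h'}). C {h, h'} * (\<Prod>e\<in>P. C e))"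
    by (subst sum.Sigma) (use assms finite_pairings in \<open>auto simp: case_prod_beta\<close>)
  finally show ?thesis by (simp add: sum_distrib_left)
qed

text \<open>
  The moments of the standard normal distribution, by the recursion that integration by parts gives.
\<close>

fun gauss_moment :: "nat \<Rightarrow> real" where
  "gauss_moment 0 = 1"
| "gauss_moment (Suc 0) = 0"
| "gauss_moment (Suc (Suc k)) = real (Suc k) * gauss_moment k"

lemma gauss_moment_Suc: "gauss_moment (Suc k) = real k * gauss_moment (k - 1)"
  by (cases k) auto

text \<open>
  Both sides satisfy the same recursion.  Removing a point \<open>h\<close> together with a partner \<open>h'\<close>
  such that \<open>f h' = f h\<close> lowers the exponent of the moment belonging to \<open>f h\<close> by two, and the number of
  possible partners is the factor in the recursion of the moments.
\<close>

lemma prod_gauss_moment_eq_sum_pairings: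
  fixes H :: "nat set"
  assumes "finite H" "finite A" "f ` H \<subseteq> A"
  shows "(\<Prod>a\<in>A. gauss_moment (card {l\<in>H. f l = a})) =
    (\<Sum>P\<in>pairings H. \<Prod>e\<in>P. of_bool (f (Min e) = f (Max e)))"
  using assms(1,3)
proof (induction "card H" arbitrary: H rule: less_induct)
  case less
  show ?case
  proof (cases "H = {}")
    case True then show ?thesis by (simp add: pairings_empty)
  next
    case False
    then obtain h where h: "h \<in> H" by auto
    let ?a = "f h"
    let ?F = "\<lambda>H a. {l\<in>H. f l = a}"
    let ?R = "\<lambda>H. \<Prod>a\<in>A. gauss_moment (card (?F H a))"
    let ?k = "card (?F H ?a - {h})"
    have aA: "?a \<in> A" using h less.prems by auto
    have fin: "finite H" by fact
    have k: "card (?F H ?a) = Suc ?k"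
      using h fin by (subst card.remove[of _ h]) auto
    have "?R H = gauss_moment (Suc ?k) * (\<Prod>a\<in>A-{?a}. gauss_moment (card (?F H a)))"
      unfolding k[symmetric] by (rule prod.remove[OF assms(2) aA])
    also have "\<dots> = (\<Sum>h'\<in>?F H ?a - {h}. gauss_moment (?k - 1) * (\<Prod>a\<in>A-{?a}. gauss_moment (card (?F H a))))"
      by (simp add: gauss_moment_Suc)
    also have "\<dots> = (\<Sum>h'\<in>?F H ?a - {h}. ?R (H - {h, h'}))"
    proof (rule sum.cong[OF refl])
      fix h' assume h': "h' \<in> ?F H ?a - {h}"
      have "?F (H - {h,h'}) ?a = ?F H ?a - {h} - {h'}" using h' by auto
      then have 1: "card (?F (H - {h,h'}) ?a) = ?k - 1"
        using h' fin by (simp add: card_Diff_singleton)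
      have 2: "?F (H - {h,h'}) a = ?F H a" if "a \<noteq> ?a" for a using that h' by auto
      show "gauss_moment (?k - 1) * (\<Prod>a\<in>A-{?a}. gauss_moment (card (?F H a))) = ?R (H - {h, h'})"
      proof -
        have "?R (H - {h, h'}) = gauss_moment (card (?F (H - {h,h'}) ?a)) * (\<Prod>a\<in>A-{?a}. gauss_moment (card (?F (H - {h,h'}) a)))"
          by (rule prod.remove[OF assms(2) aA])
        also have "(\<Prod>a\<in>A-{?a}. gauss_moment (card (?F (H - {h,h'}) a))) = (\<Prod>a\<in>A-{?a}. gauss_moment (card (?F H a)))"
          by (rule prod.cong[OF refl]) (metis 2 Diff_iff singletonI)
        finally show ?thesis unfolding 1 by simp
      qed
    qed
    also have "\<dots> = (\<Sum>h'\<in>H - {h}. of_bool (f (Min {h,h'}) = f (Max {h,h'})) * ?R (H - {h, h'}))"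
          proof (rule sum.mono_neutral_cong_left)
      have mm: "f (Min {h,h'}) = f (Max {h,h'}) \<longleftrightarrow> f h' = f h" for h'
        by (auto simp: min_def max_def)
      show "\<forall>h'\<in>H - {h} - (?F H ?a - {h}). of_bool (f (Min {h,h'}) = f (Max {h,h'})) * ?R (H - {h, h'}) = 0"
        unfolding mm by auto
      show "?R (H - {h, h'}) = of_bool (f (Min {h,h'}) = f (Max {h,h'})) * ?R (H - {h, h'})"
        if "h' \<in> ?F H ?a - {h}" for h'
        using that unfolding mm by simp
    qed (use fin in auto)
    also have "\<dots> = (\<Sum>h'\<in>H - {h}. of_bool (f (Min {h,h'}) = f (Max {h,h'})) *
        (\<Sum>P\<in>pairings (H - {h, h'}). \<Prod>e\<in>P. of_bool (f (Min e) = f (Max e))))"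
    proof (rule sum.cong[OF refl])
      fix h' assume h': "h' \<in> H - {h}"
      have "card (H - {h,h'}) < card H" using h fin by (intro psubset_card_mono) auto
      then show "of_bool (f (Min {h,h'}) = f (Max {h,h'})) * ?R (H - {h, h'}) = of_bool (f (Min {h,h'}) = f (Max {h,h'})) *
        (\<Sum>P\<in>pairings (H - {h, h'}). \<Prod>e\<in>P. of_bool (f (Min e) = f (Max e)))"
        using less.hyps[of "H - {h,h'}"] less.prems by auto
    qed
    also have "\<dots> = (\<Sum>P\<in>pairings H. \<Prod>e\<in>P. of_bool (f (Min e) = f (Max e)))"
      by (rule sum_pairings_rec[symmetric, OF fin h])
    finally show ?thesis .
  qed
qed

text \<open>
  Distributivity for factors that depend on disjoint blocks of coordinates.  It is used for the
  vertices, which partition the half-edges, and for the pairs of a pairing.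
\<close>

lemma prod_sum_PiE_blocks:
  fixes F :: "'k \<Rightarrow> ('a \<Rightarrow> 'b) \<Rightarrow> 'c::comm_semiring_1"
  assumes "finite K" "\<And>k. k \<in> K \<Longrightarrow> finite (B k)" "disjoint_family_on B K"
    and cong: "\<And>k s s'. k \<in> K \<Longrightarrow> (\<And>x. x \<in> B k \<Longrightarrow> s x = s' x) \<Longrightarrow> F k s = F k s'"
  shows "(\<Prod>k\<in>K. \<Sum>s\<in>PiE (B k) X. F k s) = (\<Sum>s\<in>PiE (\<Union>k\<in>K. B k) X. \<Prod>k\<in>K. F k s)"
  using assms
proof (induction K rule: finite_induct)
  case empty then show ?case by simp
next
  case (insert k K)
  let ?U = "\<Union>k\<in>K. B k"
  have disj: "B k \<inter> ?U = {}" using insert.prems(2) insert.hyps(2) unfolding disjoint_family_on_def by fastforce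
  have IH: "(\<Prod>k\<in>K. \<Sum>s\<in>PiE (B k) X. F k s) = (\<Sum>s\<in>PiE ?U X. \<Prod>k\<in>K. F k s)"
  proof (rule insert.IH)
    show "finite (B k')" if "k' \<in> K" for k' using insert.prems(1) that by blast
    show "disjoint_family_on B K" using insert.prems(2) by (rule disjoint_family_on_mono[rotated]) blast
    show "F k' s = F k' s'" if "k' \<in> K" "\<And>x. x \<in> B k' \<Longrightarrow> s x = s' x" for k' s s'
      by (rule insert.prems(3)) (use that in blast)+
  qed
  let ?j = "\<lambda>s. (restrict s (B k), restrict s ?U)"
  have bij: "bij_betw ?j (PiE (B k \<union> ?U) X) (PiE (B k) X \<times> PiE ?U X)"
  proof -
    let ?g = "\<lambda>(a, b) x. if x \<in> B k then a x else b x"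
    show ?thesis
    proof (rule bij_betw_byWitness[where f' = ?g])
      show "\<forall>a\<in>PiE (B k \<union> ?U) X. ?g (?j a) = a"
      proof
        fix a assume "a \<in> PiE (B k \<union> ?U) X"
        then have "a x = undefined" if "x \<notin> B k \<union> ?U" for x using that by (rule PiE_arb)
        then have "?g (?j a) x = a x" for x by (cases "x \<in> B k"; cases "x \<in> ?U") simp_all
        then show "?g (?j a) = a" by (rule ext)
      qed
      show "\<forall>a'\<in>PiE (B k) X \<times> PiE ?U X. ?j (?g a') = a'"
      proof
        fix a' assume "a' \<in> PiE (B k) X \<times> PiE ?U X"
        then obtain a b where a': "a' = (a, b)" "a \<in> PiE (B k) X" "b \<in> PiE ?U X" by blast
        have "restrict (?g a') (B k) = a"
        proof
          fix x show "restrict (?g a') (B k) x = a x"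
            using PiE_arb[OF a'(2), of x] a'(1) by (cases "x \<in> B k") simp_all
        qed
        moreover have "restrict (?g a') ?U = b"
        proof
          fix x show "restrict (?g a') ?U x = b x"
          proof (cases "x \<in> ?U")
            case True
            then have "x \<notin> B k" using disj by blast
            then show ?thesis using True a'(1) by simp
          next
            case False
            then show ?thesis using PiE_arb[OF a'(3) False] by simp
          qed
        qed
        ultimately show "?j (?g a') = a'" using a'(1) by simp
      qed
      show "?j ` PiE (B k \<union> ?U) X \<subseteq> PiE (B k) X \<times> PiE ?U X"
        by (rule image_subsetI) (simp add: PiE_iff)
      show "?g ` (PiE (B k) X \<times> PiE ?U X) \<subseteq> PiE (B k \<union> ?U) X"
      proof (rule image_subsetI)
        fix a' assume "a' \<in> PiE (B k) X \<times> PiE ?U X"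
        then obtain a b where a': "a' = (a, b)" "a \<in> PiE (B k) X" "b \<in> PiE ?U X" by blast
        show "?g a' \<in> PiE (B k \<union> ?U) X"
        proof (rule PiE_I)
          fix x assume "x \<in> B k \<union> ?U"
          then show "?g a' x \<in> X x" using PiE_mem[OF a'(2), of x] PiE_mem[OF a'(3), of x] a'(1) by (cases "x \<in> B k") simp_all
        next
          fix x assume "x \<notin> B k \<union> ?U"
          then show "?g a' x = undefined" using PiE_arb[OF a'(3), of x] a'(1) by simp
        qed
      qed
    qed
  qed
  let ?r = "\<lambda>s. F k (restrict s (B k)) * (\<Prod>k\<in>K. F k (restrict s ?U))"
  have e1: "(\<Prod>k\<in>insert k K. \<Sum>s\<in>PiE (B k) X. F k s) = (\<Sum>s\<in>PiE (B k) X. F k s) * (\<Sum>s\<in>PiE ?U X. \<Prod>k\<in>K. F k s)"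
    unfolding IH[symmetric] by (rule prod.insert[OF insert.hyps])
  have e2: "(\<Sum>s\<in>PiE (B k) X. F k s) * (\<Sum>s\<in>PiE ?U X. \<Prod>k\<in>K. F k s) = (\<Sum>(s, s')\<in>PiE (B k) X \<times> PiE ?U X. F k s * (\<Prod>k\<in>K. F k s'))"
    by (simp only: sum_product sum.cartesian_product)
  have e3: "(\<Sum>(s, s')\<in>PiE (B k) X \<times> PiE ?U X. F k s * (\<Prod>k\<in>K. F k s')) = (\<Sum>s\<in>PiE (B k \<union> ?U) X. ?r s)"
    using sum.reindex_bij_betw[OF bij, of "\<lambda>(s, s'). F k s * (\<Prod>k\<in>K. F k s')"] by (simp only: prod.case)
  have e4: "(\<Sum>s\<in>PiE (B k \<union> ?U) X. ?r s) = (\<Sum>s\<in>PiE (B k \<union> ?U) X. \<Prod>k\<in>insert k K. F k s)"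
  proof (rule sum.cong[OF refl])
    fix s assume "s \<in> PiE (B k \<union> ?U) X"
    have 1: "F k (restrict s (B k)) = F k s" by (rule insert.prems(3)) simp_all
    have 2: "F k' (restrict s ?U) = F k' s" if "k' \<in> K" for k'
      by (rule insert.prems(3)) (use that in \<open>simp_all add: restrict_def, blast?\<close>)
    show "?r s = (\<Prod>k\<in>insert k K. F k s)"
      unfolding 1 prod.insert[OF insert.hyps] by (simp only: 2 cong: prod.cong)
  qed
  show ?case unfolding UN_insert using e1 e2 e3 e4 by (simp only:)
qed

lemma sum_PiE_pair:
  fixes F :: "'b \<Rightarrow> 'b \<Rightarrow> 'c::comm_monoid_add"
  assumes "x \<noteq> y"
  shows "(\<Sum>s\<in>PiE {x, y} (\<lambda>_. K). F (s x) (s y)) = (\<Sum>c\<in>K. \<Sum>c'\<in>K. F c c')"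
proof -
  have bij: "bij_betw (\<lambda>s. (s x, s y)) (PiE {x, y} (\<lambda>_. K)) (K \<times> K)"
  proof (rule bij_betw_byWitness[where f' = "\<lambda>(a, b) z. if z = x then a else if z = y then b else undefined"])
    show "\<forall>a\<in>PiE {x, y} (\<lambda>_. K). (\<lambda>(a, b) z. if z = x then a else if z = y then b else undefined) (a x, a y) = a"
    proof
      fix a assume "a \<in> PiE {x, y} (\<lambda>_. K)"
      then have "a z = undefined" if "z \<noteq> x" "z \<noteq> y" for z using PiE_arb[of a] that by blast
      then show "(\<lambda>(a, b) z. if z = x then a else if z = y then b else undefined) (a x, a y) = a"
        by (simp add: fun_eq_iff)
    qed
  next
    show "(\<lambda>(a, b) z. if z = x then a else if z = y then b else undefined) ` (K \<times> K) \<subseteq> PiE {x, y} (\<lambda>_. K)"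
      using assms by (intro image_subsetI PiE_I) (auto split: if_splits)
  qed (use assms in \<open>auto simp: PiE_iff\<close>)
  show ?thesis
    using sum.reindex_bij_betw[OF bij, of "\<lambda>(a, b). F a b"] by (simp add: sum.cartesian_product)
qed

text \<open>
  On the natural numbers the two members of a pair are named by its minimum and maximum, so that
  functions of an ordered pair can be evaluated at an unordered one.
\<close>

lemma pairing_Min_Max:
  fixes e :: "nat set"
  assumes "card e = 2"
  shows "Min e \<in> e" "Max e \<in> e" "Min e \<noteq> Max e" "{Min e, Max e} = e" "Min e < Max e"
proof -
  obtain x y where "e = {x,y}" "x \<noteq> y" using assms by (auto simp: card_2_iff)
  then show "Min e \<in> e" "Max e \<in> e" "Min e \<noteq> Max e" "{Min e, Max e} = e" "Min e < Max e"
    by (auto simp: min_def max_def)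
qed

lemma prod_pairing:
  fixes w :: "nat \<Rightarrow> 'b::comm_monoid_mult"
  assumes "finite H" "P \<in> pairings H"
  shows "(\<Prod>l\<in>H. w l) = (\<Prod>e\<in>P. w (Min e) * w (Max e))"
proof -
  note P = pairingsD[OF assms(2)]
  have "(\<Prod>l\<in>H. w l) = (\<Prod>e\<in>P. \<Prod>l\<in>e. w l)"
    using P(1,4) unfolding P(5)[symmetric]
    by (subst prod.Union_disjoint) (auto simp: partition_on_def disjoint_def)
  also have "\<dots> = (\<Prod>e\<in>P. w (Min e) * w (Max e))"
  proof (rule prod.cong[OF refl])
    fix e assume "e \<in> P"
    note mM = pairing_Min_Max[OF P(2)[OF this]]
    have "(\<Prod>l\<in>{Min e, Max e}. w l) = w (Min e) * w (Max e)"
      using mM(3) by simp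
    then show "(\<Prod>l\<in>e. w l) = w (Min e) * w (Max e)" unfolding mM(4) .
  qed
  finally show ?thesis .
qed

lemma sum_PiE_pairing:
  fixes V :: "nat set \<Rightarrow> 'c \<Rightarrow> 'c \<Rightarrow> 'b::comm_semiring_1"
  assumes "finite H" "P \<in> pairings H"
  shows "(\<Sum>s\<in>PiE H (\<lambda>_. K). \<Prod>e\<in>P. V e (s (Min e)) (s (Max e))) =
     (\<Prod>e\<in>P. \<Sum>c\<in>K. \<Sum>c'\<in>K. V e c c')"
proof -
  note P = pairingsD[OF assms(2)]
  have "(\<Prod>e\<in>P. \<Sum>c\<in>K. \<Sum>c'\<in>K. V e c c') = (\<Prod>e\<in>P. \<Sum>s\<in>PiE e (\<lambda>_. K). V e (s (Min e)) (s (Max e)))"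
  proof (rule prod.cong[OF refl])
    fix e assume "e \<in> P"
    note mM = pairing_Min_Max[OF P(2)[OF this]]
    show "(\<Sum>c\<in>K. \<Sum>c'\<in>K. V e c c') = (\<Sum>s\<in>PiE e (\<lambda>_. K). V e (s (Min e)) (s (Max e)))"
      using sum_PiE_pair[OF mM(3), of "V e" K] unfolding mM(4) by simp
  qed
  also have "\<dots> = (\<Sum>s\<in>PiE (\<Union>e\<in>P. e) (\<lambda>_. K). \<Prod>e\<in>P. V e (s (Min e)) (s (Max e)))"
  proof (rule prod_sum_PiE_blocks)
    show "finite P" using P(1) assms(1) finite_elements by metis
    show "disjoint_family_on (\<lambda>e. e) P" using P(1) by (auto simp: disjoint_family_on_def partition_on_def disjoint_def)
    show "V e (s (Min e)) (s (Max e)) = V e (s' (Min e)) (s' (Max e))"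
      if "e \<in> P" "\<And>x. x \<in> e \<Longrightarrow> s x = s' x" for e s s'
      using that(2)[OF pairing_Min_Max(1)[OF P(2)[OF that(1)]]] that(2)[OF pairing_Min_Max(2)[OF P(2)[OF that(1)]]] by simp
  qed (use P(4) in blast)
  finally show ?thesis using P(5) by simp
qed

text \<open>
  A monomial in independent variables depends only on how often each variable occurs; the hypothesis
  on joint moments is the form in which independence and normality enter.
\<close>

lemma (in prob_space) wick_independent:
  fixes g :: "'i \<Rightarrow> 'a \<Rightarrow> real"
  assumes "finite A"
    and mom: "\<And>k. integrable M (\<lambda>\<omega>. \<Prod>a\<in>A. g a \<omega> ^ k a)"
      "\<And>k. expectation (\<lambda>\<omega>. \<Prod>a\<in>A. g a \<omega> ^ k a) = (\<Prod>a\<in>A. gauss_moment (k a))"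
    and H: "finite (H :: nat set)" "f ` H \<subseteq> A"
  shows "integrable M (\<lambda>\<omega>. \<Prod>l\<in>H. g (f l) \<omega>)"
    "expectation (\<lambda>\<omega>. \<Prod>l\<in>H. g (f l) \<omega>) = (\<Sum>P\<in>pairings H. \<Prod>e\<in>P. of_bool (f (Min e) = f (Max e)))"
proof -
  have eq: "(\<Prod>l\<in>H. g (f l) \<omega>) = (\<Prod>a\<in>A. g a \<omega> ^ card {l\<in>H. f l = a})" for \<omega>
  proof -
    have "(\<Prod>l\<in>H. g (f l) \<omega>) = (\<Prod>a\<in>A. \<Prod>l\<in>{l\<in>H. f l = a}. g (f l) \<omega>)"
      by (rule prod.group[symmetric]) (use assms in auto)
    also have "\<dots> = (\<Prod>a\<in>A. \<Prod>l\<in>{l\<in>H. f l = a}. g a \<omega>)"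
      by (intro prod.cong refl) auto
    finally show ?thesis by simp
  qed
  show "integrable M (\<lambda>\<omega>. \<Prod>l\<in>H. g (f l) \<omega>)" unfolding eq by (rule mom)
  show "expectation (\<lambda>\<omega>. \<Prod>l\<in>H. g (f l) \<omega>) = (\<Sum>P\<in>pairings H. \<Prod>e\<in>P. of_bool (f (Min e) = f (Max e)))"
    unfolding eq mom by (rule prod_gauss_moment_eq_sum_pairings[OF H(1) assms(1) H(2)])
qed

text \<open>
  Wick's formula for linear forms follows from the one for monomials by multilinearity: after
  expanding the product, the sum over the choices of variables factors over the pairs.
\<close>

lemma (in prob_space) wick_linear:
  fixes g :: "'i \<Rightarrow> 'a \<Rightarrow> real" and w :: "nat \<Rightarrow> 'c \<Rightarrow> complex"
  assumes "finite A"
    and mom: "\<And>k. integrable M (\<lambda>\<omega>. \<Prod>a\<in>A. g a \<omega> ^ k a)"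
      "\<And>k. expectation (\<lambda>\<omega>. \<Prod>a\<in>A. g a \<omega> ^ k a) = (\<Prod>a\<in>A. gauss_moment (k a))"
    and H: "finite H" and K: "finite K" and f: "\<And>l c. l \<in> H \<Longrightarrow> c \<in> K \<Longrightarrow> f l c \<in> A"
  shows "integrable M (\<lambda>\<omega>. \<Prod>l\<in>H. \<Sum>c\<in>K. w l c * complex_of_real (g (f l c) \<omega>))"
    "(CLINT \<omega>|M. (\<Prod>l\<in>H. \<Sum>c\<in>K. w l c * complex_of_real (g (f l c) \<omega>))) =
      (\<Sum>P\<in>pairings H. \<Prod>e\<in>P. \<Sum>c\<in>K. \<Sum>c'\<in>K.
        w (Min e) c * w (Max e) c' * of_bool (f (Min e) c = f (Max e) c'))"
proof -
  have of_bool: "complex_of_real (of_bool b) = of_bool b" for b by (cases b) simp_all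
  let ?S = "PiE H (\<lambda>_. K)"
  let ?g = "\<lambda>s \<omega>. \<Prod>l\<in>H. g (f l (s l)) \<omega>"
  have eq: "(\<Prod>l\<in>H. \<Sum>c\<in>K. w l c * complex_of_real (g (f l c) \<omega>)) =
      (\<Sum>s\<in>?S. (\<Prod>l\<in>H. w l (s l)) * complex_of_real (?g s \<omega>))" for \<omega>
    using H K by (subst prod_sum_PiE) (simp_all add: prod.distrib)
  have sub: "(\<lambda>l. f l (s l)) ` H \<subseteq> A" if "s \<in> ?S" for s using that f by auto
  note wi = wick_independent[OF assms(1) mom H sub]
  have int: "integrable M (\<lambda>\<omega>. (\<Prod>l\<in>H. w l (s l)) * complex_of_real (?g s \<omega>))" if "s \<in> ?S" for s
    using wi(1)[OF that] by (intro integrable_mult_right integrable_of_real)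
  show "integrable M (\<lambda>\<omega>. \<Prod>l\<in>H. \<Sum>c\<in>K. w l c * complex_of_real (g (f l c) \<omega>))"
    unfolding eq by (rule Bochner_Integration.integrable_sum) (rule int)
  have "(CLINT \<omega>|M. (\<Prod>l\<in>H. \<Sum>c\<in>K. w l c * complex_of_real (g (f l c) \<omega>))) =
      (\<Sum>s\<in>?S. CLINT \<omega>|M. (\<Prod>l\<in>H. w l (s l)) * complex_of_real (?g s \<omega>))"
    unfolding eq by (rule Bochner_Integration.integral_sum) (rule int)
  also have "\<dots> = (\<Sum>s\<in>?S. (\<Prod>l\<in>H. w l (s l)) * complex_of_real (expectation (?g s)))"
    by (simp only: integral_mult_right_zero integral_complex_of_real)
  also have "\<dots> = (\<Sum>s\<in>?S. \<Sum>P\<in>pairings H. (\<Prod>l\<in>H. w l (s l)) *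
      (\<Prod>e\<in>P. of_bool (f (Min e) (s (Min e)) = f (Max e) (s (Max e)))))"
    by (rule sum.cong[OF refl], subst wi(2)) (simp_all add: sum_distrib_left of_bool of_real_prod)
  also have "\<dots> = (\<Sum>P\<in>pairings H. \<Sum>s\<in>?S. (\<Prod>l\<in>H. w l (s l)) *
      (\<Prod>e\<in>P. of_bool (f (Min e) (s (Min e)) = f (Max e) (s (Max e)))))"
    by (rule sum.swap)
  also have "\<dots> = (\<Sum>P\<in>pairings H. \<Sum>s\<in>?S. \<Prod>e\<in>P. w (Min e) (s (Min e)) * w (Max e) (s (Max e)) *
      of_bool (f (Min e) (s (Min e)) = f (Max e) (s (Max e))))"
  proof (intro sum.cong refl)
    fix P s assume P: "P \<in> pairings H"
    show "(\<Prod>l\<in>H. w l (s l)) * (\<Prod>e\<in>P. of_bool (f (Min e) (s (Min e)) = f (Max e) (s (Max e)))) =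
      (\<Prod>e\<in>P. w (Min e) (s (Min e)) * w (Max e) (s (Max e)) * of_bool (f (Min e) (s (Min e)) = f (Max e) (s (Max e))))"
      unfolding prod_pairing[OF H P] prod.distrib by simp
  qed
  also have "\<dots> = (\<Sum>P\<in>pairings H. \<Prod>e\<in>P. \<Sum>c\<in>K. \<Sum>c'\<in>K.
        w (Min e) c * w (Max e) c' * of_bool (f (Min e) c = f (Max e) c'))"
  proof (rule sum.cong[OF refl])
    fix P assume P: "P \<in> pairings H"
    show "(\<Sum>s\<in>?S. \<Prod>e\<in>P. w (Min e) (s (Min e)) * w (Max e) (s (Max e)) *
      of_bool (f (Min e) (s (Min e)) = f (Max e) (s (Max e)))) = (\<Prod>e\<in>P. \<Sum>c\<in>K. \<Sum>c'\<in>K.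
        w (Min e) c * w (Max e) c' * of_bool (f (Min e) c = f (Max e) c'))"
      by (rule sum_PiE_pairing[OF H P, of "\<lambda>e c c'. w (Min e) c * w (Max e) c' * of_bool (f (Min e) c = f (Max e) c')"])
  qed
  finally show "(CLINT \<omega>|M. (\<Prod>l\<in>H. \<Sum>c\<in>K. w l c * complex_of_real (g (f l c) \<omega>))) =
      (\<Sum>P\<in>pairings H. \<Prod>e\<in>P. \<Sum>c\<in>K. \<Sum>c'\<in>K.
        w (Min e) c * w (Max e) c' * of_bool (f (Min e) c = f (Max e) c'))" .
qed

section \<open>Joint moments of the matrix entries\<close>

lemma gauss_moment_even: "gauss_moment (2 * k) = fact (2 * k) / (2 ^ k * fact k)"
proof (induction k)
  case (Suc k)
  have "gauss_moment (2 * Suc k) = (2 * real k + 1) * gauss_moment (2 * k)" by simp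
  also have "\<dots> = (2 * real k + 1) * fact (2 * k) / (2 ^ k * fact k)" unfolding Suc.IH by simp
  also have "\<dots> = (2 * real k + 2) * ((2 * real k + 1) * fact (2 * k)) / ((2 * real k + 2) * (2 ^ k * fact k))"
    by (subst mult_divide_mult_cancel_left) (simp_all add: add_eq_0_iff)
  also have "\<dots> = fact (2 * Suc k) / (2 ^ Suc k * fact (Suc k))"
    by (simp add: algebra_simps)
  finally show ?case .
qed simp

lemma gauss_moment_odd: "gauss_moment (Suc (2 * k)) = 0"
  by (induction k) simp_all

lemma (in prob_space) normal_moments:
  assumes X: "distributed M lborel X (normal_density 0 \<sigma>)" and "\<sigma> > 0"
  shows "integrable M (\<lambda>\<omega>. (X \<omega> / \<sigma>) ^ k)" "expectation (\<lambda>\<omega>. (X \<omega> / \<sigma>) ^ k) = gauss_moment k"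
proof -
  have hbi: "has_bochner_integral lborel (\<lambda>x. normal_density 0 \<sigma> x * (x / \<sigma>) ^ k) (gauss_moment k)"
  proof (cases "even k")
    case True
    then obtain j where k: "k = 2 * j" by (elim evenE)
    have "has_bochner_integral lborel (\<lambda>x. normal_density 0 \<sigma> x * (x - 0) ^ (2 * j) * (1 / \<sigma> ^ k))
        (fact (2 * j) / ((2 / \<sigma>\<^sup>2)^j * fact j) * (1 / \<sigma> ^ k))"
      by (intro has_bochner_integral_mult_left normal_moment_even \<open>\<sigma> > 0\<close>)
    moreover have "fact (2 * j) / ((2 / \<sigma>\<^sup>2)^j * fact j) * (1 / \<sigma> ^ k) = gauss_moment k"
      using \<open>\<sigma> > 0\<close> unfolding k gauss_moment_even by (simp add: power_divide power_mult)
    ultimately show ?thesis by (simp add: k power_divide)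
  next
    case False
    then obtain j where k: "k = 2 * j + 1" by (elim oddE)
    have "has_bochner_integral lborel (\<lambda>x. normal_density 0 \<sigma> x * (x - 0) ^ (2 * j + 1) * (1 / \<sigma> ^ k)) (0 * (1 / \<sigma> ^ k))"
      using normal_moment_odd \<open>\<sigma> > 0\<close> by (intro has_bochner_integral_mult_left)
    then show ?thesis by (simp add: k power_divide gauss_moment_odd)
  qed
  have meas: "(\<lambda>x. (x / \<sigma>) ^ k) \<in> borel_measurable lborel" by measurable
  have nn: "0 \<le> normal_density 0 \<sigma> x" for x by simp
  show "integrable M (\<lambda>\<omega>. (X \<omega> / \<sigma>) ^ k)"
    using distributed_integrable[OF X meas nn] hbi by (simp add: has_bochner_integral_iff)
  show "expectation (\<lambda>\<omega>. (X \<omega> / \<sigma>) ^ k) = gauss_moment k"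
    using distributed_integral[OF X meas nn] hbi by (simp add: has_bochner_integral_iff)
qed

abbreviation quat_components :: "(quat \<Rightarrow> real) set"
  where "quat_components \<equiv> {qRe, qI, qJ, qK}"

lemma quat_components_distinct:
  "qRe \<noteq> qI" "qRe \<noteq> qJ" "qRe \<noteq> qK" "qI \<noteq> qJ" "qI \<noteq> qK" "qJ \<noteq> qK"
  "qI \<noteq> qRe" "qJ \<noteq> qRe" "qK \<noteq> qRe" "qJ \<noteq> qI" "qK \<noteq> qI" "qK \<noteq> qJ"
proof -
  let ?q = "Quat 0 1 2 3"
  have "qRe ?q = 0" "qI ?q = 1" "qJ ?q = 2" "qK ?q = 3" by simp_all
  then show "qRe \<noteq> qI" "qRe \<noteq> qJ" "qRe \<noteq> qK" "qI \<noteq> qJ" "qI \<noteq> qK" "qJ \<noteq> qK"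
    "qI \<noteq> qRe" "qJ \<noteq> qRe" "qK \<noteq> qRe" "qJ \<noteq> qI" "qK \<noteq> qI" "qK \<noteq> qJ"
    by (metis zero_neq_one zero_neq_numeral one_eq_numeral_iff numeral_eq_iff num.distinct num.inject)+
qed

text \<open>
  The topology of the quaternions is transported from fourfold real tuples, where the components are
  compositions of projections.
\<close>

lemma quat_component_measurable:
  assumes "c \<in> quat_components"
  shows "c \<in> borel \<rightarrow>\<^sub>M borel"
proof (rule borel_measurable_continuous_onI)
  have "open (c -` B)" if "open B" for B
  proof -
    obtain h :: "real \<times> real \<times> real \<times> real \<Rightarrow> real" where h: "continuous_on UNIV h" "\<And>x y z u. c (Quat x y z u) = h (x, y, z, u)"
    proof -
      have "continuous_on UNIV (\<lambda>p::real \<times> real \<times> real \<times> real. fst p)"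
        "continuous_on UNIV (\<lambda>p::real \<times> real \<times> real \<times> real. fst (snd p))"
        "continuous_on UNIV (\<lambda>p::real \<times> real \<times> real \<times> real. fst (snd (snd p)))"
        "continuous_on UNIV (\<lambda>p::real \<times> real \<times> real \<times> real. snd (snd (snd p)))"
        by (intro continuous_intros)+
      then show thesis using assms that by fastforce
    qed
    have "(\<lambda>(x, y, z, u). Quat x y z u) -` c -` B = h -` B" using h(2) by auto
    then show ?thesis unfolding open_quat_def using h(1) that by (simp add: open_vimage)
  qed
  then show "continuous_on UNIV c" by (simp add: continuous_on_open_vimage)
qed

lemma matrix_entry_measurable:
  "(\<lambda>A :: ('a::topological_space, 'n::finite) vec ^ 'm::finite. A $ i $ j) \<in> borel \<rightarrow>\<^sub>M borel"
  by (intro borel_measurable_continuous_onI continuous_on_component continuous_on_id)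

text \<open>
  The components that are not forced to vanish by self-adjointness.
\<close>

definition independent_components :: "'n::linorder \<times> 'n \<Rightarrow> (quat \<Rightarrow> real) set" where
  "independent_components = (\<lambda>(i, j). if i = j then {qRe} else quat_components)"

definition entry_sd :: "'n::linorder \<times> 'n \<Rightarrow> real" where
  "entry_sd = (\<lambda>(i, j). if i = j then sqrt 2 else 1)"

lemma independent_components_subset: "independent_components e \<subseteq> quat_components"
  by (auto simp: independent_components_def split: prod.splits)

lemma finite_independent_components: "finite (independent_components e)"
  by (auto simp: independent_components_def split: prod.splits)

text \<open>
  An index consists of the number of the matrix, a position on or above the diagonal, and a component.
  The entries below the diagonal are determined by self-adjointness.
\<close>

definition gse_index :: "nat \<Rightarrow> (nat \<times> ('n::{finite,linorder} \<times> 'n) \<times> (quat \<Rightarrow> real)) set" where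
  "gse_index s = {1..s} \<times> Sigma {(i, j). i \<le> j} independent_components"

definition gse_component :: "(nat \<Rightarrow> 'a \<Rightarrow> 'n::{finite,linorder} quat_matrix) \<Rightarrow>
    nat \<times> ('n \<times> 'n) \<times> (quat \<Rightarrow> real) \<Rightarrow> 'a \<Rightarrow> real" where
  "gse_component Z = (\<lambda>(t, e, c) \<omega>. c (Z t \<omega> $ fst e $ snd e) / entry_sd e)"

lemma finite_gse_index: "finite (gse_index s :: (nat \<times> ('n::{finite,linorder} \<times> 'n) \<times> (quat \<Rightarrow> real)) set)"
  unfolding gse_index_def using finite_independent_components by (intro finite_cartesian_product finite_SigmaI) auto

lemma prod_gse_index:
  fixes h :: "nat \<times> ('n::{finite,linorder} \<times> 'n) \<times> (quat \<Rightarrow> real) \<Rightarrow> real"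
  shows "(\<Prod>a\<in>gse_index s. h a) =
    (\<Prod>t\<in>{1..s}. \<Prod>e\<in>{(i, j). i \<le> j}. \<Prod>c\<in>independent_components e. h (t, e, c))"
proof -
  let ?I = "{(i, j). i \<le> (j::'n)}"
  have "(\<Prod>e\<in>?I. \<Prod>c\<in>independent_components e. h (t, e, c)) = (\<Prod>x\<in>Sigma ?I independent_components. h (t, x))" for t
    using finite_independent_components by (subst prod.Sigma) (auto intro!: prod.cong)
  then show ?thesis unfolding gse_index_def by (simp add: prod.cartesian_product)
qed

context prob_space
begin

text \<open>
  Dividing by the standard deviation reduces the diagonal and the off-diagonal entries to the same
  moments of standard normal variables.
\<close>

lemma gse_entry_moments:
  fixes k :: "_ \<Rightarrow> nat"
  assumes Z: "gse (Z :: 'a \<Rightarrow> 'n::{finite,linorder} quat_matrix)" and "i \<le> j"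
  defines "X \<equiv> \<lambda>\<omega>. \<Prod>c\<in>independent_components (i, j). (c (Z \<omega> $ i $ j) / entry_sd (i, j)) ^ k c"
  shows "integrable M X" "expectation X = (\<Prod>c\<in>independent_components (i, j). gauss_moment (k c))"
proof -
  have "integrable M X \<and> expectation X = (\<Prod>c\<in>independent_components (i, j). gauss_moment (k c))"
  proof (cases "i = j")
    case True
    have "distributed M lborel (\<lambda>\<omega>. qRe (Z \<omega> $ i $ i)) (normal_density 0 (sqrt 2))"
      using Z unfolding gse_def by blast
    from normal_moments[OF this] show ?thesis
      using True by (simp add: X_def independent_components_def entry_sd_def)
  next
    case False
    then have "i < j" using assms by simp
    then have *: "std_quat_gaussian (\<lambda>\<omega>. Z \<omega> $ i $ j)" using Z unfolding gse_def by blast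
    have d: "distributed M lborel (\<lambda>\<omega>. c (Z \<omega> $ i $ j)) (normal_density 0 1)" if "c \<in> quat_components" for c
      using * that unfolding std_quat_gaussian_def by blast
    have iv: "indep_vars (\<lambda>_. borel) (\<lambda>c \<omega>. c (Z \<omega> $ i $ j)) quat_components"
      using * unfolding std_quat_gaussian_def by blast
    have iv': "indep_vars (\<lambda>_. borel) (\<lambda>c \<omega>. (c (Z \<omega> $ i $ j) / 1) ^ k c) quat_components"
      by (rule indep_vars_compose2[OF iv]) measurable
    have X: "X = (\<lambda>\<omega>. \<Prod>c\<in>quat_components. (c (Z \<omega> $ i $ j) / 1) ^ k c)"
      using False by (simp add: X_def independent_components_def entry_sd_def)
    have fin: "finite quat_components" by simp
    note nm = normal_moments[OF d zero_less_one]
    have "integrable M X" unfolding X by (rule indep_vars_integrable[OF fin iv' nm(1)])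
    moreover have "expectation X = (\<Prod>c\<in>quat_components. gauss_moment (k c))"
      unfolding X by (rule trans[OF indep_vars_lebesgue_integral[OF fin iv' nm(1)] prod.cong[OF refl nm(2)]])
    ultimately show ?thesis using False by (simp add: independent_components_def)
  qed
  then show "integrable M X" "expectation X = (\<Prod>c\<in>independent_components (i, j). gauss_moment (k c))"
    by auto
qed

lemma gse_matrix_moments:
  fixes k :: "_ \<Rightarrow> nat"
  assumes Z: "gse (Z :: 'a \<Rightarrow> 'n::{finite,linorder} quat_matrix)"
  defines "X \<equiv> \<lambda>\<omega>. \<Prod>e\<in>{(i, j). i \<le> j}. \<Prod>c\<in>independent_components e.
    (c (Z \<omega> $ fst e $ snd e) / entry_sd e) ^ k (e, c)"
  shows "integrable M X"
    "expectation X = (\<Prod>e\<in>{(i, j). i \<le> j}. \<Prod>c\<in>independent_components e. gauss_moment (k (e, c)))"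
proof -
  let ?I = "{(i, j). i \<le> (j::'n)}"
  let ?Y = "\<lambda>e \<omega>. \<Prod>c\<in>independent_components e. (c (Z \<omega> $ fst e $ snd e) / entry_sd e) ^ k (e, c)"
  have iv: "indep_vars (\<lambda>_. borel) (\<lambda>(i, j) \<omega>. Z \<omega> $ i $ j) ?I"
    using Z unfolding gse_def by blast
  have "indep_vars (\<lambda>_. borel) (\<lambda>e \<omega>. (\<lambda>q. \<Prod>c\<in>independent_components e. (c q / entry_sd e) ^ k (e, c)) ((case e of (i, j) \<Rightarrow> \<lambda>\<omega>. Z \<omega> $ i $ j) \<omega>)) ?I"
    by (rule indep_vars_compose2[OF iv])
      (use independent_components_subset in \<open>intro borel_measurable_prod borel_measurable_power borel_measurable_divide borel_measurable_const quat_component_measurable, blast\<close>)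
  then have iv': "indep_vars (\<lambda>_. borel) ?Y ?I" by (simp add: case_prod_beta)
  have int: "integrable M (?Y e)" "expectation (?Y e) = (\<Prod>c\<in>independent_components e. gauss_moment (k (e, c)))"
    if "e \<in> ?I" for e
  proof -
    obtain i j where e: "e = (i, j)" by (cases e)
    with that have "i \<le> j" by simp
    from gse_entry_moments[OF Z this, of "\<lambda>c. k ((i, j), c)"]
    show "integrable M (?Y e)" "expectation (?Y e) = (\<Prod>c\<in>independent_components e. gauss_moment (k (e, c)))"
      by (simp_all add: e)
  qed
  have fin: "finite ?I" by simp
  show "integrable M X" unfolding X_def by (rule indep_vars_integrable[OF fin iv' int(1)])
  show "expectation X = (\<Prod>e\<in>?I. \<Prod>c\<in>independent_components e. gauss_moment (k (e, c)))"
    unfolding X_def by (rule trans[OF indep_vars_lebesgue_integral[OF fin iv' int(1)] prod.cong[OF refl int(2)]])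
qed

text \<open>
  Independence is given on three levels: of the matrices, of the entries of a matrix, and of the
  components of an entry.  The expectation of a monomial is split along these levels in turn.
\<close>

lemma gse_component_moments:
  fixes Z :: "nat \<Rightarrow> 'a \<Rightarrow> 'n::{finite,linorder} quat_matrix"
  assumes Z: "\<And>t. t \<in> {1..s} \<Longrightarrow> gse (Z t)" and iv: "indep_vars (\<lambda>_. borel) Z {1..s}"
  shows "integrable M (\<lambda>\<omega>. \<Prod>a\<in>gse_index s. gse_component Z a \<omega> ^ k a)"
    "expectation (\<lambda>\<omega>. \<Prod>a\<in>gse_index s. gse_component Z a \<omega> ^ k a) = (\<Prod>a\<in>gse_index s. gauss_moment (k a))"
proof -
  let ?Y = "\<lambda>t \<omega>. \<Prod>e\<in>{(i, j). i \<le> j}. \<Prod>c\<in>independent_components e.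
    (c (Z t \<omega> $ fst e $ snd e) / entry_sd e) ^ k (t, e, c)"
  have "indep_vars (\<lambda>_. borel) (\<lambda>t \<omega>. (\<lambda>A. \<Prod>e\<in>{(i, j). i \<le> j}. \<Prod>c\<in>independent_components e.
    (c (A $ fst e $ snd e) / entry_sd e) ^ k (t, e, c)) (Z t \<omega>)) {1..s}"
    by (rule indep_vars_compose2[OF iv])
      (use independent_components_subset in \<open>intro borel_measurable_prod borel_measurable_power borel_measurable_divide borel_measurable_const
         measurable_compose[OF matrix_entry_measurable quat_component_measurable], blast\<close>)
  then have iv': "indep_vars (\<lambda>_. borel) ?Y {1..s}" by simp
  note mm = gse_matrix_moments[OF Z]
  have fin: "finite {1..s}" by simp
  have eq: "(\<lambda>\<omega>. \<Prod>a\<in>gse_index s. gse_component Z a \<omega> ^ k a) = (\<lambda>\<omega>. \<Prod>t\<in>{1..s}. ?Y t \<omega>)"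
    unfolding prod_gse_index by (simp add: gse_component_def)
  have int: "integrable M (?Y t)" "expectation (?Y t) = (\<Prod>e\<in>{(i, j). i \<le> j}. \<Prod>c\<in>independent_components e. gauss_moment (k (t, e, c)))"
    if "t \<in> {1..s}" for t
    using mm[OF that, of "\<lambda>(e, c). k (t, e, c)"] by simp_all
  show "integrable M (\<lambda>\<omega>. \<Prod>a\<in>gse_index s. gse_component Z a \<omega> ^ k a)"
    unfolding eq by (rule indep_vars_integrable[OF fin iv' int(1)])
  show "expectation (\<lambda>\<omega>. \<Prod>a\<in>gse_index s. gse_component Z a \<omega> ^ k a) = (\<Prod>a\<in>gse_index s. gauss_moment (k a))"
    unfolding eq prod_gse_index[of "\<lambda>a. gauss_moment (k a)"] by (rule trans[OF indep_vars_lebesgue_integral[OF fin iv' int(1)] prod.cong[OF refl int(2)]])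
qed

text \<open>
  For a single matrix the outermost level is absent.
\<close>

lemma gse_component_moments_single:
  fixes Z :: "'a \<Rightarrow> 'n::{finite,linorder} quat_matrix"
  assumes Z: "gse Z"
  shows "integrable M (\<lambda>\<omega>. \<Prod>a\<in>gse_index 1. gse_component (\<lambda>_. Z) a \<omega> ^ k a)"
    "expectation (\<lambda>\<omega>. \<Prod>a\<in>gse_index 1. gse_component (\<lambda>_. Z) a \<omega> ^ k a) = (\<Prod>a\<in>gse_index 1. gauss_moment (k a))"
  using gse_matrix_moments[OF Z, of "\<lambda>(e, c). k (1, e, c)"]
  unfolding prod_gse_index by (simp_all add: gse_component_def)

end

section \<open>Quaternionic matrices as complex matrices\<close>

text \<open>
  The representation of the quaternions by the complex matrices
  \<open>((x\<^sub>0 + i x\<^sub>1, x\<^sub>2 + i x\<^sub>3), (- x\<^sub>2 + i x\<^sub>3, x\<^sub>0 - i x\<^sub>1))\<close>, with rows and columns indexed by booleans.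
\<close>

definition quat_repr :: "quat \<Rightarrow> bool \<Rightarrow> bool \<Rightarrow> complex" where
  "quat_repr q a b = (if a then (if b then Complex (qRe q) (- qI q) else Complex (- qJ q) (qK q))
     else (if b then Complex (qJ q) (qK q) else Complex (qRe q) (qI q)))"

lemma quat_repr_mult: "quat_repr (p * q) a b = (\<Sum>c\<in>UNIV. quat_repr p a c * quat_repr q c b)"
  by (cases a; cases b) (simp_all add: UNIV_bool quat_repr_def times_quat_def complex_eq_iff algebra_simps)

lemma quat_repr_add: "quat_repr (p + q) a b = quat_repr p a b + quat_repr q a b"
  by (simp add: quat_repr_def plus_quat_def complex_eq_iff)

lemma quat_repr_0 [simp]: "quat_repr 0 a b = 0"
  by (simp add: quat_repr_def zero_quat_def complex_eq_iff)

lemma quat_repr_sum: "quat_repr (\<Sum>x\<in>A. f x) a b = (\<Sum>x\<in>A. quat_repr (f x) a b)"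
  by (induction A rule: infinite_finite_induct) (simp_all add: quat_repr_add)

lemma complex_of_real_qRe_eq_trace: "complex_of_real (qRe q) = 1 / 2 * (\<Sum>a\<in>UNIV. quat_repr q a a)"
  by (simp add: UNIV_bool quat_repr_def complex_eq_iff)

lemma qRe_sum: "qRe (\<Sum>x\<in>A. f x) = (\<Sum>x\<in>A. qRe (f x))"
  by (induction A rule: infinite_finite_induct) (simp_all add: plus_quat_def zero_quat_def)

definition mat_repr :: "'n::finite quat_matrix \<Rightarrow> 'n \<times> bool \<Rightarrow> 'n \<times> bool \<Rightarrow> complex" where
  "mat_repr A x y = quat_repr (A $ fst x $ fst y) (snd x) (snd y)"

lemma sum_prod_UNIV: "(\<Sum>z\<in>UNIV. f z) = (\<Sum>i\<in>UNIV. \<Sum>a\<in>UNIV. f (i :: 'n::finite, a :: bool))"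
  by (simp add: sum.cartesian_product flip: UNIV_Times_UNIV)

lemma mat_repr_mult: "mat_repr (A ** B) x y = (\<Sum>z\<in>UNIV. mat_repr A x z * mat_repr B z y)"
  by (simp add: mat_repr_def matrix_matrix_mult_def quat_repr_sum quat_repr_mult sum_prod_UNIV)

lemma complex_of_real_qRe_trace: "complex_of_real (qRe (trace A)) = 1 / 2 * (\<Sum>x\<in>UNIV. mat_repr A x x)"
  by (simp add: trace_def qRe_sum complex_of_real_qRe_eq_trace mat_repr_def sum_prod_UNIV sum_distrib_left)

definition quat_unit :: "(quat \<Rightarrow> real) \<Rightarrow> quat" where
  "quat_unit c = (if c = qRe then Quat 1 0 0 0 else if c = qI then Quat 0 1 0 0
     else if c = qJ then Quat 0 0 1 0 else Quat 0 0 0 1)"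

lemma quat_repr_expand: "quat_repr q a b = (\<Sum>c\<in>quat_components. quat_repr (quat_unit c) a b * complex_of_real (c q))"
  by (simp add: quat_components_distinct quat_unit_def quat_repr_def complex_eq_iff)

text \<open>
  The identity on the matrix indices tensored with the standard symplectic form on the booleans.
\<close>

definition skew :: "'n \<times> bool \<Rightarrow> 'n \<times> bool \<Rightarrow> complex" where
  "skew x y = (if fst x = fst y \<and> snd x \<noteq> snd y then (if snd x then -1 else 1) else 0)"

text \<open>
  The normal variable that carries the component \<open>c\<close> of an entry.  On the diagonal only the real
  component is random; the others have weight zero and are given the index of the real one, so that
  every index is valid.
\<close>

definition entry_index :: "nat \<Rightarrow> 'n::linorder \<times> bool \<Rightarrow> 'n \<times> bool \<Rightarrow> (quat \<Rightarrow> real) \<Rightarrow>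
    nat \<times> ('n \<times> 'n) \<times> (quat \<Rightarrow> real)" where
  "entry_index t x y c =
    (t, (min (fst x) (fst y), max (fst x) (fst y)), if fst x = fst y then qRe else c)"

text \<open>
  The coefficient of that variable: \<open>sqrt 2\<close> restores the variance of the diagonal, and below the
  diagonal the imaginary components change sign, because the entry there is a conjugate.
\<close>

definition entry_weight :: "'n::linorder \<times> bool \<Rightarrow> 'n \<times> bool \<Rightarrow> (quat \<Rightarrow> real) \<Rightarrow> complex" where
  "entry_weight x y c = quat_repr (quat_unit c) (snd x) (snd y) *
    (if fst x < fst y then 1 else if c = qRe then (if fst x = fst y then complex_of_real (sqrt 2) else 1)
     else if fst x = fst y then 0 else -1)"

lemma entry_index_in_gse_index:
  assumes "t \<in> {1..s}" "c \<in> quat_components"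
  shows "entry_index t x y c \<in> gse_index s"
  using assms by (auto simp: entry_index_def gse_index_def independent_components_def min_def max_def)

lemma mat_repr_eq_linear_form:
  assumes sa: "\<And>i j. A $ j $ i = qcnj (A $ i $ j)" and A: "A = Z t \<omega>"
  shows "mat_repr A x y =
    (\<Sum>c\<in>quat_components. entry_weight x y c * complex_of_real (gse_component Z (entry_index t x y c) \<omega>))"
proof -
  obtain i a j b where xy: "x = (i, a)" "y = (j, b)" by (cases x, cases y) auto
  consider "i < j" | "i = j" | "j < i" by force
  then have "quat_repr (quat_unit c) a b * complex_of_real (c (A $ i $ j)) =
      entry_weight x y c * complex_of_real (gse_component Z (entry_index t x y c) \<omega>)"
    if c: "c \<in> quat_components" for c
  proof cases
    case 1
    then show ?thesis
      by (auto simp: xy A entry_weight_def entry_index_def gse_component_def entry_sd_def min_def max_def)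
  next
    case 2
    show ?thesis
    proof (cases "c = qRe")
      case True
      then show ?thesis using 2
        by (simp add: xy A entry_weight_def entry_index_def gse_component_def entry_sd_def)
    next
      case False
      have "A $ i $ i = qcnj (A $ i $ i)" by (rule sa)
      then have "qI (A $ i $ i) = 0 \<and> qJ (A $ i $ i) = 0 \<and> qK (A $ i $ i) = 0"
        by (cases "A $ i $ i") (simp add: qcnj_def)
      then have "c (A $ i $ i) = 0" using c False by blast
      then show ?thesis using 2 False by (simp add: xy entry_weight_def)
    qed
  next
    case 3
    have "A $ i $ j = qcnj (A $ j $ i)" by (rule sa)
    then have "c (A $ i $ j) = (if c = qRe then 1 else -1) * c (A $ j $ i)"
      using c by (elim insertE) (auto simp: qcnj_def quat_components_distinct)
    then show ?thesis using 3
      by (auto simp: xy A entry_weight_def entry_index_def gse_component_def entry_sd_def min_def max_def)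
  qed
  then show ?thesis unfolding mat_repr_def quat_repr_expand[of "A $ fst x $ fst y"] by (intro sum.cong refl) (simp add: xy)
qed

text \<open>
  The two contractions behind the covariance: summing \<open>u \<otimes> u\<close> over the quaternion units \<open>u\<close> gives
  twice the product of the symplectic forms of the rows and of the columns, and summing \<open>u\<close> tensored with
  its conjugate gives twice the exchange of the two factors.
\<close>

lemma sum_quat_unit:
  "(\<Sum>c\<in>quat_components. quat_repr (quat_unit c) a b * quat_repr (quat_unit c) a' b') =
    2 * (of_bool (a \<noteq> a') * (if a then -1 else 1)) * (of_bool (b \<noteq> b') * (if b then -1 else 1))"
  "(\<Sum>c\<in>quat_components. quat_repr (quat_unit c) a b * quat_repr (quat_unit c) a' b' * (if c = qRe then 1 else -1)) =
    2 * of_bool (a = b' \<and> b = a')"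
  by (cases a; cases b; cases a'; cases b';
      simp add: quat_components_distinct quat_unit_def quat_repr_def complex_eq_iff)+

lemma sum_quat_components_diag:
  fixes h :: "_ \<Rightarrow> _ \<Rightarrow> complex"
  shows "(\<Sum>c\<in>quat_components. \<Sum>c'\<in>quat_components. h c c' * of_bool (c = c')) = (\<Sum>c\<in>quat_components. h c c)"
  by (simp add: quat_components_distinct)

text \<open>
  Two entries are correlated only if their positions agree or are mirror images.  In the first case
  the sum of \<open>u \<otimes> u\<close> gives the skew term; in the second a conjugate enters and gives the
  other term.  On the diagonal both cases apply, and the variance 2 of the real part makes up for the
  missing imaginary parts, so the formula holds there as well.
\<close>

lemma entry_covariance:
  "(\<Sum>c\<in>quat_components. \<Sum>c'\<in>quat_components.
      entry_weight x y c * entry_weight x' y' c' * of_bool (entry_index t x y c = entry_index t' x' y' c')) =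
    of_bool (t = t') * 2 * (of_bool (x = y' \<and> y = x') + skew x x' * skew y y')"
proof -
  obtain i a j b where xy: "x = (i, a)" "y = (j, b)" by (cases x, cases y) auto
  obtain k a' l b' where xy': "x' = (k, a')" "y' = (l, b')" by (cases x', cases y') auto
  show ?thesis
  proof (cases "t = t' \<and> ((i = k \<and> j = l) \<or> (i = l \<and> j = k))")
    case False
    then have "entry_index t x y c \<noteq> entry_index t' x' y' c'" for c c'
      by (auto simp: entry_index_def xy xy' min_def max_def split: if_splits)
    moreover have "of_bool (t = t') * 2 * (of_bool (x = y' \<and> y = x') + skew x x' * skew y y') = (0::complex)"
      using False by (auto simp: xy xy' skew_def)
    ultimately show ?thesis by simp
  next
    case True
    then have t: "t = t'" by simp
    show ?thesis
    proof (cases "i = j")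
      case True
      then have kl: "i = k" "i = l" "j = k" "j = l" "k = l" using \<open>t = t' \<and> _\<close> by auto
      have "(\<Sum>c\<in>quat_components. \<Sum>c'\<in>quat_components.
        entry_weight x y c * entry_weight x' y' c' * of_bool (entry_index t x y c = entry_index t' x' y' c')) =
        complex_of_real (sqrt 2) * complex_of_real (sqrt 2) * quat_repr (quat_unit qRe) a b * quat_repr (quat_unit qRe) a' b'"
        by (simp add: kl t xy xy' entry_weight_def entry_index_def quat_components_distinct)
      also have "complex_of_real (sqrt 2) * complex_of_real (sqrt 2) = 2"
        by (simp flip: of_real_mult)
      finally show ?thesis
        by (cases a; cases b; cases a'; cases b')
          (simp_all add: kl t xy xy' skew_def quat_unit_def quat_repr_def complex_eq_iff)
    next
      case False
      then have ne: "i \<noteq> j" "k \<noteq> l" using \<open>t = t' \<and> _\<close> by auto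
      have idx: "entry_index t x y c = entry_index t' x' y' c' \<longleftrightarrow> c = c'" for c c'
        using \<open>t = t' \<and> _\<close> ne by (auto simp: entry_index_def xy xy' min_def max_def)
      have lhs: "(\<Sum>c\<in>quat_components. \<Sum>c'\<in>quat_components.
        entry_weight x y c * entry_weight x' y' c' * of_bool (entry_index t x y c = entry_index t' x' y' c')) =
        (\<Sum>c\<in>quat_components. entry_weight x y c * entry_weight x' y' c)"
        unfolding idx by (rule sum_quat_components_diag)
      show ?thesis
      proof (cases "i = k")
        case True
        then have kl: "i = k" "j = l" using \<open>t = t' \<and> _\<close> ne by auto
        have "entry_weight x y c * entry_weight x' y' c = quat_repr (quat_unit c) a b * quat_repr (quat_unit c) a' b'" for c
          using ne by (simp add: entry_weight_def xy xy' kl)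
        then show ?thesis unfolding lhs
          using ne by (simp only: sum_quat_unit) (auto simp: t xy xy' kl skew_def)
      next
        case False
        then have kl: "i = l" "j = k" using \<open>t = t' \<and> _\<close> ne by auto
        have "entry_weight x y c * entry_weight x' y' c = quat_repr (quat_unit c) a b * quat_repr (quat_unit c) a' b' * (if c = qRe then 1 else -1)" for c
          using ne by (auto simp: entry_weight_def xy xy' kl)
        then show ?thesis unfolding lhs
          using ne by (simp only: sum_quat_unit) (auto simp: t xy xy' kl skew_def)
      qed
    qed
  qed
qed

section \<open>Traces as sums over labels of the half-edges\<close>

lemma sum_PiE_insert:
  fixes F :: "('a \<Rightarrow> 'b) \<Rightarrow> 'c::comm_monoid_add"
  assumes "x \<notin> S"
  shows "(\<Sum>s\<in>PiE (insert x S) X. F s) = (\<Sum>y\<in>X x. \<Sum>s\<in>PiE S X. F (s(x := y)))"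
proof -
  have "(\<Sum>s\<in>PiE (insert x S) X. F s) = (\<Sum>p\<in>X x \<times> PiE S X. F ((\<lambda>(y, s). s(x := y)) p))"
    unfolding PiE_insert_eq by (rule sum.reindex[OF inj_combinator[OF assms], unfolded o_def])
  then show ?thesis by (simp add: sum.cartesian_product case_prod_beta')
qed

lemma sum_of_bool_UNIV:
  fixes h :: "'a::finite \<Rightarrow> complex"
  shows "(\<Sum>z\<in>UNIV. of_bool (z = x) * h z) = h x" "(\<Sum>z\<in>UNIV. of_bool (x = z) * h z) = h x"
    "(\<Sum>z\<in>UNIV. h z * (of_bool (x = z) * c)) = h x * c"
  by (simp_all add: of_bool_def if_distrib[of "\<lambda>a. a * _"] if_distrib[of "\<lambda>a. _ * a"] cong: if_cong)

lemma mat_prod_list_Cons: "mat_prod_list (A # As) = A ** mat_prod_list As"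
  by (simp add: mat_prod_list_def)

text \<open>
  An entry of a product is a sum over paths of matrix positions, here encoded by the row \<open>s l\<close> at
  which each factor is entered.
\<close>

lemma mat_repr_mat_prod_list:
  assumes "a \<le> b"
  shows "mat_repr (mat_prod_list (map f [a..<Suc b])) x y =
    (\<Sum>s\<in>PiE {a..b} (\<lambda>_. UNIV). of_bool (s a = x) *
      ((\<Prod>l\<in>{a..<b}. mat_repr (f l) (s l) (s (Suc l))) * mat_repr (f b) (s b) y))"
  using assms
proof (induction a arbitrary: x rule: inc_induct)
  case base
  have "(\<Sum>s\<in>PiE {b..b} (\<lambda>_. UNIV). of_bool (s b = x) * ((\<Prod>l\<in>{b..<b}. mat_repr (f l) (s l) (s (Suc l))) * mat_repr (f b) (s b) y)) =
    (\<Sum>z\<in>UNIV. of_bool (z = x) * mat_repr (f b) z y)"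
    using sum_PiE_insert[of b "{}" "\<lambda>s. of_bool (s b = x) * mat_repr (f b) (s b) y" "\<lambda>_. UNIV"] by simp
  also have "\<dots> = mat_repr (f b) x y" by (rule sum_of_bool_UNIV)
  finally show ?case by (simp add: mat_prod_list_def)
next
  case (step a)
  let ?R = "\<lambda>a s. (\<Prod>l\<in>{a..<b}. mat_repr (f l) (s l) (s (Suc l))) * mat_repr (f b) (s b) y"
  let ?P = "PiE {Suc a..b} (\<lambda>_. UNIV :: ('a \<times> bool) set)"
  have ab: "a < b" by fact
  have ins: "{a..b} = insert a {Suc a..b}" "{a..<b} = insert a {Suc a..<b}" using ab by auto
  have "mat_repr (mat_prod_list (map f [a..<Suc b])) x y = (\<Sum>z\<in>UNIV. mat_repr (f a) x z * mat_repr (mat_prod_list (map f [Suc a..<Suc b])) z y)"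
    using ab by (simp add: upt_conv_Cons mat_prod_list_Cons mat_repr_mult del: upt_Suc)
  also have "\<dots> = (\<Sum>z\<in>UNIV. \<Sum>s\<in>?P. mat_repr (f a) x z * (of_bool (s (Suc a) = z) * ?R (Suc a) s))"
    unfolding step.IH by (simp add: sum_distrib_left)
  also have "\<dots> = (\<Sum>s\<in>?P. \<Sum>z\<in>UNIV. mat_repr (f a) x z * (of_bool (s (Suc a) = z) * ?R (Suc a) s))"
    by (rule sum.swap)
  also have "\<dots> = (\<Sum>s\<in>?P. mat_repr (f a) x (s (Suc a)) * ?R (Suc a) s)"
    by (simp only: sum_of_bool_UNIV)
  also have "\<dots> = (\<Sum>s\<in>?P. \<Sum>z\<in>UNIV. of_bool (z = x) * (mat_repr (f a) z (s (Suc a)) * ?R (Suc a) s))"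
    by (simp only: sum_of_bool_UNIV)
  also have "\<dots> = (\<Sum>z\<in>UNIV. \<Sum>s\<in>?P. of_bool (z = x) * (mat_repr (f a) z (s (Suc a)) * ?R (Suc a) s))"
    by (rule sum.swap)
  also have "\<dots> = (\<Sum>z\<in>UNIV. \<Sum>s\<in>?P. of_bool ((s(a := z)) a = x) * ?R a (s(a := z)))"
  proof (intro sum.cong refl)
    fix z s
    have "(\<Prod>l\<in>{Suc a..<b}. mat_repr (f l) ((s(a := z)) l) ((s(a := z)) (Suc l))) = (\<Prod>l\<in>{Suc a..<b}. mat_repr (f l) (s l) (s (Suc l)))"
      by (rule prod.cong) auto
    then show "of_bool (z = x) * (mat_repr (f a) z (s (Suc a)) * ?R (Suc a) s) = of_bool ((s(a := z)) a = x) * ?R a (s(a := z))"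
      using ab unfolding ins(2) by (subst prod.insert) auto
  qed
  also have "\<dots> = (\<Sum>s\<in>PiE {a..b} (\<lambda>_. UNIV). of_bool (s a = x) * ?R a s)"
    unfolding ins(1) by (rule sum_PiE_insert[symmetric]) simp
  finally show ?case .
qed

lemma qRe_trace_mat_prod_list:
  assumes "a \<le> b"
  shows "complex_of_real (qRe (trace (mat_prod_list (map f [a..<b + 1])))) =
    1 / 2 * (\<Sum>s\<in>PiE {a..b} (\<lambda>_. UNIV). \<Prod>l\<in>{a..b}. mat_repr (f l) (s l) (s (if l = b then a else l + 1)))"
proof -
  let ?S = "PiE {a..b} (\<lambda>_. UNIV)"
  let ?R = "\<lambda>s x. (\<Prod>l\<in>{a..<b}. mat_repr (f l) (s l) (s (Suc l))) * mat_repr (f b) (s b) x"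
  have "(\<Sum>x\<in>UNIV. mat_repr (mat_prod_list (map f [a..<Suc b])) x x) = (\<Sum>x\<in>UNIV. \<Sum>s\<in>?S. of_bool (s a = x) * ?R s x)"
    by (simp only: mat_repr_mat_prod_list[OF assms])
  also have "\<dots> = (\<Sum>s\<in>?S. \<Sum>x\<in>UNIV. of_bool (s a = x) * ?R s x)" by (rule sum.swap)
  also have "\<dots> = (\<Sum>s\<in>?S. ?R s (s a))" by (simp only: sum_of_bool_UNIV)
  also have "\<dots> = (\<Sum>s\<in>?S. \<Prod>l\<in>{a..b}. mat_repr (f l) (s l) (s (if l = b then a else l + 1)))"
  proof (rule sum.cong[OF refl])
    fix s
    have ins: "{a..b} = insert b {a..<b}" using assms by auto
    have "(\<Prod>l\<in>{a..<b}. mat_repr (f l) (s l) (s (if l = b then a else l + 1))) = (\<Prod>l\<in>{a..<b}. mat_repr (f l) (s l) (s (Suc l)))"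
      by (rule prod.cong) auto
    then show "?R s (s a) = (\<Prod>l\<in>{a..b}. mat_repr (f l) (s l) (s (if l = b then a else l + 1)))"
      unfolding ins by simp
  qed
  finally show ?thesis by (simp only: complex_of_real_qRe_trace Suc_eq_plus1)
qed

lemma mat_pow_eq_mat_prod_list: "mat_pow A (length xs) = mat_prod_list (map (\<lambda>_. A) xs)"
  by (induction xs) (simp_all add: mat_prod_list_def)

lemma first_he_eq: "1 \<le> k \<Longrightarrow> first_he j k = last_he j (k - 1) + 1"
  by (cases k) (simp_all add: first_he_def last_he_def atLeastLessThanSuc_atLeastAtMost)

lemma last_he_mono: "k \<le> k' \<Longrightarrow> last_he j k \<le> last_he j k'"
  unfolding last_he_def by (rule sum_mono2) auto

lemma last_he_step: "1 \<le> k \<Longrightarrow> last_he j k = last_he j (k - 1) + j k"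
  by (cases k) (simp_all add: last_he_def)

definition vertex_block :: "(nat \<Rightarrow> nat) \<Rightarrow> nat \<Rightarrow> nat set" where
  "vertex_block j k = {first_he j k..last_he j k}"

lemma vertex_of_block:
  assumes "1 \<le> k" "l \<in> vertex_block j k"
  shows "vertex_of j l = k"
  unfolding vertex_of_def
proof (rule Least_equality)
  show "l \<le> last_he j k" using assms by (simp add: vertex_block_def)
  fix k' assume "l \<le> last_he j k'"
  show "k \<le> k'"
  proof (rule ccontr)
    assume "\<not> k \<le> k'"
    then have "last_he j k' \<le> last_he j (k - 1)" by (intro last_he_mono) simp
    then show False using \<open>l \<le> last_he j k'\<close> assms by (simp add: vertex_block_def first_he_eq)
  qed
qed

lemma next_he_block:
  assumes "1 \<le> k" "l \<in> vertex_block j k"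
  shows "next_he j l = (if l = last_he j k then first_he j k else l + 1)"
  unfolding next_he_def vertex_of_block[OF assms] ..

lemma disjoint_vertex_blocks: "disjoint_family_on (vertex_block j) {1..m}"
proof (unfold disjoint_family_on_def, intro ballI impI)
  fix k k' assume "k \<in> {1..m}" "k' \<in> {1..m}" "k \<noteq> k'"
  then show "vertex_block j k \<inter> vertex_block j k' = {}"
    using vertex_of_block[of k _ j] vertex_of_block[of k' _ j] by fastforce
qed

lemma UN_vertex_block: "(\<Union>k\<in>{1..m}. vertex_block j k) = half_edges m j"
proof (induction m)
  case 0 then show ?case by (simp add: half_edges_def)
next
  case (Suc m)
  have "{1..Suc m} = insert (Suc m) {1..m}" by auto
  then have "(\<Union>k\<in>{1..Suc m}. vertex_block j k) = vertex_block j (Suc m) \<union> half_edges m j"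
    using Suc by simp
  also have "\<dots> = half_edges (Suc m) j"
    using last_he_mono[of m "Suc m" j] unfolding vertex_block_def half_edges_def
    by (auto simp: first_he_eq last_he_def)
  finally show ?case .
qed

lemma vertex_block_nonempty:
  assumes "1 \<le> k" "0 < j k"
  shows "first_he j k \<le> last_he j k" "first_he j k \<in> vertex_block j k" "last_he j k \<in> vertex_block j k"
  using assms last_he_step[OF assms(1), of j] by (simp_all add: first_he_eq vertex_block_def)

lemma finite_half_edges: "finite (half_edges m j)"
  by (simp add: half_edges_def)

text \<open>
  Each trace closes its path up, which is what the successor at the vertex encodes; the labels at
  the different vertices are independent and combine into one label of all half-edges.
\<close>

lemma prod_qRe_trace:
  assumes "\<forall>r\<in>{1..m}. 0 < j r"
  shows "complex_of_real (\<Prod>k=1..m. qRe (trace (mat_prod_list (map f [first_he j k..<last_he j k + 1])))) =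
    (1 / 2) ^ m * (\<Sum>s\<in>PiE (half_edges m j) (\<lambda>_. UNIV). \<Prod>l\<in>half_edges m j. mat_repr (f l) (s l) (s (next_he j l)))"
proof -
  let ?F = "\<lambda>k s. \<Prod>l\<in>vertex_block j k. mat_repr (f l) (s l) (s (next_he j l))"
  have tr: "complex_of_real (qRe (trace (mat_prod_list (map f [first_he j k..<last_he j k + 1])))) =
      1 / 2 * (\<Sum>s\<in>PiE (vertex_block j k) (\<lambda>_. UNIV). ?F k s)" if "k \<in> {1..m}" for k
  proof -
    have k: "1 \<le> k" "0 < j k" using that assms by auto
    have "(\<Prod>l\<in>{first_he j k..last_he j k}. mat_repr (f l) (s l) (s (if l = last_he j k then first_he j k else l + 1))) = ?F k s" for s
      unfolding vertex_block_def[symmetric]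
      by (rule prod.cong[OF refl]) (simp only: next_he_block[OF k(1)])
    then show ?thesis
      unfolding qRe_trace_mat_prod_list[OF vertex_block_nonempty(1)[of k j, OF k]] by (simp only: vertex_block_def)
  qed
  have "complex_of_real (\<Prod>k=1..m. qRe (trace (mat_prod_list (map f [first_he j k..<last_he j k + 1])))) =
      (\<Prod>k\<in>{1..m}. 1 / 2 * (\<Sum>s\<in>PiE (vertex_block j k) (\<lambda>_. UNIV). ?F k s))"
    unfolding of_real_prod by (rule prod.cong[OF refl tr])
  also have "\<dots> = (1 / 2) ^ m * (\<Prod>k\<in>{1..m}. \<Sum>s\<in>PiE (vertex_block j k) (\<lambda>_. UNIV). ?F k s)"
    by (simp only: prod.distrib prod_constant card_atLeastAtMost) simp
  also have "(\<Prod>k\<in>{1..m}. \<Sum>s\<in>PiE (vertex_block j k) (\<lambda>_. UNIV). ?F k s) =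
      (\<Sum>s\<in>PiE (\<Union>k\<in>{1..m}. vertex_block j k) (\<lambda>_. UNIV). \<Prod>k\<in>{1..m}. ?F k s)"
  proof (rule prod_sum_PiE_blocks)
    show "?F k s = ?F k s'" if k: "k \<in> {1..m}" and eq: "\<And>x. x \<in> vertex_block j k \<Longrightarrow> s x = s' x" for k s s'
    proof (rule prod.cong[OF refl])
      fix l assume l: "l \<in> vertex_block j k"
      then have "next_he j l \<in> vertex_block j k"
        using k assms vertex_block_nonempty[of k j] by (auto simp: next_he_block vertex_block_def)
      then show "mat_repr (f l) (s l) (s (next_he j l)) = mat_repr (f l) (s' l) (s' (next_he j l))"
        using eq l by simp
    qed
  qed (use disjoint_vertex_blocks[of j m] in \<open>simp_all add: vertex_block_def[abs_def]\<close>)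
  also have "\<dots> = (\<Sum>s\<in>PiE (half_edges m j) (\<lambda>_. UNIV). \<Prod>l\<in>half_edges m j. mat_repr (f l) (s l) (s (next_he j l)))"
  proof -
    have "(\<Prod>k\<in>{1..m}. ?F k s) = (\<Prod>l\<in>half_edges m j. mat_repr (f l) (s l) (s (next_he j l)))" for s
      unfolding UN_vertex_block[symmetric]
      by (rule prod.UNION_disjoint[symmetric])
        (use disjoint_vertex_blocks[of j m] in \<open>auto simp: vertex_block_def[abs_def] disjoint_family_on_def\<close>)
    then show ?thesis by (simp only: UN_vertex_block)
  qed
  finally show ?thesis .
qed

section \<open>Expectations as sums over graphs\<close>

definition untwisted_weight :: "(nat \<Rightarrow> nat) \<Rightarrow> (nat \<Rightarrow> 'n \<times> bool) \<Rightarrow> nat set \<Rightarrow> complex" where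
  "untwisted_weight nx s e = of_bool (s (Min e) = s (nx (Max e)) \<and> s (nx (Min e)) = s (Max e))"

definition twisted_weight :: "(nat \<Rightarrow> nat) \<Rightarrow> (nat \<Rightarrow> 'n \<times> bool) \<Rightarrow> nat set \<Rightarrow> complex" where
  "twisted_weight nx s e = skew (s (Min e)) (s (Max e)) * skew (s (nx (Min e))) (s (nx (Max e)))"

text \<open>
  The contribution of one graph to the expectation, up to a factor common to all graphs.
\<close>

definition graph_state_sum :: "'n itself \<Rightarrow> nat \<Rightarrow> (nat \<Rightarrow> nat) \<Rightarrow> moebius_graph \<Rightarrow> complex" where
  "graph_state_sum _ m j = (\<lambda>(E, T). \<Sum>s\<in>PiE (half_edges m j) (\<lambda>_. UNIV :: ('n \<times> bool) set).
     (\<Prod>e\<in>T. twisted_weight (next_he j) s e) * (\<Prod>e\<in>E - T. untwisted_weight (next_he j) s e))"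

lemma card_pairing:
  assumes "finite H" "P \<in> pairings H" "card H = 2 * n"
  shows "card P = n" "finite P"
proof -
  note P = pairingsD[OF assms(2)]
  show fin: "finite P" using P(1) assms(1) finite_elements by metis
  have "card H = (\<Sum>e\<in>P. card e)"
    unfolding P(5)[symmetric] by (rule card_Union_disjoint) (use P in \<open>auto simp: partition_on_def disjoint_def pairwise_def disjnt_def\<close>)
  also have "\<dots> = (\<Sum>e\<in>P. 2)" by (rule sum.cong[OF refl P(2)])
  finally show "card P = n" using assms(3) by simp
qed

lemma moebius_graphs_eq_Sigma: "moebius_graphs m j = Sigma (pairings (half_edges m j)) Pow"
  by (auto simp: moebius_graphs_def pairings_def)

lemma color_preserving_pairing:
  assumes "P \<in> pairings (H :: nat set)"
  shows "color_preserving t (P, T) \<longleftrightarrow> (\<forall>e\<in>P. t (Min e) = t (Max e))"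
proof -
  have "(\<forall>i\<in>e. \<forall>i'\<in>e. t i = t i') \<longleftrightarrow> t (Min e) = t (Max e)" if "e \<in> P" for e
  proof -
    have "(\<forall>i\<in>{Min e, Max e}. \<forall>i'\<in>{Min e, Max e}. t i = t i') \<longleftrightarrow> t (Min e) = t (Max e)" by auto
    then show ?thesis by (simp only: pairing_Min_Max(4)[OF pairingsD(2)[OF assms that]])
  qed
  then show ?thesis by (simp add: color_preserving_def)
qed

text \<open>
  For a fixed label of the half-edges the product of complex entries falls under Wick's formula.  The
  covariance of a pair is a sum of an untwisted and a twisted term, so multiplying out over the pairs
  chooses the set of twisted edges.  Pairs of different colours are uncorrelated, which leaves the
  colour-preserving graphs.
\<close>

lemma (in prob_space) expectation_trace_product:
  fixes Z :: "nat \<Rightarrow> 'a \<Rightarrow> 'n::{finite,linorder} quat_matrix" and j :: "nat \<Rightarrow> nat"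
  assumes pos: "\<forall>r\<in>{1..m}. 0 < j r" and sum: "(\<Sum>r=1..m. j r) = 2 * n"
    and t: "t ` {1..2*n} \<subseteq> {1..s}"
    and sa: "\<And>c \<omega> i k. c \<in> {1..s} \<Longrightarrow> \<omega> \<in> space M \<Longrightarrow> Z c \<omega> $ k $ i = qcnj (Z c \<omega> $ i $ k)"
    and mom: "\<And>k. integrable M (\<lambda>\<omega>. \<Prod>a\<in>gse_index s. gse_component Z a \<omega> ^ k a)"
      "\<And>k. expectation (\<lambda>\<omega>. \<Prod>a\<in>gse_index s. gse_component Z a \<omega> ^ k a) = (\<Prod>a\<in>gse_index s. gauss_moment (k a))"
  defines "X \<equiv> \<lambda>\<omega>. \<Prod>k=1..m.
      qRe (trace (mat_prod_list (map (\<lambda>i. Z (t i) \<omega>) [first_he j k..<last_he j k + 1])))"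
  shows "integrable M X"
    "complex_of_real (expectation X) = 2 ^ n / 2 ^ m *
       (\<Sum>\<Gamma>\<in>{\<Gamma> \<in> moebius_graphs m j. color_preserving t \<Gamma>}. graph_state_sum TYPE('n) m j \<Gamma>)"
proof -
  let ?H = "half_edges m j" and ?nx = "next_he j"
  let ?S = "PiE ?H (\<lambda>_. UNIV :: ('n \<times> bool) set)"
  let ?Y = "\<lambda>s \<omega>. \<Prod>l\<in>?H. \<Sum>c\<in>quat_components. entry_weight (s l) (s (?nx l)) c *
     complex_of_real (gse_component Z (entry_index (t l) (s l) (s (?nx l)) c) \<omega>)"
  have H: "?H = {1..2*n}" using sum by (simp add: half_edges_def)
  have cardH: "card ?H = 2 * n" unfolding H by simp
  have tH: "t l \<in> {1..s}" if "l \<in> ?H" for l using t that unfolding H by blast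
  have X: "complex_of_real (X \<omega>) = (1 / 2) ^ m * (\<Sum>s\<in>?S. ?Y s \<omega>)" if \<omega>: "\<omega> \<in> space M" for \<omega>
    unfolding X_def prod_qRe_trace[OF pos]
  proof (intro arg_cong[where f = "\<lambda>x. (1 / 2) ^ m * x"] sum.cong prod.cong refl)
    fix s l assume l: "l \<in> ?H"
    show "mat_repr (Z (t l) \<omega>) (s l) (s (?nx l)) = (\<Sum>c\<in>quat_components. entry_weight (s l) (s (?nx l)) c *
     complex_of_real (gse_component Z (entry_index (t l) (s l) (s (?nx l)) c) \<omega>))"
      by (rule mat_repr_eq_linear_form[of "Z (t l) \<omega>" Z "t l" \<omega>]) (rule sa[OF tH[OF l] \<omega>], rule refl)
  qed
  have idx: "entry_index (t l) (s' l) (s' (?nx l)) c \<in> gse_index s" if "l \<in> ?H" "c \<in> quat_components" for l c and s' :: "nat \<Rightarrow> 'n \<times> bool"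
    using entry_index_in_gse_index[OF tH[OF that(1)] that(2)] .
  have finC: "finite quat_components" by simp
  note wick = wick_linear[OF finite_gse_index mom finite_half_edges finC idx]
  have intY: "integrable M (?Y s')" for s' :: "nat \<Rightarrow> 'n \<times> bool"
    by (rule wick(1))
  have expY: "(CLINT \<omega>|M. ?Y s' \<omega>) = (\<Sum>P\<in>pairings ?H. \<Prod>e\<in>P. of_bool (t (Min e) = t (Max e)) * 2 *
      (untwisted_weight ?nx s' e + twisted_weight ?nx s' e))" for s' :: "nat \<Rightarrow> 'n \<times> bool"
    unfolding untwisted_weight_def twisted_weight_def
    by (rule trans[OF wick(2)]) (assumption | simp only: entry_covariance)+
  have int: "integrable M (\<lambda>\<omega>. (1 / 2) ^ m * (\<Sum>s\<in>?S. ?Y s \<omega>))"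
    by (intro integrable_mult_right Bochner_Integration.integrable_sum intY)
  then have intX: "integrable M (\<lambda>\<omega>. complex_of_real (X \<omega>))"
    by (subst Bochner_Integration.integrable_cong[OF refl X])
  show "integrable M X" using integrable_Re[OF intX] by simp
  have "complex_of_real (expectation X) = (CLINT \<omega>|M. complex_of_real (X \<omega>))"
    by (rule integral_complex_of_real[symmetric])
  also have "\<dots> = (CLINT \<omega>|M. (1 / 2) ^ m * (\<Sum>s\<in>?S. ?Y s \<omega>))"
    by (rule Bochner_Integration.integral_cong[OF refl X])
  also have "\<dots> = (1 / 2) ^ m * (\<Sum>s\<in>?S. CLINT \<omega>|M. ?Y s \<omega>)"
    unfolding integral_mult_right_zero
    by (rule arg_cong[where f = "\<lambda>x. (1 / 2) ^ m * x"], rule Bochner_Integration.integral_sum, rule intY)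
  also have "\<dots> = (1 / 2) ^ m * (\<Sum>s\<in>?S. \<Sum>P\<in>pairings ?H. \<Prod>e\<in>P. of_bool (t (Min e) = t (Max e)) * 2 *
      (untwisted_weight ?nx s e + twisted_weight ?nx s e))"
    by (simp only: expY)
  also have "\<dots> = (1 / 2) ^ m * (\<Sum>P\<in>pairings ?H. \<Sum>s\<in>?S. \<Prod>e\<in>P. of_bool (t (Min e) = t (Max e)) * 2 *
      (untwisted_weight ?nx s e + twisted_weight ?nx s e))"
    by (simp only: sum.swap[of _ "pairings ?H"])
  also have "\<dots> = (1 / 2) ^ m * (\<Sum>P\<in>pairings ?H. \<Sum>T\<in>Pow P. of_bool (color_preserving t (P, T)) * 2 ^ n * graph_state_sum TYPE('n) m j (P, T))"
  proof (intro arg_cong[where f = "\<lambda>x. (1 / 2) ^ m * x"] sum.cong refl)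
    fix P assume P: "P \<in> pairings ?H"
    note cP = card_pairing[OF finite_half_edges P cardH]
    have "(\<Prod>e\<in>P. of_bool (t (Min e) = t (Max e)) :: complex) = of_bool (\<forall>e\<in>P. t (Min e) = t (Max e))"
      using cP(2) by (induction P rule: finite_induct) auto
    then have col: "(\<Prod>e\<in>P. of_bool (t (Min e) = t (Max e)) :: complex) = of_bool (color_preserving t (P, T))" for T
      using color_preserving_pairing[OF P] by simp
    have "(\<Prod>e\<in>P. of_bool (t (Min e) = t (Max e)) * 2 * (untwisted_weight ?nx s e + twisted_weight ?nx s e)) =
       (\<Sum>T\<in>Pow P. of_bool (color_preserving t (P, T)) * 2 ^ n *
         ((\<Prod>e\<in>T. twisted_weight ?nx s e) * (\<Prod>e\<in>P - T. untwisted_weight ?nx s e)))" for s :: "nat \<Rightarrow> 'n \<times> bool"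
    proof -
      have "(\<Prod>e\<in>P. untwisted_weight ?nx s e + twisted_weight ?nx s e) =
        (\<Sum>T\<in>Pow P. (\<Prod>e\<in>T. twisted_weight ?nx s e) * (\<Prod>e\<in>P - T. untwisted_weight ?nx s e))"
        using prod_add[OF cP(2), of "twisted_weight ?nx s" "untwisted_weight ?nx s"] by (simp add: add.commute)
      then show ?thesis
        by (simp add: prod.distrib cP(1) sum_distrib_left flip: col)
    qed
    then have "(\<Sum>s\<in>?S. \<Prod>e\<in>P. of_bool (t (Min e) = t (Max e)) * 2 * (untwisted_weight ?nx s e + twisted_weight ?nx s e)) =
      (\<Sum>s\<in>?S. \<Sum>T\<in>Pow P. of_bool (color_preserving t (P, T)) * 2 ^ n *
         ((\<Prod>e\<in>T. twisted_weight ?nx s e) * (\<Prod>e\<in>P - T. untwisted_weight ?nx s e)))" by simp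
    also have "\<dots> = (\<Sum>T\<in>Pow P. \<Sum>s\<in>?S. of_bool (color_preserving t (P, T)) * 2 ^ n *
         ((\<Prod>e\<in>T. twisted_weight ?nx s e) * (\<Prod>e\<in>P - T. untwisted_weight ?nx s e)))"
      by (rule sum.swap)
    finally show "(\<Sum>s\<in>?S. \<Prod>e\<in>P. of_bool (t (Min e) = t (Max e)) * 2 * (untwisted_weight ?nx s e + twisted_weight ?nx s e)) =
      (\<Sum>T\<in>Pow P. of_bool (color_preserving t (P, T)) * 2 ^ n * graph_state_sum TYPE('n) m j (P, T))"
      by (simp only: graph_state_sum_def prod.case sum_distrib_left)
  qed
  also have "\<dots> = (1 / 2) ^ m * (\<Sum>\<Gamma>\<in>moebius_graphs m j. of_bool (color_preserving t \<Gamma>) * 2 ^ n * graph_state_sum TYPE('n) m j \<Gamma>)"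
    unfolding moebius_graphs_eq_Sigma
    by (subst sum.Sigma) (auto simp: finite_pairings finite_half_edges card_pairing(2)[OF finite_half_edges _ cardH])
  also have "\<dots> = 2 ^ n / 2 ^ m * (\<Sum>\<Gamma>\<in>moebius_graphs m j. of_bool (color_preserving t \<Gamma>) * graph_state_sum TYPE('n) m j \<Gamma>)"
    by (simp add: sum_distrib_left power_one_over field_simps)
  also have "(\<Sum>\<Gamma>\<in>moebius_graphs m j. of_bool (color_preserving t \<Gamma>) * graph_state_sum TYPE('n) m j \<Gamma>) =
      (\<Sum>\<Gamma>\<in>{\<Gamma> \<in> moebius_graphs m j. color_preserving t \<Gamma>}. graph_state_sum TYPE('n) m j \<Gamma>)"
  proof (rule sum.mono_neutral_cong_right)
    show "finite (moebius_graphs m j)"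
      unfolding moebius_graphs_eq_Sigma
      by (intro finite_SigmaI) (auto simp: finite_pairings finite_half_edges card_pairing(2)[OF finite_half_edges _ cardH])
  qed auto
  finally show "complex_of_real (expectation X) = 2 ^ n / 2 ^ m *
       (\<Sum>\<Gamma>\<in>{\<Gamma> \<in> moebius_graphs m j. color_preserving t \<Gamma>}. graph_state_sum TYPE('n) m j \<Gamma>)" .
qed

section \<open>Signs of permutations\<close>

lemma sign_cycle_of_list:
  assumes "distinct cs" "cs \<noteq> []"
  shows "sign (cycle_of_list cs) = (-1) ^ (length cs - 1)"
  using assms
proof (induction cs rule: cycle_of_list.induct)
  case (1 i j cs)
  have "sign (cycle_of_list (i # j # cs)) = sign (Transposition.transpose i j) * sign (cycle_of_list (j # cs))"
    by (simp add: sign_compose permutation_swap_id permutation_of_cycle)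
  also have "\<dots> = (-1) ^ (length (i # j # cs) - 1)"
    using 1 by (simp add: sign_swap_id)
  finally show ?case .
qed simp_all

text \<open>
  The powers of a cycle rotate its list, so they take the first element to every other.
\<close>

lemma orbit_cycle_of_list:
  assumes "distinct cs" "x \<in> set cs"
  shows "orbit (cycle_of_list cs) x = set cs"
proof -
  let ?c = "cycle_of_list cs"
  have perm: "permutation ?c" by (rule permutation_of_cycle)
  have ne: "cs \<noteq> []" using assms by auto
  have "(?c ^^ n) (cs ! 0) = cs ! n" if "n < length cs" for n
  proof -
    have "map (?c ^^ n) cs ! 0 = rotate n cs ! 0" using cyclic_rotation[OF assms(1)] by simp
    then show ?thesis using that ne by (simp add: nth_rotate)
  qed
  then have "set cs \<subseteq> orbit ?c (cs ! 0)"
    unfolding orbit_altdef_permutation[OF perm] by (clarsimp simp: in_set_conv_nth) metis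
  moreover have "orbit ?c (cs ! 0) \<subseteq> set cs"
    using ne by (intro permutes_orbit_subset[OF cycle_permutes]) simp
  ultimately have eq: "orbit ?c (cs ! 0) = set cs" by blast
  then show ?thesis using assms(2) orbit_cyclic_eq3[OF cyclic_on_orbit'[OF perm]] by blast
qed

text \<open>
  A cycle of length \<open>k\<close> has sign \<open>(-1)\<^sup>k\<^sup>-\<^sup>1\<close> and contributes one orbit, so the formula holds by
  composing disjoint cycles.  Since only the parity matters, the difference of the two cardinalities
  is replaced by their sum.
\<close>

lemma sign_eq_orbits:
  assumes "p permutes S" "finite S"
  shows "sign p = (-1) ^ (card S + card (orbit p ` S))"
proof -
  have "cycle_decomp S p" by (rule cycle_decomposition[OF assms])
  then have "finite S \<and> p permutes S \<and> sign p = (-1) ^ (card S + card (orbit p ` S))"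
  proof (induction rule: cycle_decomp.induct)
    case empty show ?case
      by (intro conjI finite.emptyI permutes_id) (simp only: sign_id image_empty card.empty add_0 power_0)
  next
    case (comp I p cs)
    let ?c = "cycle_of_list cs" and ?q = "cycle_of_list cs \<circ> p"
    have p: "finite I" "p permutes I" "sign p = (-1) ^ (card I + card (orbit p ` I))"
      using comp.IH by auto
    show ?case
    proof (cases "cs = []")
      case True then show ?thesis using p by simp
    next
      case False
      have pp: "p permutes (set cs \<union> I)" "?c permutes (set cs \<union> I)"
        using p(2) cycle_permutes by (auto intro: permutes_subset)
      have fin: "finite (set cs \<union> I)" using p(1) by simp
      have I: "orbit ?q x = orbit p x" if "x \<in> I" for x
      proof (rule orbit_cong0[OF that, symmetric])
        show "p \<in> I \<rightarrow> I" using permutes_in_image[OF p(2)] by auto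
        show "p y = ?q y" if "y \<in> I" for y
          using permutes_in_image[OF p(2)] that comp.hyps(3) id_outside_supp[of "p y" cs] by (simp add: disjoint_iff) metis
      qed
      have c: "orbit ?q x = set cs" if "x \<in> set cs" for x
      proof -
        have "orbit ?c x = orbit ?q x"
        proof (rule orbit_cong0[OF that])
          show "?c \<in> set cs \<rightarrow> set cs" using permutes_in_image[OF cycle_permutes[of cs]] by auto
          show "?c y = ?q y" if "y \<in> set cs" for y
            using that comp.hyps(3) permutes_not_in[OF p(2), of y] by (simp add: disjoint_iff)
        qed
        then show ?thesis using orbit_cycle_of_list[OF comp.hyps(2) that] by simp
      qed
      have "orbit ?q ` (set cs \<union> I) = insert (set cs) (orbit p ` I)"
      proof -
        have "orbit ?q ` set cs = {set cs}" using False by (simp add: c image_constant_conv cong: image_cong)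
        moreover have "orbit ?q ` I = orbit p ` I" using I by (rule image_cong[OF refl])
        ultimately show ?thesis by (simp add: image_Un)
      qed
      moreover have "set cs \<notin> orbit p ` I"
      proof
        assume "set cs \<in> orbit p ` I"
        then obtain x where "x \<in> I" "set cs = orbit p x" by auto
        then have "set cs \<subseteq> I" using permutes_orbit_subset[OF p(2)] by auto
        then show False using False comp.hyps(3) by (metis inf.absorb1 set_empty)
      qed
      ultimately have orb: "card (orbit ?q ` (set cs \<union> I)) = Suc (card (orbit p ` I))"
        using p(1) by simp
      have crd: "card (set cs \<union> I) = length cs + card I"
        using comp.hyps p(1) by (simp add: card_Un_disjoint distinct_card)
      have "sign ?q = sign ?c * sign p"
        using permutation_of_cycle permutation_permutes p by (intro sign_compose) auto
      also have "\<dots> = (-1) ^ (length cs - 1) * (-1) ^ (card I + card (orbit p ` I))"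
        using sign_cycle_of_list[OF comp.hyps(2) False] p(3) by simp
      also have "\<dots> = (-1) ^ (card (set cs \<union> I) + card (orbit ?q ` (set cs \<union> I)))"
        unfolding orb crd using False by (cases cs) (simp_all add: power_add)
      finally show ?thesis using fin permutes_compose[OF pp] by blast
    qed
  qed
  then show ?thesis by simp
qed

text \<open>
  The moved points fall into transpositions; they are split off one at a time.
\<close>

lemma sign_involution:
  assumes "p permutes S" "finite S" "\<And>x. p (p x) = x" "card {x. p x \<noteq> x} = 2 * k"
  shows "sign p = (-1) ^ k"
  using assms
proof (induction k arbitrary: p)
  case 0
  have "finite {x. p x \<noteq> x}" using permutes_not_in[OF 0(1)] by (intro finite_subset[OF _ 0(2)]) auto
  then have "p = id" using 0(4) by auto
  then show ?case by simp
next
  case (Suc k)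
  have fin: "finite {x. p x \<noteq> x}" using permutes_not_in[OF Suc.prems(1)] by (intro finite_subset[OF _ Suc.prems(2)]) auto
  have "{x. p x \<noteq> x} \<noteq> {}"
  proof
    assume "{x. p x \<noteq> x} = {}"
    then show False using Suc.prems(4) by (simp only: card.empty) simp
  qed
  then obtain x where x: "p x \<noteq> x" by auto
  then have xS: "x \<in> S" "p x \<in> S"
    using permutes_not_in[OF Suc.prems(1)] permutes_in_image[OF Suc.prems(1)] by auto
  let ?t = "Transposition.transpose x (p x)"
  let ?q = "?t \<circ> p"
  have inv: "p (p y) = y" for y by fact
  have peq: "p y = p z \<longleftrightarrow> y = z" for y z using inv by metis
  have q: "?q y = (if y = x \<or> y = p x then y else p y)" for y
  proof -
    consider "y = x" | "y = p x" | "y \<noteq> x" "y \<noteq> p x" by blast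
    then show ?thesis
    proof cases
      case 3
      then have "p y \<noteq> x" "p y \<noteq> p x" using inv by metis+
      then show ?thesis using 3 by simp
    qed (simp_all add: inv)
  qed
  have tp: "?t permutes S" using xS by (rule permutes_swap_id)
  have "sign ?q = (-1) ^ k"
  proof (rule Suc.IH)
    show "?q permutes S" using Suc.prems(1) tp by (rule permutes_compose)
    show "?q (?q y) = y" for y
      unfolding q using peq[of y x] inv[of x] inv[of y] peq[of y "p x"] by (auto simp: inv)
    have "{y. ?q y \<noteq> y} = {y. p y \<noteq> y} - {x, p x}" unfolding q using inv[of x] by auto
    moreover have "{x, p x} \<subseteq> {y. p y \<noteq> y}" using x inv[of x] by auto
    ultimately show "card {y. ?q y \<noteq> y} = 2 * k"
      using Suc.prems(4) fin x by (simp add: card_Diff_subset)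
  qed fact
  moreover have "sign ?q = sign ?t * sign p"
    using tp Suc.prems(1,2) permutation_permutes by (intro sign_compose) blast+
  ultimately show ?case using x by (simp add: sign_swap_id)
qed

section \<open>Two matchings on a finite set\<close>

locale matching_pair =
  fixes W :: "'a set" and \<nu> \<rho> :: "'a \<Rightarrow> 'a"
  assumes finite_W: "finite W"
    and nu_perm: "\<nu> permutes W" and rho_perm: "\<rho> permutes W"
    and nu_nu [simp]: "\<nu> (\<nu> x) = x" and rho_rho [simp]: "\<rho> (\<rho> x) = x"
    and nu_neq: "x \<in> W \<Longrightarrow> \<nu> x \<noteq> x" and rho_neq: "x \<in> W \<Longrightarrow> \<rho> x \<noteq> x"
begin

definition joins :: "('a \<times> 'a) set" where
  "joins = {(x, \<nu> x) | x. x \<in> W} \<union> {(x, \<rho> x) | x. x \<in> W}"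

text \<open>
  Two steps along a component of the graph formed by the two matchings.
\<close>

definition turn :: "'a \<Rightarrow> 'a" where "turn = \<rho> \<circ> \<nu>"

definition alternating :: "('a \<Rightarrow> bool) \<Rightarrow> bool" where
  "alternating \<beta> \<longleftrightarrow> (\<forall>x\<in>W. \<beta> (\<nu> x) \<noteq> \<beta> x \<and> \<beta> (\<rho> x) \<noteq> \<beta> x)"

lemma nu_in_W [simp]: "\<nu> x \<in> W \<longleftrightarrow> x \<in> W"
  using permutes_in_image[OF nu_perm] by simp
lemma rho_in_W [simp]: "\<rho> x \<in> W \<longleftrightarrow> x \<in> W"
  using permutes_in_image[OF rho_perm] by simp

lemma joins_iff: "(x, y) \<in> joins \<longleftrightarrow> x \<in> W \<and> (y = \<nu> x \<or> y = \<rho> x)"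
  by (auto simp: joins_def)

lemma sym_joins: "sym joins"
  by (rule symI) (auto simp: joins_iff)

lemma joins_rtrancl_in_W: "(x, y) \<in> joins\<^sup>* \<Longrightarrow> x \<in> W \<Longrightarrow> y \<in> W"
  by (induction rule: rtrancl_induct) (auto simp: joins_iff)

lemma joins_rtrancl_sym: "(x, y) \<in> joins\<^sup>* \<Longrightarrow> (y, x) \<in> joins\<^sup>*"
  using sym_rtrancl[OF sym_joins] by (auto dest: symD)

lemma turn_perm: "turn permutes W"
  unfolding turn_def by (rule permutes_compose[OF nu_perm rho_perm])

lemma turn_in_W: "turn x \<in> W \<longleftrightarrow> x \<in> W"
  by (simp add: turn_def)

lemma permutation_turn: "permutation turn"
  using turn_perm finite_W permutation_permutes by blast

lemma turn_step_iff: "turn y \<in> orbit turn x \<longleftrightarrow> y \<in> orbit turn x"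
proof
  assume "turn y \<in> orbit turn x"
  then have "orbit turn (turn y) = orbit turn x"
    using orbit_cyclic_eq3[OF cyclic_on_orbit'[OF permutation_turn]] by blast
  then show "y \<in> orbit turn x"
    using permutation_orbit_step[OF permutation_turn, of y] permutation_self_in_orbit[OF permutation_turn, of y] by simp
qed (rule orbit.step)

text \<open>
  The maps \<open>\<nu> \<circ> turn ^^ k\<close> are the reflections of a dihedral group.  Each of them is conjugate to \<open>\<nu>\<close> or
  to \<open>\<rho>\<close>, and so has no fixed point in \<open>W\<close>; conjugation by one step lowers \<open>k\<close> by two.
\<close>

lemma nu_neq_turn_power: "x \<in> W \<Longrightarrow> \<nu> x \<noteq> (turn ^^ k) x"
proof (induction k arbitrary: x rule: less_induct)
  case (less k)
  show ?case
  proof (cases k)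
    case 0 then show ?thesis using nu_neq[OF less.prems] by simp
  next
    case (Suc k')
    show ?thesis
    proof (cases k')
      case 0
      then show ?thesis using Suc rho_neq[of "\<nu> x"] less.prems by (simp add: turn_def)
    next
      case (Suc i)
      have kk: "k = Suc (Suc i)" using Suc \<open>k = Suc k'\<close> by simp
      show ?thesis
      proof
        assume eq: "\<nu> x = (turn ^^ k) x"
        \<comment> \<open>As \<open>\<nu> \<circ> \<rho>\<close> undoes a step, the equation for \<open>k\<close> at \<open>x\<close> becomes the one
          for \<open>k - 2\<close> at \<open>turn x\<close>.\<close>
        have "\<nu> (turn x) = \<nu> (\<rho> (\<nu> x))" by (simp add: turn_def)
        also have "\<dots> = \<nu> (\<rho> (turn ((turn ^^ i) (turn x))))"
          unfolding eq kk by (simp add: funpow_swap1)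
        also have "\<dots> = (turn ^^ i) (turn x)" by (simp add: turn_def)
        finally show False using less.IH[of i "turn x"] less.prems kk by (simp add: turn_in_W)
      qed
    qed
  qed
qed

lemma nu_notin_orbit:
  assumes "x \<in> W" "x \<in> orbit turn r"
  shows "\<nu> x \<notin> orbit turn r"
proof
  assume "\<nu> x \<in> orbit turn r"
  then have "\<nu> x \<in> orbit turn x"
    using orbit_cyclic_eq3[OF cyclic_on_orbit'[OF permutation_turn] assms(2)] by simp
  then show False using nu_neq_turn_power[OF assms(1)] unfolding orbit_altdef by auto
qed

text \<open>
  A component consists of the orbit of one of its points under \<open>turn\<close> and the image of that
  orbit under \<open>\<nu>\<close>.  By the preceding lemma the two are disjoint.
\<close>

lemma connected_orbit_cases:
  assumes "(r, x) \<in> joins\<^sup>*"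
  shows "x \<in> orbit turn r \<or> \<nu> x \<in> orbit turn r"
  using assms
proof (induction rule: rtrancl_induct)
  case base then show ?case using permutation_self_in_orbit[OF permutation_turn] by simp
next
  case (step y z)
  have "turn (\<nu> y) = \<rho> y" "turn (\<nu> (\<rho> y)) = y" by (simp_all add: turn_def)
  then have "\<rho> y \<in> orbit turn r \<longleftrightarrow> \<nu> y \<in> orbit turn r" "\<nu> (\<rho> y) \<in> orbit turn r \<longleftrightarrow> y \<in> orbit turn r"
    using turn_step_iff[of "\<nu> y" r] turn_step_iff[of "\<nu> (\<rho> y)" r] by simp_all
  then show ?case using step by (auto simp: joins_iff)
qed

lemma class_eq_iff: "joins\<^sup>* `` {x} = joins\<^sup>* `` {y} \<longleftrightarrow> (x, y) \<in> joins\<^sup>*"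
  using joins_rtrancl_sym by (auto intro: rtrancl_trans)

text \<open>
  In every component, colour the orbit of a representative under \<open>turn\<close> with one colour and
  its image under \<open>\<nu>\<close> with the other.
\<close>

lemma alternating_exists: "\<exists>\<beta>. alternating \<beta>"
proof -
  \<comment> \<open>Only the component of \<open>x\<close> enters, so \<open>r\<close> picks one representative of each component.\<close>
  define r where "r x = (SOME y. (x, y) \<in> joins\<^sup>*)" for x
  have r: "(x, r x) \<in> joins\<^sup>*" for x unfolding r_def by (rule someI) (rule rtrancl_refl)
  have r_cong: "r x = r y" if "(x, y) \<in> joins" for x y
  proof -
    have xy: "(x, y) \<in> joins\<^sup>*" "(y, x) \<in> joins\<^sup>*" using that joins_rtrancl_sym by blast+
    have "(\<lambda>z. (x, z) \<in> joins\<^sup>*) = (\<lambda>z. (y, z) \<in> joins\<^sup>*)"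
      using rtrancl_trans[OF xy(1)] rtrancl_trans[OF xy(2)] by (intro ext iffI)
    then show ?thesis by (simp add: r_def)
  qed
  define \<beta> where "\<beta> x \<longleftrightarrow> x \<in> orbit turn (r x)" for x
  have xor: "x \<in> orbit turn (r x) \<longleftrightarrow> \<nu> x \<notin> orbit turn (r x)" if "x \<in> W" for x
    using connected_orbit_cases[OF joins_rtrancl_sym[OF r]] nu_notin_orbit[OF that] by metis
  have "alternating \<beta>"
    unfolding alternating_def
  proof (intro ballI conjI)
    fix x assume x: "x \<in> W"
    have rnu: "r (\<nu> x) = r x" "r (\<rho> x) = r x"
      using r_cong[of x "\<nu> x"] r_cong[of x "\<rho> x"] x by (simp_all add: joins_iff)
    show "\<beta> (\<nu> x) \<noteq> \<beta> x" using xor[OF x] by (simp add: \<beta>_def rnu)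
    have "turn (\<nu> x) = \<rho> x" by (simp add: turn_def)
    then show "\<beta> (\<rho> x) \<noteq> \<beta> x"
      using xor[OF x] turn_step_iff[of "\<nu> x" "r x"] by (simp add: \<beta>_def rnu)
  qed
  then show ?thesis by blast
qed

lemma const_on_class:
  assumes "\<And>x. x \<in> W \<Longrightarrow> F (\<nu> x) = F x \<and> F (\<rho> x) = F x" "(x, y) \<in> joins\<^sup>*"
  shows "F y = F x"
  using assms(2) by (induction rule: rtrancl_induct) (auto simp: joins_iff assms(1))

text \<open>
  Comparing with a fixed alternating colouring turns the condition on the booleans into being constant
  on components, so a label is a free choice of an index and a boolean for each component.
\<close>

lemma card_alternating_labels:
  fixes L :: "'c::finite itself"
  shows "card {S \<in> PiE W (\<lambda>_. UNIV :: ('c \<times> bool) set).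
      \<forall>x\<in>W. fst (S (\<nu> x)) = fst (S x) \<and> fst (S (\<rho> x)) = fst (S x) \<and>
        snd (S (\<nu> x)) \<noteq> snd (S x) \<and> snd (S (\<rho> x)) \<noteq> snd (S x)} =
    (2 * CARD('c)) ^ card (W // joins\<^sup>*)" (is "card ?A = _")
proof -
  obtain \<beta> where \<beta>: "alternating \<beta>" using alternating_exists by blast
  let ?cl = "\<lambda>x. joins\<^sup>* `` {x}"
  let ?G = "PiE (W // joins\<^sup>*) (\<lambda>_. UNIV :: ('c \<times> bool) set)"
  \<comment> \<open>For a fixed \<open>x\<close> this is an involution; it converts alternating booleans into constant ones and back.\<close>
  define tw where "tw x p = (fst p, snd p \<noteq> \<beta> x)" for x and p :: "'c \<times> bool"
  have tw_tw: "tw x (tw x p) = p" for x p by (simp add: tw_def prod_eq_iff) auto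
  define \<Phi> where "\<Phi> G = (\<lambda>x\<in>W. tw x (G (?cl x)))" for G :: "'a set \<Rightarrow> 'c \<times> bool"
  define \<Psi> where "\<Psi> S = (\<lambda>F\<in>W // joins\<^sup>*. let x = (SOME x. x \<in> F) in tw x (S x))" for S :: "'a \<Rightarrow> 'c \<times> bool"
  have some: "(x, SOME y. y \<in> ?cl x) \<in> joins\<^sup>*" for x
  proof -
    have "x \<in> ?cl x" by simp
    then have "(SOME y. y \<in> ?cl x) \<in> ?cl x" by (rule someI)
    then show ?thesis by simp
  qed
  have "bij_betw \<Phi> ?G ?A"
  proof (rule bij_betw_byWitness[where f' = \<Psi>])
    show "\<forall>G\<in>?G. \<Psi> (\<Phi> G) = G"
    proof
      fix G assume G: "G \<in> ?G"
      show "\<Psi> (\<Phi> G) = G"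
      proof
        fix F show "\<Psi> (\<Phi> G) F = G F"
        proof (cases "F \<in> W // joins\<^sup>*")
          case True
          then obtain x where x: "x \<in> W" "F = ?cl x" by (auto elim: quotientE)
          let ?y = "SOME y. y \<in> F"
          have y: "(x, ?y) \<in> joins\<^sup>*" using some[of x] x by simp
          then have "?cl ?y = F" "?y \<in> W" using x class_eq_iff joins_rtrancl_in_W by blast+
          then show ?thesis using True by (simp add: \<Psi>_def \<Phi>_def tw_tw Let_def)
        next
          case False then show ?thesis using PiE_arb[OF G] by (simp add: \<Psi>_def)
        qed
      qed
    qed
    show "\<forall>S\<in>?A. \<Phi> (\<Psi> S) = S"
    proof
      fix S assume S: "S \<in> ?A"
      have const: "tw y (S y) = tw x (S x)" if "(x, y) \<in> joins\<^sup>*" for x y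
        by (rule const_on_class[where F = "\<lambda>x. tw x (S x)", OF _ that])
          (use S \<beta> in \<open>auto simp: tw_def alternating_def\<close>)
      show "\<Phi> (\<Psi> S) = S"
      proof
        fix x show "\<Phi> (\<Psi> S) x = S x"
        proof (cases "x \<in> W")
          case True
          then have "\<Psi> S (?cl x) = tw x (S x)"
            using const[OF some[of x]] by (simp add: \<Psi>_def quotientI Let_def)
          then show ?thesis using True by (simp add: \<Phi>_def tw_tw)
        next
          case False
          moreover have "S \<in> PiE W (\<lambda>_. UNIV)" using S by simp
          ultimately show ?thesis using PiE_arb[of S W] by (simp add: \<Phi>_def)
        qed
      qed
    qed
    show "\<Phi> ` ?G \<subseteq> ?A"
    proof (intro image_subsetI CollectI conjI ballI)
      fix G x assume x: "x \<in> W"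
      have "?cl (\<nu> x) = ?cl x" "?cl (\<rho> x) = ?cl x"
        using x class_eq_iff joins_rtrancl_sym r_into_rtrancl[of "(x, \<nu> x)" joins] r_into_rtrancl[of "(x, \<rho> x)" joins]
        by (auto simp: joins_iff)
      moreover have "\<beta> (\<nu> x) = (\<not> \<beta> x)" "\<beta> (\<rho> x) = (\<not> \<beta> x)" using \<beta> x by (auto simp: alternating_def)
      ultimately show "fst (\<Phi> G (\<nu> x)) = fst (\<Phi> G x)" "fst (\<Phi> G (\<rho> x)) = fst (\<Phi> G x)"
        "snd (\<Phi> G (\<nu> x)) \<noteq> snd (\<Phi> G x)" "snd (\<Phi> G (\<rho> x)) \<noteq> snd (\<Phi> G x)"
        using x by (simp_all add: \<Phi>_def tw_def)
    qed (simp add: \<Phi>_def)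
    show "\<Psi> ` ?A \<subseteq> ?G" by (auto simp: \<Psi>_def)
  qed
  then have "card ?A = card ?G" by (rule bij_betw_same_card[symmetric])
  also have "\<dots> = (2 * CARD('c)) ^ card (W // joins\<^sup>*)"
  proof -
    have "finite (W // joins\<^sup>*)" using finite_W by (simp add: quotient_def)
    then show ?thesis by (simp add: card_PiE mult.commute flip: UNIV_Times_UNIV)
  qed
  finally show ?thesis .
qed

text \<open>
  Within one colour class the components are exactly the orbits of \<open>turn\<close>.
\<close>

lemma card_classes_eq_orbits:
  assumes "alternating \<beta>"
  defines "A \<equiv> {x \<in> W. \<beta> x}"
  shows "card (W // joins\<^sup>*) = card (orbit turn ` A)"
proof -
  let ?cl = "\<lambda>x. joins\<^sup>* `` {x}"
  have turnA: "turn x \<in> A" "(x, turn x) \<in> joins\<^sup>*" if "x \<in> A" for x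
  proof -
    have x: "x \<in> W" "\<nu> x \<in> W" using that by (auto simp: A_def)
    then have "\<beta> (\<rho> (\<nu> x)) = \<beta> x" using assms(1) by (auto simp: alternating_def)
    then show "turn x \<in> A" using that by (simp add: A_def turn_def)
    have "(x, \<nu> x) \<in> joins" "(\<nu> x, \<rho> (\<nu> x)) \<in> joins" using x by (simp_all add: joins_iff)
    then show "(x, turn x) \<in> joins\<^sup>*" by (simp add: turn_def)
  qed
  have clA: "?cl x \<inter> A = orbit turn x" if x: "x \<in> A" for x
  proof
    show orb: "orbit turn x \<subseteq> ?cl x \<inter> A"
    proof
      fix y assume "y \<in> orbit turn x"
      then show "y \<in> ?cl x \<inter> A"
        by induction (use turnA x in \<open>auto intro: rtrancl_trans\<close>)
    qed
    show "?cl x \<inter> A \<subseteq> orbit turn x"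
    proof
      fix y assume y: "y \<in> ?cl x \<inter> A"
      then have "\<nu> y \<notin> A" using assms(1) by (auto simp: A_def alternating_def)
      then show "y \<in> orbit turn x" using connected_orbit_cases[of x y] y orb by blast
    qed
  qed
  have "W // joins\<^sup>* = ?cl ` A"
  proof
    show "?cl ` A \<subseteq> W // joins\<^sup>*" by (auto simp: A_def intro: quotientI)
    show "W // joins\<^sup>* \<subseteq> ?cl ` A"
    proof
      fix F assume "F \<in> W // joins\<^sup>*"
      then obtain x where x: "x \<in> W" "F = ?cl x" by (auto elim: quotientE)
      have "(x, \<nu> x) \<in> joins\<^sup>*" using x by (auto simp: joins_iff)
      then have "?cl (\<nu> x) = F" using class_eq_iff x joins_rtrancl_sym by blast
      moreover have "x \<in> A \<or> \<nu> x \<in> A" using x assms(1) by (auto simp: A_def alternating_def)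
      ultimately show "F \<in> ?cl ` A" using x by blast
    qed
  qed
  moreover have "inj_on (\<lambda>F. F \<inter> A) (?cl ` A)"
  proof (rule inj_onI)
    fix F F' assume "F \<in> ?cl ` A" "F' \<in> ?cl ` A" and eq: "F \<inter> A = F' \<inter> A"
    then obtain x y where x: "x \<in> A" "F = ?cl x" and y: "y \<in> A" "F' = ?cl y" by auto
    have "x \<in> ?cl y" using eq x y by auto
    then show "F = F'" using class_eq_iff[of y x] x y by simp
  qed
  ultimately have "card (W // joins\<^sup>*) = card ((\<lambda>F. F \<inter> A) ` ?cl ` A)" by (simp add: card_image)
  also have "(\<lambda>F. F \<inter> A) ` ?cl ` A = orbit turn ` A"
    unfolding image_image by (rule image_cong[OF refl clA])
  finally show ?thesis .
qed

text \<open>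
  Let \<open>Q\<close> respect the colours and carry the matching \<open>\<nu>\<close> to the matching \<open>\<rho>\<close>.  On the
  second colour class \<open>Q\<close> is determined by its values on the first: conjugating by \<open>\<nu>\<close> moves it to
  the first class, where it differs from \<open>Q\<close> by \<open>turn\<close>.  So the two halves of \<open>Q\<close> differ in sign by the
  sign of \<open>turn\<close> on one class, whose orbits there are the components.
\<close>

lemma sign_eq_classes:
  assumes \<beta>: "alternating \<beta>"
  defines "A \<equiv> {x \<in> W. \<beta> x}"
  assumes Q: "Q permutes W" "\<And>x. x \<in> W \<Longrightarrow> \<beta> (Q x) = \<beta> x" "\<And>x. Q (\<nu> x) = \<rho> (Q x)"
  shows "sign Q = (-1) ^ (card A + card (W // joins\<^sup>*))"
proof -
  let ?pA = "perm_restrict turn A" and ?QA = "perm_restrict Q A" and ?QB = "perm_restrict Q (W - A)"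
  have flip: "\<beta> (\<nu> x) = (\<not> \<beta> x)" "\<beta> (\<rho> x) = (\<not> \<beta> x)" if "x \<in> W" for x
    using \<beta> that by (auto simp: alternating_def)
  have QW: "Q x \<in> W \<longleftrightarrow> x \<in> W" for x using permutes_in_image[OF Q(1)] by simp
  have restr: "perm_restrict g B permutes B" if "g permutes W" "B \<subseteq> W" "\<And>x. x \<in> B \<Longrightarrow> g x \<in> B" for g B
  proof (rule bij_imp_permutes)
    have inj: "inj_on g B" using permutes_inj[OF that(1)] inj_on_subset by blast
    have "finite B" using that(2) finite_W finite_subset by blast
    then have "g ` B = B" using endo_inj_surj[of B g] inj that(3) by blast
    then show "bij_betw (perm_restrict g B) B B"
      using inj by (auto simp: bij_betw_def perm_restrict_def inj_on_def image_def)
  qed (simp add: perm_restrict_simps)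
  have pA: "?pA permutes A"
    by (rule restr[OF turn_perm]) (auto simp: A_def turn_def flip)
  have QA: "?QA permutes A"
    by (rule restr[OF Q(1)]) (simp_all add: A_def Q(2) QW)
  have QB: "?QB permutes (W - A)"
    by (rule restr[OF Q(1)]) (simp_all add: A_def Q(2) QW)
  have finA: "finite A" using finite_W by (simp add: A_def)
  have perm: "permutation ?pA" "permutation ?QA" "permutation ?QB" "permutation \<nu>"
    using pA QA QB nu_perm finite_W finA permutation_permutes finite_Diff by blast+
  have "?QA \<circ> ?QB = Q"
  proof -
    have "?QA \<circ> ?QB = perm_restrict Q (A \<union> (W - A))" by (rule perm_restrict_union[OF QA QB]) auto
    also have "A \<union> (W - A) = W" by (auto simp: A_def)
    finally show ?thesis by (simp only: perm_restrict_id[OF Q(1)])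
  qed
  then have 1: "sign Q = sign ?QA * sign ?QB" using sign_compose[OF perm(2,3)] by simp
  \<comment> \<open>On the first class \<open>?QB \<circ> \<nu>\<close> is \<open>Q \<circ> \<nu> = \<rho> \<circ> Q\<close>, and \<open>turn \<circ> \<nu>\<close> is \<open>\<rho>\<close>, which cancels it.\<close>
  have "?pA \<circ> (\<nu> \<circ> (?QB \<circ> \<nu>)) = ?QA"
  proof
    fix x
    consider "x \<in> A" | "x \<in> W" "x \<notin> A" | "x \<notin> W" by blast
    then show "(?pA \<circ> (\<nu> \<circ> (?QB \<circ> \<nu>))) x = ?QA x"
    proof cases
      case 1
      then have x: "x \<in> W" "\<beta> x" by (auto simp: A_def)
      have "?QB (\<nu> x) = \<rho> (Q x)" using x by (simp add: perm_restrict_def A_def flip Q(3))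
      moreover have "\<nu> (\<rho> (Q x)) \<in> A" using x by (simp add: A_def flip QW Q(2))
      ultimately show ?thesis using 1 by (simp add: perm_restrict_simps turn_def)
    next
      case 2
      then have "\<nu> x \<in> A" by (simp add: A_def flip)
      then show ?thesis using 2 by (simp add: perm_restrict_def)
    next
      case 3
      then have "\<nu> x = x" using permutes_not_in[OF nu_perm] by simp
      then show ?thesis using 3 by (simp add: perm_restrict_def A_def)
    qed
  qed
  moreover have "sign (?pA \<circ> (\<nu> \<circ> (?QB \<circ> \<nu>))) = sign ?pA * (sign \<nu> * (sign ?QB * sign \<nu>))"
    by (subst sign_compose | intro perm permutation_compose | rule refl)+
  moreover have "sign \<nu> * (sign ?QB * sign \<nu>) = sign ?QB"
    by (simp only: mult.commute[of "sign ?QB"] sign_left_idempotent)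
  ultimately have 2: "sign ?QA = sign ?pA * sign ?QB" by (simp only:)
  have orb: "orbit ?pA x = orbit turn x" if "x \<in> A" for x
  proof (rule orbit_cong0[OF that])
    show "?pA \<in> A \<rightarrow> A" using permutes_in_image[OF pA] by blast
  qed (simp add: perm_restrict_simps)
  have "sign Q = sign ?pA" using 1 2 by (simp add: mult.assoc)
  moreover have "sign ?pA = (-1) ^ (card A + card (orbit ?pA ` A))" by (rule sign_eq_orbits[OF pA finA])
  moreover have "orbit ?pA ` A = orbit turn ` A" by (rule image_cong[OF refl orb])
  moreover have "card (W // joins\<^sup>*) = card (orbit turn ` A)"
    unfolding A_def by (rule card_classes_eq_orbits[OF \<beta>])
  ultimately show ?thesis by (simp only:)
qed

end

section \<open>Ribbon graphs\<close>

lemma involution_permutes: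
  assumes "\<And>x. f (f x) = x" "\<And>x. x \<notin> S \<Longrightarrow> f x = x"
  shows "f permutes S"
  unfolding permutes_def using assms by metis

lemma UNIV_side: "(UNIV :: side set) = {LeftSide, RightSide}"
  using side.exhaust by auto

lemma finite_UNIV_side: "finite (UNIV :: side set)"
  by (simp add: UNIV_side)

fun opposite_side :: "side \<Rightarrow> side" where
  "opposite_side LeftSide = RightSide"
| "opposite_side RightSide = LeftSide"

lemma opposite_opposite [simp]: "opposite_side (opposite_side a) = a"
  by (cases a) simp_all

lemma opposite_side_neq [simp]: "opposite_side a \<noteq> a" "a \<noteq> opposite_side a"
  by (cases a; simp)+

text \<open>
  A Moebius graph on the half-edges \<open>H\<close> with rotation \<open>\<sigma>\<close> at the vertices, edges \<open>E\<close> and twisted edges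
  \<open>T\<close>.  Its points are the sides of half-edges, and its faces are the components formed by two
  perfect matchings of these points.
\<close>

locale ribbon_graph =
  fixes H :: "nat set" and \<sigma> :: "nat \<Rightarrow> nat" and E T :: "nat set set"
  assumes finite_H: "finite H" and sigma_perm: "\<sigma> permutes H" and E: "E \<in> pairings H" and T: "T \<subseteq> E"
begin

definition W :: "(nat \<times> side) set" where "W = H \<times> UNIV"

definition partner :: "nat \<Rightarrow> nat" where
  "partner l = (if l \<in> H then THE l'. l' \<noteq> l \<and> {l, l'} \<in> E else l)"

definition twisted :: "nat \<Rightarrow> bool" where
  "twisted l \<longleftrightarrow> {l, partner l} \<in> T"

lemma partner_unique:
  assumes "{l, l'} \<in> E" "{l, l''} \<in> E" "l' \<noteq> l" "l'' \<noteq> l"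
  shows "l' = l''"
proof -
  have "{l, l'} = {l, l''}"
  proof (rule ccontr)
    assume "{l, l'} \<noteq> {l, l''}"
    moreover have "disjoint E" using pairingsD(1)[OF E] by (simp add: partition_on_def)
    ultimately have "{l, l'} \<inter> {l, l''} = {}" using assms(1,2) disjointD by metis
    then show False by simp
  qed
  then show ?thesis using assms(3,4) by (simp add: doubleton_eq_iff)
qed

lemma partner:
  assumes "l \<in> H"
  shows "partner l \<noteq> l" "{l, partner l} \<in> E"
proof -
  obtain e where e: "e \<in> E" "l \<in> e" using pairingsD(5)[OF E] assms by blast
  have "card e = 2" using pairingsD(2)[OF E e(1)] .
  then obtain l' where l': "e = {l, l'}" "l' \<noteq> l"
  proof -
    obtain x y where "e = {x, y}" "x \<noteq> y" using \<open>card e = 2\<close> by (auto simp: card_2_iff)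
    then show thesis using e(2) that[of x] that[of y] by (cases "l = x") (simp_all add: insert_commute)
  qed
  have "partner l = l'"
  proof -
    have "{l, l'} \<in> E" using e l' by simp
    then have "(THE l'. l' \<noteq> l \<and> {l, l'} \<in> E) = l'"
      using l'(2) partner_unique by (intro the_equality conjI) blast+
    then show ?thesis using assms by (simp add: partner_def)
  qed
  then show "partner l \<noteq> l" "{l, partner l} \<in> E" using e(1) l' by simp_all
qed

lemma partner_eqI: "{l, l'} \<in> E \<Longrightarrow> l' \<noteq> l \<Longrightarrow> partner l = l'"
  using partner_unique[of l "partner l" l'] partner[of l] pairingsD(3)[OF E] by blast

lemma partner_outside [simp]: "l \<notin> H \<Longrightarrow> partner l = l"
  by (simp add: partner_def)

lemma partner_partner [simp]: "partner (partner l) = l"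
proof (cases "l \<in> H")
  case True
  then have "{partner l, l} \<in> E" "l \<noteq> partner l" using partner[OF True] by (auto simp: insert_commute)
  then show ?thesis by (rule partner_eqI)
qed simp

lemma partner_in_H [simp]: "partner l \<in> H \<longleftrightarrow> l \<in> H"
  by (metis partner_outside partner_partner)

lemma twisted_partner [simp]: "twisted (partner l) \<longleftrightarrow> twisted l"
  unfolding twisted_def partner_partner by (subst insert_commute) (rule refl)

lemma partner_Min_Max:
  assumes "e \<in> E"
  shows "Min e \<in> H" "Max e \<in> H" "partner (Min e) = Max e" "partner (Max e) = Min e" "Min e < Max e"
    "twisted (Min e) \<longleftrightarrow> e \<in> T" "twisted (Max e) \<longleftrightarrow> e \<in> T"
proof -
  note mM = pairing_Min_Max[OF pairingsD(2)[OF E assms]]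
  show H: "Min e \<in> H" "Max e \<in> H" using mM(1,2) pairingsD(3)[OF E assms] by blast+
  show p: "partner (Min e) = Max e"
    by (rule partner_eqI) (simp_all only: mM(4) assms mM(3)[symmetric] not_False_eq_True)
  show "partner (Max e) = Min e" using p partner_partner by metis
  show "Min e < Max e" by (rule mM(5))
  show tw: "twisted (Min e) \<longleftrightarrow> e \<in> T" unfolding twisted_def p mM(4) ..
  show "twisted (Max e) \<longleftrightarrow> e \<in> T" using twisted_partner[of "Min e"] p tw by simp
qed

text \<open>
  The reference matching, which pairs the two sides of each half-edge.  The vertex joins and the ribbon
  joins are both obtained from it by conjugation.
\<close>

definition corner_flip :: "nat \<times> side \<Rightarrow> nat \<times> side" where
  "corner_flip x = (if fst x \<in> H then (fst x, opposite_side (snd x)) else x)"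

definition vertex_join :: "nat \<times> side \<Rightarrow> nat \<times> side" where
  "vertex_join x = (if fst x \<in> H then
     (case snd x of LeftSide \<Rightarrow> (\<sigma> (fst x), RightSide) | RightSide \<Rightarrow> (inv \<sigma> (fst x), LeftSide)) else x)"

definition ribbon_join :: "nat \<times> side \<Rightarrow> nat \<times> side" where
  "ribbon_join x = (if fst x \<in> H then
     (partner (fst x), if twisted (fst x) then snd x else opposite_side (snd x)) else x)"

text \<open>
  This permutation carries \<open>corner_flip\<close> to the vertex joins.
\<close>

definition rotate_right_sides :: "nat \<times> side \<Rightarrow> nat \<times> side" where
  "rotate_right_sides x = (if snd x = RightSide then (\<sigma> (fst x), RightSide) else x)"

text \<open>
  A twisted ribbon is treated asymmetrically: its end with the larger number is singled out.
\<close>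

definition upper_twisted :: "nat \<Rightarrow> bool" where
  "upper_twisted l \<longleftrightarrow> twisted l \<and> partner l < l"

definition moved_side :: "nat \<Rightarrow> side" where
  "moved_side l = (if upper_twisted l then LeftSide else RightSide)"

text \<open>
  One transposition for each ribbon suffices to carry \<open>corner_flip\<close> to the ribbon joins.  For an
  untwisted ribbon it exchanges the right sides of the two ends; for a twisted one it exchanges the
  right side of the lower end with the left side of the upper end.
\<close>

definition half_ribbon_swap :: "nat \<times> side \<Rightarrow> nat \<times> side" where
  "half_ribbon_swap x = (if fst x \<in> H \<and> snd x = moved_side (fst x)
     then (partner (fst x), moved_side (partner (fst x))) else x)"

text \<open>
  These permutations commute with \<open>corner_flip\<close>.  They serve to make the left sides correspond to the
  sides of one colour.
\<close>

definition flip_on :: "nat set \<Rightarrow> nat \<times> side \<Rightarrow> nat \<times> side" where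
  "flip_on D x = (if fst x \<in> D then (fst x, opposite_side (snd x)) else x)"

lemma finite_W: "finite W"
  by (simp add: W_def finite_H finite_UNIV_side)

lemma sigma_in_H [simp]: "\<sigma> l \<in> H \<longleftrightarrow> l \<in> H" "inv \<sigma> l \<in> H \<longleftrightarrow> l \<in> H"
  using permutes_in_image[OF sigma_perm] permutes_in_image[OF permutes_inv[OF sigma_perm]] by auto

lemma vertex_join_vertex_join: "vertex_join (vertex_join x) = x"
  by (cases x; cases "snd x") (auto simp: vertex_join_def permutes_inverses[OF sigma_perm])

lemma ribbon_join_ribbon_join: "ribbon_join (ribbon_join x) = x"
  by (cases x) (auto simp: ribbon_join_def)

sublocale matching_pair W vertex_join ribbon_join
proof
  show "finite W" by (rule finite_W)
  show "vertex_join permutes W"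
    by (rule involution_permutes[OF vertex_join_vertex_join]) (auto simp: vertex_join_def W_def)
  show "ribbon_join permutes W"
    by (rule involution_permutes[OF ribbon_join_ribbon_join]) (auto simp: ribbon_join_def W_def)
  show "vertex_join (vertex_join x) = x" for x by (rule vertex_join_vertex_join)
  show "ribbon_join (ribbon_join x) = x" for x by (rule ribbon_join_ribbon_join)
  show "vertex_join x \<noteq> x" if "x \<in> W" for x
    using that by (cases x; cases "snd x") (auto simp: vertex_join_def W_def)
  show "ribbon_join x \<noteq> x" if "x \<in> W" for x
    using that partner(1)[of "fst x"] by (cases x) (auto simp: ribbon_join_def W_def)
qed

lemma rotate_right_sides_eq: "rotate_right_sides = map_permutation H (\<lambda>l. (l, RightSide)) \<sigma>"
proof
  fix x :: "nat \<times> side"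
  have inj: "inj_on (\<lambda>l. (l, RightSide)) H" by (auto simp: inj_on_def)
  show "rotate_right_sides x = map_permutation H (\<lambda>l. (l, RightSide)) \<sigma> x"
  proof (cases "x \<in> (\<lambda>l. (l, RightSide)) ` H")
    case True
    then obtain l where l: "l \<in> H" "x = (l, RightSide)" by auto
    then show ?thesis
      using inv_into_f_f[OF inj l(1)] by (simp add: map_permutation_def rotate_right_sides_def restrict_id_simps)
  next
    case False
    then show ?thesis using permutes_not_in[OF sigma_perm]
      by (cases x) (auto simp: map_permutation_def rotate_right_sides_def restrict_id_simps)
  qed
qed

lemma rotate_right_sides_perm: "rotate_right_sides permutes W" and sign_rotate_right_sides: "sign rotate_right_sides = sign \<sigma>"
proof -
  have inj: "inj_on (\<lambda>l. (l, RightSide)) H" by (auto simp: inj_on_def)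
  have "bij_betw (\<lambda>l. (l, RightSide)) H ((\<lambda>l. (l, RightSide)) ` H)" using inj by (simp add: bij_betw_def)
  then have "rotate_right_sides permutes ((\<lambda>l. (l, RightSide)) ` H)"
    unfolding rotate_right_sides_eq by (rule map_permutation_permutes[OF _ sigma_perm])
  then show "rotate_right_sides permutes W" by (rule permutes_subset) (auto simp: W_def)
  show "sign rotate_right_sides = sign \<sigma>"
    unfolding rotate_right_sides_eq by (rule sign_map_permutation[OF inj sigma_perm finite_H])
qed

lemma vertex_join_rotate_right_sides: "vertex_join (rotate_right_sides x) = rotate_right_sides (corner_flip x)"
  by (cases x; cases "snd x")
    (auto simp: vertex_join_def rotate_right_sides_def corner_flip_def permutes_inverses[OF sigma_perm]
      permutes_not_in[OF sigma_perm])

lemma half_ribbon_swap_involution: "half_ribbon_swap (half_ribbon_swap x) = x"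
  by (cases x) (auto simp: half_ribbon_swap_def)

lemma half_ribbon_swap_perm: "half_ribbon_swap permutes W"
  by (rule involution_permutes[OF half_ribbon_swap_involution]) (auto simp: half_ribbon_swap_def W_def)

lemma moved_side_partner:
  "l \<in> H \<Longrightarrow> moved_side (partner l) = (if twisted l then opposite_side (moved_side l) else moved_side l)"
  using partner(1)[of l] by (auto simp: moved_side_def upper_twisted_def)

lemma ribbon_join_half_ribbon_swap: "ribbon_join (half_ribbon_swap x) = half_ribbon_swap (corner_flip x)"
proof (cases "fst x \<in> H")
  case True
  obtain l a where x: "x = (l, a)" by (cases x)
  have l: "l \<in> H" using True x by simp
  let ?s = "moved_side l"
  note mp = moved_side_partner[OF l]
  show ?thesis
  proof (cases "a = ?s")
    case True
    have "ribbon_join (half_ribbon_swap x) = (l, opposite_side ?s)"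
      using l True by (simp add: x half_ribbon_swap_def ribbon_join_def mp)
    then show ?thesis using l True by (simp add: x half_ribbon_swap_def corner_flip_def)
  next
    case False
    then have a: "a = opposite_side ?s" by (cases a; cases ?s) simp_all
    have "ribbon_join (half_ribbon_swap x) = (partner l, moved_side (partner l))"
      using l by (simp add: x a half_ribbon_swap_def ribbon_join_def mp)
    then show ?thesis using l by (simp add: x a half_ribbon_swap_def corner_flip_def)
  qed
qed (simp add: ribbon_join_def half_ribbon_swap_def corner_flip_def)

lemma sign_half_ribbon_swap:
  assumes "card H = 2 * n"
  shows "sign half_ribbon_swap = (-1) ^ n"
proof (rule sign_involution[OF half_ribbon_swap_perm finite_W half_ribbon_swap_involution])
  have "{x. half_ribbon_swap x \<noteq> x} = (\<lambda>l. (l, moved_side l)) ` H"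
    using partner(1) by (auto simp: half_ribbon_swap_def)
  moreover have "inj_on (\<lambda>l. (l, moved_side l)) H" by (auto simp: inj_on_def)
  ultimately show "card {x. half_ribbon_swap x \<noteq> x} = 2 * n" using assms by (simp add: card_image)
qed

lemma flip_on_involution: "flip_on D (flip_on D x) = x"
  by (cases x) (auto simp: flip_on_def)

lemma flip_on_perm: "D \<subseteq> H \<Longrightarrow> flip_on D permutes W"
  by (rule involution_permutes[OF flip_on_involution]) (auto simp: flip_on_def W_def)

lemma sign_flip_on:
  assumes "D \<subseteq> H"
  shows "sign (flip_on D) = (-1) ^ card D"
proof (rule sign_involution[OF flip_on_perm[OF assms] finite_W flip_on_involution])
  have "{x. flip_on D x \<noteq> x} = D \<times> UNIV" by (auto simp: flip_on_def)
  then show "card {x. flip_on D x \<noteq> x} = 2 * card D" by (simp add: card_cartesian_product UNIV_side)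
qed

lemma corner_flip_flip_on: "D \<subseteq> H \<Longrightarrow> corner_flip (flip_on D x) = flip_on D (corner_flip x)"
  by (cases x) (auto simp: corner_flip_def flip_on_def)

lemma minus_one_power_card:
  assumes "D \<subseteq> H"
  shows "(-1 :: int) ^ card D = (\<Prod>l\<in>H. if l \<in> D then -1 else 1)"
  using finite_H assms by (simp add: prod.If_cases Int_absorb1)

text \<open>
  After correction by flips, \<open>rotate_right_sides\<close> and \<open>half_ribbon_swap\<close> both send the left sides to the
  sides of colour \<open>True\<close>, and their quotient carries vertex joins to ribbon joins.  Its sign is computed
  once from the faces and once from the four factors.  A half-edge needs either no flip at all or one
  in each factor, unless it is the upper end of a twisted ribbon.
\<close>

theorem ribbon_graph_sign:
  assumes \<beta>: "alternating \<beta>" and n: "card H = 2 * n"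
  shows "(-1) ^ card (W // joins\<^sup>*) = (-1) ^ n * sign \<sigma> *
    (\<Prod>e\<in>T. if \<beta> (Min e, LeftSide) = \<beta> (Min e, RightSide) then -1 else 1)"
proof -
  have flip: "\<beta> (vertex_join x) = (\<not> \<beta> x)" "\<beta> (ribbon_join x) = (\<not> \<beta> x)" if "x \<in> W" for x
    using \<beta> that by (auto simp: alternating_def)
  have swapW: "half_ribbon_swap x \<in> W \<longleftrightarrow> x \<in> W" "rotate_right_sides x \<in> W \<longleftrightarrow> x \<in> W" for x
    using permutes_in_image[OF half_ribbon_swap_perm] permutes_in_image[OF rotate_right_sides_perm] by auto
  define D\<^sub>1 where "D\<^sub>1 = {l \<in> H. \<not> \<beta> (rotate_right_sides (l, LeftSide))}"
  define D\<^sub>2 where "D\<^sub>2 = {l \<in> H. \<not> \<beta> (half_ribbon_swap (l, LeftSide))}"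
  have D: "D\<^sub>1 \<subseteq> H" "D\<^sub>2 \<subseteq> H" by (auto simp: D\<^sub>1_def D\<^sub>2_def)
  let ?N = "rotate_right_sides \<circ> flip_on D\<^sub>1" and ?R = "half_ribbon_swap \<circ> flip_on D\<^sub>2"
  have N: "?N permutes W" and R: "?R permutes W"
    using rotate_right_sides_perm half_ribbon_swap_perm flip_on_perm D by (auto intro: permutes_compose)
  have Nnu: "vertex_join (?N x) = ?N (corner_flip x)" and Rrho: "ribbon_join (?R x) = ?R (corner_flip x)" for x
    using D by (simp_all add: vertex_join_rotate_right_sides ribbon_join_half_ribbon_swap corner_flip_flip_on)
  have NL: "\<beta> (?N (l, LeftSide))" and RL: "\<beta> (?R (l, LeftSide))" if "l \<in> H" for l
  proof -
    have lW: "(l, LeftSide) \<in> W" using that by (simp add: W_def)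
    have "rotate_right_sides (l, RightSide) = vertex_join (rotate_right_sides (l, LeftSide))"
      "half_ribbon_swap (l, RightSide) = ribbon_join (half_ribbon_swap (l, LeftSide))"
      using that by (simp_all add: vertex_join_rotate_right_sides ribbon_join_half_ribbon_swap corner_flip_def)
    then show "\<beta> (?N (l, LeftSide))" "\<beta> (?R (l, LeftSide))"
      using that flip swapW lW by (auto simp: flip_on_def D\<^sub>1_def D\<^sub>2_def)
  qed
  have NW: "?N x \<in> W \<longleftrightarrow> x \<in> W" and RW: "?R x \<in> W \<longleftrightarrow> x \<in> W" for x
    using permutes_in_image[OF N] permutes_in_image[OF R] by auto
  have N_iff: "\<beta> (?N x) \<longleftrightarrow> snd x = LeftSide" and R_iff: "\<beta> (?R x) \<longleftrightarrow> snd x = LeftSide" if "x \<in> W" for x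
  proof -
    obtain l a where xla: "x = (l, a)" by (cases x)
    then have x: "x = (l, a)" "l \<in> H" using that by (simp_all add: W_def)
    have lW: "(l, LeftSide) \<in> W" using x by (simp add: W_def)
    show "\<beta> (?N x) \<longleftrightarrow> snd x = LeftSide"
    proof (cases a)
      case LeftSide then show ?thesis using NL x by simp
    next
      case RightSide
      then have "x = corner_flip (l, LeftSide)" using x by (simp add: corner_flip_def)
      then have "?N x = vertex_join (?N (l, LeftSide))" by (simp only: Nnu)
      then show ?thesis using flip(1)[of "?N (l, LeftSide)"] NW lW NL[OF x(2)] RightSide x(1) by simp
    qed
    show "\<beta> (?R x) \<longleftrightarrow> snd x = LeftSide"
    proof (cases a)
      case LeftSide then show ?thesis using RL x by simp
    next
      case RightSide
      then have "x = corner_flip (l, LeftSide)" using x by (simp add: corner_flip_def)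
      then have "?R x = ribbon_join (?R (l, LeftSide))" by (simp only: Rrho)
      then show ?thesis using flip(2)[of "?R (l, LeftSide)"] RW lW RL[OF x(2)] RightSide x(1) by simp
    qed
  qed
  let ?Q = "?R \<circ> inv ?N"
  have Q: "?Q permutes W" by (rule permutes_compose[OF permutes_inv[OF N] R])
  have invN: "inv ?N (?N x) = x" "?N (inv ?N x) = x" for x using permutes_inverses[OF N] by auto
  have invW: "inv ?N x \<in> W \<longleftrightarrow> x \<in> W" for x using NW[of "inv ?N x"] unfolding invN(2) by simp
  have sgn: "sign ?Q = (-1) ^ (card {x \<in> W. \<beta> x} + card (W // joins\<^sup>*))"
  proof (rule sign_eq_classes[OF \<beta> Q])
    show "\<beta> (?Q x) = \<beta> x" if "x \<in> W" for x
      using R_iff[of "inv ?N x"] N_iff[of "inv ?N x"] invW that unfolding invN(2) by simp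
    show "?Q (vertex_join x) = ribbon_join (?Q x)" for x
    proof -
      have "vertex_join x = ?N (corner_flip (inv ?N x))" using Nnu[of "inv ?N x"] unfolding invN(2) .
      then have "inv ?N (vertex_join x) = corner_flip (inv ?N x)" using invN(1) by metis
      then show ?thesis using Rrho[of "inv ?N x"] by simp
    qed
  qed
  have "{x \<in> W. \<beta> x} = ?N ` (H \<times> {LeftSide})"
  proof
    show "{x \<in> W. \<beta> x} \<subseteq> ?N ` (H \<times> {LeftSide})"
    proof
      fix x assume x: "x \<in> {x \<in> W. \<beta> x}"
      then have "inv ?N x \<in> W" "\<beta> (?N (inv ?N x))" using invW invN by auto
      then have "inv ?N x \<in> H \<times> {LeftSide}" using N_iff[of "inv ?N x"] by (cases "inv ?N x") (auto simp: W_def)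
      then show "x \<in> ?N ` (H \<times> {LeftSide})" using invN(2) by (metis image_eqI)
    qed
    show "?N ` (H \<times> {LeftSide}) \<subseteq> {x \<in> W. \<beta> x}"
    proof (rule image_subsetI)
      fix y assume y: "y \<in> H \<times> {LeftSide}"
      then have "?N y \<in> W" using NW[of y] by (auto simp: W_def)
      moreover have "\<beta> (?N y)" using y NL by auto
      ultimately show "?N y \<in> {x \<in> W. \<beta> x}" by simp
    qed
  qed
  then have "card {x \<in> W. \<beta> x} = card (H \<times> {LeftSide})"
    using card_image[OF inj_on_subset[OF permutes_inj[OF N] subset_UNIV]] by simp
  then have cardA: "card {x \<in> W. \<beta> x} = 2 * n" using n by (simp add: card_cartesian_product)
  have perm: "permutation rotate_right_sides" "permutation (flip_on D\<^sub>1)" "permutation half_ribbon_swap" "permutation (flip_on D\<^sub>2)"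
    "permutation ?N" "permutation ?R"
    using rotate_right_sides_perm flip_on_perm[OF D(1)] half_ribbon_swap_perm flip_on_perm[OF D(2)] N R finite_W permutation_permutes
    by blast+
  have "sign ?Q = sign ?R * sign ?N"
    using sign_compose[OF perm(6) permutation_inverse[OF perm(5)]] sign_inverse[OF perm(5)] by simp
  also have "sign ?R = (-1) ^ n * (-1) ^ card D\<^sub>2"
    by (simp only: sign_compose[OF perm(3,4)] sign_half_ribbon_swap[OF n] sign_flip_on[OF D(2)])
  also have "sign ?N = sign \<sigma> * (-1) ^ card D\<^sub>1"
    by (simp only: sign_compose[OF perm(1,2)] sign_rotate_right_sides sign_flip_on[OF D(1)])
  finally have sQ: "sign ?Q = (-1) ^ n * sign \<sigma> * ((-1) ^ card D\<^sub>1 * (-1) ^ card D\<^sub>2)"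
    by (simp only: mult_ac)
  \<comment> \<open>The upper end of a twisted ribbon is flipped in exactly one factor iff the two sides of the
    lower end have the same colour.\<close>
  let ?v = "\<lambda>l. (if \<beta> (l, LeftSide) = \<beta> (l, RightSide) then -1 else 1) :: int"
  let ?w = "\<lambda>l. if upper_twisted l then ?v (partner l) else 1"
  have "(-1) ^ card D\<^sub>1 * (-1) ^ card D\<^sub>2 = (\<Prod>l\<in>H. (if l \<in> D\<^sub>1 then -1 else 1) * (if l \<in> D\<^sub>2 then -1 else 1) :: int)"
    by (simp only: minus_one_power_card[OF D(1)] minus_one_power_card[OF D(2)] prod.distrib)
  also have "\<dots> = (\<Prod>l\<in>H. ?w l)"
  proof (rule prod.cong[OF refl])
    fix l assume l: "l \<in> H"
    have D1: "l \<in> D\<^sub>1 \<longleftrightarrow> \<not> \<beta> (l, LeftSide)" using l by (simp add: D\<^sub>1_def rotate_right_sides_def)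
    show "(if l \<in> D\<^sub>1 then -1 else 1) * (if l \<in> D\<^sub>2 then -1 else 1) = ?w l"
    proof (cases "upper_twisted l")
      case True
      then have tw: "twisted l" "\<not> upper_twisted (partner l)" by (auto simp: upper_twisted_def)
      have "l \<in> D\<^sub>2 \<longleftrightarrow> \<not> \<beta> (partner l, RightSide)"
        using l True tw by (simp add: D\<^sub>2_def half_ribbon_swap_def moved_side_def)
      moreover have "ribbon_join (l, LeftSide) = (partner l, LeftSide)" using l tw by (simp add: ribbon_join_def)
      then have "\<beta> (partner l, LeftSide) = (\<not> \<beta> (l, LeftSide))"
        using flip(2)[of "(l, LeftSide)"] l by (simp add: W_def)
      ultimately show ?thesis using True D1 by simp
    next
      case False
      then have "l \<in> D\<^sub>2 \<longleftrightarrow> \<not> \<beta> (l, LeftSide)"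
        using l by (simp add: D\<^sub>2_def half_ribbon_swap_def moved_side_def)
      then show ?thesis using False D1 by simp
    qed
  qed
  also have "\<dots> = (\<Prod>e\<in>E. ?w (Min e) * ?w (Max e))" by (rule prod_pairing[OF finite_H E])
  also have "\<dots> = (\<Prod>e\<in>E. if e \<in> T then ?v (Min e) else 1)"
  proof (rule prod.cong[OF refl])
    fix e assume "e \<in> E"
    note pm = partner_Min_Max[OF this]
    have "\<not> upper_twisted (Min e)" "upper_twisted (Max e) \<longleftrightarrow> e \<in> T"
      using pm by (auto simp: upper_twisted_def)
    then show "?w (Min e) * ?w (Max e) = (if e \<in> T then ?v (Min e) else 1)" by (simp add: pm(4))
  qed
  also have "\<dots> = (\<Prod>e\<in>T. ?v (Min e))"
  proof -
    have "finite E" using card_pairing(2)[OF finite_H E n] .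
    then show ?thesis using T by (simp add: prod.inter_restrict[symmetric] Int_absorb1)
  qed
  finally have "(-1) ^ card D\<^sub>1 * (-1) ^ card D\<^sub>2 = (\<Prod>e\<in>T. ?v (Min e))" .
  then show ?thesis using sQ sgn unfolding cardA by (simp add: power_add)
qed

end

context ribbon_graph
begin

text \<open>
  The right side of a half-edge carries the row of its matrix entry and the left side the column,
  which is the label of the next half-edge.  The boolean is negated on left sides, so that a vertex join
  imposes the same condition as a twisted ribbon.
\<close>

definition side_label :: "(nat \<Rightarrow> 'n \<times> bool) \<Rightarrow> nat \<times> side \<Rightarrow> 'n \<times> bool" where
  "side_label s = (\<lambda>x\<in>W. case snd x of RightSide \<Rightarrow> s (fst x)
     | LeftSide \<Rightarrow> (fst (s (\<sigma> (fst x))), \<not> snd (s (\<sigma> (fst x)))))"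

definition opposed :: "'n \<times> bool \<Rightarrow> 'n \<times> bool \<Rightarrow> bool" where
  "opposed p q \<longleftrightarrow> fst p = fst q \<and> snd p \<noteq> snd q"

lemma opposed_sym: "opposed p q \<longleftrightarrow> opposed q p"
  by (auto simp: opposed_def)

definition labels :: "(nat \<times> side \<Rightarrow> 'n \<times> bool) set" where
  "labels = {S \<in> PiE W (\<lambda>_. UNIV). \<forall>x\<in>W. opposed (S (vertex_join x)) (S x) \<and> opposed (S (ribbon_join x)) (S x)}"

lemma side_label_simps:
  assumes "l \<in> H"
  shows "side_label s (l, RightSide) = s l"
    "side_label s (l, LeftSide) = (fst (s (\<sigma> l)), \<not> snd (s (\<sigma> l)))"
  using assms by (simp_all add: side_label_def W_def)

lemma side_label_vertex_join:
  assumes "x \<in> W"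
  shows "opposed (side_label s (vertex_join x)) (side_label s x)"
proof -
  obtain l a where x: "x = (l, a)" by (cases x)
  have l: "l \<in> H" using assms x by (simp add: W_def)
  then show ?thesis
    by (cases a) (simp_all add: x vertex_join_def side_label_simps opposed_def permutes_inverses[OF sigma_perm])
qed

lemma bij_betw_side_label:
  "bij_betw side_label {s \<in> PiE H (\<lambda>_. UNIV :: ('n \<times> bool) set). side_label s \<in> labels} labels"
proof (rule bij_betw_byWitness[where f' = "\<lambda>S. \<lambda>l\<in>H. S (l, RightSide)"])
  show "\<forall>s\<in>{s \<in> PiE H (\<lambda>_. UNIV :: ('n \<times> bool) set). side_label s \<in> labels}.
      (\<lambda>l\<in>H. side_label s (l, RightSide)) = s"
  proof
    fix s assume "s \<in> {s \<in> PiE H (\<lambda>_. UNIV :: ('n \<times> bool) set). side_label s \<in> labels}"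
    then have s: "s \<in> PiE H (\<lambda>_. UNIV)" by simp
    show "(\<lambda>l\<in>H. side_label s (l, RightSide)) = s"
    proof
      fix l show "(\<lambda>l\<in>H. side_label s (l, RightSide)) l = s l"
        using PiE_arb[OF s, of l] by (cases "l \<in> H") (simp_all add: side_label_simps)
    qed
  qed
  have inv: "side_label (\<lambda>l\<in>H. S (l, RightSide)) = S" if S: "S \<in> labels" for S :: "_ \<Rightarrow> 'n \<times> bool"
  proof
    fix x
    show "side_label (\<lambda>l\<in>H. S (l, RightSide)) x = S x"
    proof (cases "x \<in> W")
      case True
      obtain l a where x: "x = (l, a)" by (cases x)
      have l: "l \<in> H" using True x by (simp add: W_def)
      show ?thesis
      proof (cases a)
        case RightSide then show ?thesis using l x by (simp add: side_label_simps)
      next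
        case LeftSide
        have "opposed (S (vertex_join x)) (S x)" using S True by (simp add: labels_def)
        then show ?thesis using l LeftSide
          by (simp add: x side_label_simps vertex_join_def opposed_def prod_eq_iff)
      qed
    next
      case False
      moreover have "S \<in> PiE W (\<lambda>_. UNIV)" using S by (simp add: labels_def)
      ultimately show ?thesis using PiE_arb[of S W _ x] by (simp add: side_label_def)
    qed
  qed
  show "\<forall>S\<in>labels :: (nat \<times> side \<Rightarrow> 'n \<times> bool) set. side_label (\<lambda>l\<in>H. S (l, RightSide)) = S"
    using inv by blast
  show "side_label ` {s \<in> PiE H (\<lambda>_. UNIV :: ('n \<times> bool) set). side_label s \<in> labels} \<subseteq> labels" by blast
  show "(\<lambda>S. \<lambda>l\<in>H. S (l, RightSide)) ` labels \<subseteq> {s \<in> PiE H (\<lambda>_. UNIV :: ('n \<times> bool) set). side_label s \<in> labels}"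
    using inv by (auto simp del: restrict_apply simp: PiE_iff)
qed

lemma card_labels:
  "card (labels :: (nat \<times> side \<Rightarrow> 'n::finite \<times> bool) set) = (2 * CARD('n)) ^ card (W // joins\<^sup>*)"
proof -
  have "labels = {S \<in> PiE W (\<lambda>_. UNIV :: ('n \<times> bool) set).
      \<forall>x\<in>W. fst (S (vertex_join x)) = fst (S x) \<and> fst (S (ribbon_join x)) = fst (S x) \<and>
        snd (S (vertex_join x)) \<noteq> snd (S x) \<and> snd (S (ribbon_join x)) \<noteq> snd (S x)}"
    unfolding labels_def opposed_def by (intro Collect_cong) blast
  then show ?thesis using card_alternating_labels by simp
qed

text \<open>
  The vertex joins are respected by construction, so only the ribbons matter.
\<close>

lemma labels_iff:
  "side_label s \<in> labels \<longleftrightarrow>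
    (\<forall>e\<in>E. \<forall>a. opposed (side_label s (Min e, a)) (side_label s (ribbon_join (Min e, a))))"
proof
  assume lab: "side_label s \<in> labels"
  show "\<forall>e\<in>E. \<forall>a. opposed (side_label s (Min e, a)) (side_label s (ribbon_join (Min e, a)))"
  proof (intro ballI allI)
    fix e a assume "e \<in> E"
    then have "(Min e, a) \<in> W" using partner_Min_Max(1) by (simp add: W_def)
    then show "opposed (side_label s (Min e, a)) (side_label s (ribbon_join (Min e, a)))"
      using lab by (subst opposed_sym) (simp add: labels_def)
  qed
next
  assume opp: "\<forall>e\<in>E. \<forall>a. opposed (side_label s (Min e, a)) (side_label s (ribbon_join (Min e, a)))"
  have "opposed (side_label s (ribbon_join x)) (side_label s x)" if xW: "x \<in> W" for x
  proof -
    obtain l a where x: "x = (l, a)" by (cases x)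
    have l: "l \<in> H" using xW x by (simp add: W_def)
    obtain e where e: "e \<in> E" "l \<in> e" using pairingsD(5)[OF E] l by blast
    note mM = pairing_Min_Max[OF pairingsD(2)[OF E e(1)]]
    have "l = Min e \<or> l = Max e" using e(2) mM(4) by blast
    then show ?thesis
    proof
      assume "l = Min e" then show ?thesis using opp e(1) opposed_sym x by blast
    next
      assume "l = Max e"
      then have "fst (ribbon_join x) = Min e"
        using partner_Min_Max(2,4)[OF e(1)] x by (simp add: ribbon_join_def)
      then obtain b where b: "ribbon_join x = (Min e, b)" by (cases "ribbon_join x") simp
      then have "ribbon_join (Min e, b) = x" using rho_rho[of x] by simp
      then show ?thesis using opp e(1) b by metis
    qed
  qed
  then show "side_label s \<in> labels"
    using side_label_vertex_join by (auto simp: labels_def side_label_def)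
qed

lemma untwisted_weight_eq:
  assumes "e \<in> E" "e \<notin> T"
  shows "untwisted_weight \<sigma> s e =
    of_bool (\<forall>a. opposed (side_label s (Min e, a)) (side_label s (ribbon_join (Min e, a))))"
proof -
  note pm = partner_Min_Max[OF assms(1)]
  have all: "(\<forall>a. P a) \<longleftrightarrow> P LeftSide \<and> P RightSide" for P using side.exhaust by metis
  show ?thesis unfolding untwisted_weight_def all
    by (rule arg_cong[where f = of_bool])
      (use assms pm in \<open>auto simp: ribbon_join_def side_label_simps opposed_def prod_eq_iff\<close>)
qed

lemma twisted_weight_eq:
  assumes "e \<in> T"
  shows "twisted_weight \<sigma> s e =
    of_bool (\<forall>a. opposed (side_label s (Min e, a)) (side_label s (ribbon_join (Min e, a)))) *
    (if snd (side_label s (Min e, LeftSide)) = snd (side_label s (Min e, RightSide)) then -1 else 1)"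
proof -
  have "e \<in> E" using assms T by blast
  note pm = partner_Min_Max[OF this]
  have all: "(\<forall>a. P a) \<longleftrightarrow> P LeftSide \<and> P RightSide" for P using side.exhaust by metis
  show ?thesis unfolding twisted_weight_def all
    using assms pm by (auto simp: ribbon_join_def side_label_simps opposed_def skew_def)
qed

text \<open>
  Only the labels admissible for the joins contribute, and all of them contribute the same sign.
\<close>

lemma state_sum_eq:
  assumes n: "card H = 2 * n"
  shows "(\<Sum>s\<in>PiE H (\<lambda>_. UNIV :: ('n::finite \<times> bool) set).
      (\<Prod>e\<in>T. twisted_weight \<sigma> s e) * (\<Prod>e\<in>E - T. untwisted_weight \<sigma> s e)) =
    (-1) ^ n * of_int (sign \<sigma>) * (- 2 * of_nat CARD('n)) ^ card (W // joins\<^sup>*)"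
proof -
  let ?f = "card (W // joins\<^sup>*)"
  let ?c = "(-1) ^ ?f * (-1) ^ n * of_int (sign \<sigma>) :: complex"
  have finE: "finite E" using card_pairing(2)[OF finite_H E n] .
  then have finT: "finite T" using T finite_subset by blast
  let ?ok = "\<lambda>s e. \<forall>a. opposed (side_label s (Min e, a)) (side_label s (ribbon_join (Min e, a)))"
  have "(\<Prod>e\<in>T. twisted_weight \<sigma> s e) * (\<Prod>e\<in>E - T. untwisted_weight \<sigma> s e) =
      (if side_label s \<in> labels then ?c else 0)" for s :: "nat \<Rightarrow> 'n \<times> bool"
  proof (cases "side_label s \<in> labels")
    case True
    then have ok: "?ok s e" if "e \<in> E" for e using that labels_iff by blast
    let ?\<beta> = "\<lambda>x. snd (side_label s x)"
    have "alternating ?\<beta>"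
      using True unfolding alternating_def labels_def opposed_def by blast
    note rs = ribbon_graph_sign[OF this n]
    have "(\<Prod>e\<in>E - T. untwisted_weight \<sigma> s e) = 1"
      by (rule prod.neutral) (use ok in \<open>simp add: untwisted_weight_eq\<close>)
    moreover have "(\<Prod>e\<in>T. twisted_weight \<sigma> s e) =
        of_int (\<Prod>e\<in>T. if ?\<beta> (Min e, LeftSide) = ?\<beta> (Min e, RightSide) then -1 else 1)"
      unfolding of_int_prod
    proof (rule prod.cong[OF refl])
      fix e assume e: "e \<in> T"
      then have "?ok s e" using ok T by blast
      then show "twisted_weight \<sigma> s e = of_int (if ?\<beta> (Min e, LeftSide) = ?\<beta> (Min e, RightSide) then -1 else 1)"
        unfolding twisted_weight_eq[OF e] by simp
    qed
    moreover have "(\<Prod>e\<in>T. if ?\<beta> (Min e, LeftSide) = ?\<beta> (Min e, RightSide) then -1 else 1) = (-1) ^ ?f * (-1) ^ n * sign \<sigma>"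
    proof -
      have "(-1) ^ ?f * (-1) ^ n * sign \<sigma> = ((-1) ^ n * (-1) ^ n) * (sign \<sigma> * sign \<sigma>) *
        (\<Prod>e\<in>T. if ?\<beta> (Min e, LeftSide) = ?\<beta> (Min e, RightSide) then -1 else 1)"
        unfolding rs by (simp only: mult_ac)
      also have "(-1 :: int) ^ n * (-1) ^ n = 1" by (simp flip: power_mult_distrib)
      finally show ?thesis by simp
    qed
    ultimately show ?thesis using True by simp
  next
    case False
    then obtain e where e: "e \<in> E" "\<not> ?ok s e" using labels_iff by blast
    have "(\<Prod>e\<in>T. twisted_weight \<sigma> s e) = 0 \<or> (\<Prod>e\<in>E - T. untwisted_weight \<sigma> s e) = 0"
    proof (cases "e \<in> T")
      case True
      then have "twisted_weight \<sigma> s e = 0" using e(2) unfolding twisted_weight_eq[OF True] by simp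
      then show ?thesis using finT True by (auto simp: prod_zero_iff)
    next
      case F: False
      then have "untwisted_weight \<sigma> s e = 0" using e(2) unfolding untwisted_weight_eq[OF e(1) F] by simp
      then show ?thesis using finE F e(1) by (auto simp: prod_zero_iff)
    qed
    then show ?thesis using False by auto
  qed
  then have "(\<Sum>s\<in>PiE H (\<lambda>_. UNIV :: ('n \<times> bool) set).
      (\<Prod>e\<in>T. twisted_weight \<sigma> s e) * (\<Prod>e\<in>E - T. untwisted_weight \<sigma> s e)) =
    (\<Sum>s\<in>PiE H (\<lambda>_. UNIV :: ('n \<times> bool) set). if side_label s \<in> labels then ?c else 0)" by simp
  also have "\<dots> = of_nat (card {s \<in> PiE H (\<lambda>_. UNIV :: ('n \<times> bool) set). side_label s \<in> labels}) * ?c"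
    using finite_H by (subst sum.inter_filter[symmetric]) (simp_all add: finite_PiE)
  also have "card {s \<in> PiE H (\<lambda>_. UNIV :: ('n \<times> bool) set). side_label s \<in> labels} = (2 * CARD('n)) ^ ?f"
    using bij_betw_same_card[OF bij_betw_side_label] card_labels by (rule trans)
  also have "of_nat ((2 * CARD('n)) ^ ?f) * ?c = (-1) ^ n * of_int (sign \<sigma>) * (- 2 * of_nat CARD('n)) ^ ?f"
  proof -
    have "(- 2 * of_nat CARD('n) :: complex) = (-1) * (2 * of_nat CARD('n))" by simp
    then have "(- 2 * of_nat CARD('n) :: complex) ^ ?f = (-1) ^ ?f * (2 * of_nat CARD('n)) ^ ?f"
      by (simp only: power_mult_distrib)
    then show ?thesis by (simp add: mult_ac)
  qed
  finally show ?thesis .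
qed

end

section \<open>The rotation at the vertices\<close>

text \<open>
  The successor at a vertex, made the identity outside the half-edges, so that it becomes a permutation.
\<close>

definition rotation :: "nat \<Rightarrow> (nat \<Rightarrow> nat) \<Rightarrow> nat \<Rightarrow> nat" where
  "rotation m j = perm_restrict (next_he j) (half_edges m j)"

lemma rotation_eq: "l \<in> half_edges m j \<Longrightarrow> rotation m j l = next_he j l"
  by (simp add: rotation_def perm_restrict_simps)

context
  fixes m :: nat and j :: "nat \<Rightarrow> nat"
  assumes pos: "\<forall>r\<in>{1..m}. 0 < j r"
begin

lemma next_he_in_block:
  assumes "k \<in> {1..m}" "l \<in> vertex_block j k"
  shows "next_he j l \<in> vertex_block j k"
  using assms pos vertex_block_nonempty[of k j] by (auto simp: next_he_block vertex_block_def)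

lemma half_edge_block:
  assumes "l \<in> half_edges m j"
  obtains k where "k \<in> {1..m}" "l \<in> vertex_block j k"
  using assms unfolding UN_vertex_block[symmetric] by blast

lemma block_subset: "k \<in> {1..m} \<Longrightarrow> vertex_block j k \<subseteq> half_edges m j"
  unfolding UN_vertex_block[symmetric] by blast

lemma rotation_permutes: "rotation m j permutes half_edges m j"
proof (rule bij_imp_permutes)
  have "inj_on (next_he j) (half_edges m j)"
  proof (rule inj_onI)
    fix l l' assume l: "l \<in> half_edges m j" and l': "l' \<in> half_edges m j" and eq: "next_he j l = next_he j l'"
    obtain k where k: "k \<in> {1..m}" "l \<in> vertex_block j k" using half_edge_block[OF l] .
    obtain k' where k': "k' \<in> {1..m}" "l' \<in> vertex_block j k'" using half_edge_block[OF l'] .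
    have "k = k'"
      using vertex_of_block[of k "next_he j l" j] vertex_of_block[of k' "next_he j l'" j]
        next_he_in_block[OF k] next_he_in_block[OF k'] k(1) k'(1) eq by simp
    then show "l = l'"
      using k k' eq by (auto simp: next_he_block vertex_block_def split: if_splits)
  qed
  moreover have "next_he j ` half_edges m j \<subseteq> half_edges m j"
  proof (rule image_subsetI)
    fix l assume "l \<in> half_edges m j"
    then obtain k where "k \<in> {1..m}" "l \<in> vertex_block j k" by (rule half_edge_block)
    then show "next_he j l \<in> half_edges m j" using next_he_in_block block_subset by blast
  qed
  ultimately have "bij_betw (next_he j) (half_edges m j) (half_edges m j)"
    using endo_inj_surj[OF finite_half_edges] by (simp add: bij_betw_def)
  then show "bij_betw (rotation m j) (half_edges m j) (half_edges m j)"
    by (rule bij_betw_cong[THEN iffD1, rotated]) (simp add: rotation_eq)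
qed (simp add: rotation_def perm_restrict_simps)

lemma orbit_rotation:
  assumes k: "k \<in> {1..m}" "l \<in> vertex_block j k"
  shows "orbit (rotation m j) l = vertex_block j k"
proof -
  let ?r = "rotation m j" and ?a = "first_he j k" and ?b = "last_he j k"
  have perm: "permutation ?r" using rotation_permutes finite_half_edges permutation_permutes by blast
  have k1: "1 \<le> k" "0 < j k" using k pos by auto
  have aB: "?a \<in> vertex_block j k" using vertex_block_nonempty(2)[of k j] k1 by simp
  have step: "?r x = (if x = ?b then ?a else x + 1)" if "x \<in> vertex_block j k" for x
    using that block_subset[OF k(1)] by (simp add: rotation_eq subsetD next_he_block[OF k1(1)])
  have "orbit ?r ?a = vertex_block j k"
  proof
    show "orbit ?r ?a \<subseteq> vertex_block j k"
    proof
      have closed: "?r x \<in> vertex_block j k" if "x \<in> vertex_block j k" for x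
        using next_he_in_block[OF k(1) that] block_subset[OF k(1)] that by (simp add: rotation_eq subsetD)
      fix x assume "x \<in> orbit ?r ?a"
      then show "x \<in> vertex_block j k" by induction (use closed aB in blast)+
    qed
    show "vertex_block j k \<subseteq> orbit ?r ?a"
    proof
      have "?a + d \<in> orbit ?r ?a" if "?a + d \<le> ?b" for d
        using that
      proof (induction d)
        case 0 show ?case using permutation_self_in_orbit[OF perm] by simp
      next
        case (Suc d)
        have "?a + d \<in> vertex_block j k" "?a + d \<noteq> ?b" using Suc.prems by (simp_all add: vertex_block_def)
        then have "?r (?a + d) = ?a + Suc d" using step[of "?a + d"] by simp
        moreover have "?a + d \<in> orbit ?r ?a" using Suc by simp
        then have "?r (?a + d) \<in> orbit ?r ?a" by (rule orbit.step)
        ultimately show ?case by simp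
      qed
      moreover fix x assume "x \<in> vertex_block j k"
      then have "x = ?a + (x - ?a)" "?a + (x - ?a) \<le> ?b" by (simp_all add: vertex_block_def)
      ultimately show "x \<in> orbit ?r ?a" by metis
    qed
  qed
  then show ?thesis using k(2) orbit_cyclic_eq3[OF cyclic_on_orbit'[OF perm]] by metis
qed

text \<open>
  The rotation has one orbit for each vertex on an even number of half-edges.
\<close>

lemma sign_rotation:
  assumes "card (half_edges m j) = 2 * n"
  shows "sign (rotation m j) = (-1) ^ m"
proof -
  have "orbit (rotation m j) ` half_edges m j = vertex_block j ` {1..m}"
  proof
    show "orbit (rotation m j) ` half_edges m j \<subseteq> vertex_block j ` {1..m}"
    proof (rule image_subsetI)
      fix l assume "l \<in> half_edges m j"
      then obtain k where "k \<in> {1..m}" "l \<in> vertex_block j k" by (rule half_edge_block)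
      then show "orbit (rotation m j) l \<in> vertex_block j ` {1..m}" using orbit_rotation by blast
    qed
    show "vertex_block j ` {1..m} \<subseteq> orbit (rotation m j) ` half_edges m j"
    proof (rule image_subsetI)
      fix k assume k: "k \<in> {1..m}"
      then have "first_he j k \<in> vertex_block j k" using vertex_block_nonempty(2)[of k j] pos by simp
      then show "vertex_block j k \<in> orbit (rotation m j) ` half_edges m j"
        using orbit_rotation[OF k] block_subset[OF k] by blast
    qed
  qed
  moreover have "inj_on (vertex_block j) {1..m}"
  proof (rule inj_onI)
    fix k k' assume k: "k \<in> {1..m}" "k' \<in> {1..m}" and eq: "vertex_block j k = vertex_block j k'"
    have "first_he j k \<in> vertex_block j k" using k vertex_block_nonempty(2)[of k j] pos by simp
    then show "k = k'"
      using vertex_of_block[of k "first_he j k" j] vertex_of_block[of k' "first_he j k" j] k eq by simp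
  qed
  ultimately have "card (orbit (rotation m j) ` half_edges m j) = m" by (simp add: card_image)
  then show ?thesis
    using sign_eq_orbits[OF rotation_permutes finite_half_edges] assms by (simp add: power_add)
qed

text \<open>
  The components of the two matchings of the ribbon graph are its faces.
\<close>

lemma graph_state_sum_eq:
  assumes \<Gamma>: "(E, T) \<in> moebius_graphs m j" and n: "card (half_edges m j) = 2 * n"
  shows "graph_state_sum TYPE('n::finite) m j (E, T) =
    (-1) ^ n * (-1) ^ m * (- 2 * of_nat CARD('n)) ^ card (faces m j (E, T))"
proof -
  interpret ribbon_graph "half_edges m j" "rotation m j" E T
    using \<Gamma> finite_half_edges rotation_permutes
    by unfold_locales (auto simp: moebius_graphs_eq_Sigma)
  have "side_joins m j (E, T) \<union> (side_joins m j (E, T))\<inverse> = joins"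
  proof (intro equalityI subrelI)
    have v: "((i, LeftSide), (next_he j i, RightSide)) \<in> joins" if "i \<in> half_edges m j" for i
    proof -
      have "(i, LeftSide) \<in> W" using that by (simp add: W_def)
      moreover have "vertex_join (i, LeftSide) = (next_he j i, RightSide)"
        using that by (simp add: vertex_join_def rotation_eq)
      ultimately show ?thesis unfolding joins_iff by simp
    qed
    have r: "((i, a), (i', b)) \<in> joins" if "i \<noteq> i'" "{i, i'} \<in> E" "a = b \<longleftrightarrow> {i, i'} \<in> T" for i a i' b
    proof -
      have p: "partner i = i'" using that by (intro partner_eqI) auto
      have i: "i \<in> half_edges m j" using pairingsD(3)[OF E that(2)] by simp
      have "ribbon_join (i, a) = (i', b)"
        using that(3) i p by (cases a; cases b) (simp_all add: ribbon_join_def twisted_def)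
      moreover have "(i, a) \<in> W" using i by (simp add: W_def)
      ultimately show ?thesis unfolding joins_iff by simp
    qed
    have "side_joins m j (E, T) \<subseteq> joins" unfolding side_joins_def using v r by auto
    then have "(side_joins m j (E, T))\<inverse> \<subseteq> joins" using sym_joins by (auto dest: symD)
    then show "(x, y) \<in> joins" if "(x, y) \<in> side_joins m j (E, T) \<union> (side_joins m j (E, T))\<inverse>" for x y
      using that \<open>side_joins m j (E, T) \<subseteq> joins\<close> by blast
  next
    fix x y assume "(x, y) \<in> joins"
    then have xW: "x \<in> W" and y: "y = vertex_join x \<or> y = ribbon_join x" by (simp_all add: joins_iff)
    obtain i a where x: "x = (i, a)" by (cases x)
    have i: "i \<in> half_edges m j" using xW x by (simp add: W_def)
    from y show "(x, y) \<in> side_joins m j (E, T) \<union> (side_joins m j (E, T))\<inverse>"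
    proof
      assume y: "y = vertex_join x"
      show ?thesis
      proof (cases a)
        case LeftSide
        then have "y = (next_he j i, RightSide)" using y x i by (simp add: vertex_join_def rotation_eq)
        then show ?thesis using x i LeftSide unfolding side_joins_def by simp
      next
        case RightSide
        let ?i = "inv (rotation m j) i"
        have "y = (?i, LeftSide)" using y x i RightSide by (simp add: vertex_join_def)
        moreover have "?i \<in> half_edges m j" using i by simp
        moreover have "next_he j ?i = i"
          using rotation_eq[OF \<open>?i \<in> half_edges m j\<close>] permutes_inverses(1)[OF rotation_permutes, of i] by simp
        ultimately have "(y, x) \<in> side_joins m j (E, T)"
          using x RightSide unfolding side_joins_def by simp
        then show ?thesis by simp
      qed
    next
      assume y: "y = ribbon_join x"
      have "(x, y) \<in> side_joins m j (E, T)"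
        using partner[OF i] i y x unfolding side_joins_def by (auto simp: ribbon_join_def twisted_def)
      then show ?thesis by simp
    qed
  qed
  then have faces: "faces m j (E, T) = W // joins\<^sup>*" by (simp add: faces_def W_def)
  have "graph_state_sum TYPE('n) m j (E, T) = (\<Sum>s\<in>PiE (half_edges m j) (\<lambda>_. UNIV :: ('n \<times> bool) set).
      (\<Prod>e\<in>T. twisted_weight (rotation m j) s e) * (\<Prod>e\<in>E - T. untwisted_weight (rotation m j) s e))"
  proof -
    have "twisted_weight (next_he j) s e = twisted_weight (rotation m j) s e"
      "untwisted_weight (next_he j) s e = untwisted_weight (rotation m j) s e" if "e \<in> E" for e and s :: "nat \<Rightarrow> 'n \<times> bool"
      using partner_Min_Max(1,2)[OF that] by (simp_all add: twisted_weight_def untwisted_weight_def rotation_eq)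
    then show ?thesis unfolding graph_state_sum_def using T
      by (auto intro!: sum.cong arg_cong2[where f = "(*)"] prod.cong)
  qed
  then show ?thesis unfolding state_sum_eq[OF n] faces using sign_rotation[OF n] by simp
qed

end

section \<open>The expectation formula\<close>

text \<open>
  The powers of 2 that stem from the half traces, the contractions and the normalization combine with
  the signs into a power of \<open>-2 N\<close>.
\<close>

lemma normalized_state_sum:
  fixes N :: nat
  assumes "N > 0"
  shows "1 / (4 * real N) powi (int n - int m) * (2 ^ n / 2 ^ m * ((-1) ^ n * (-1) ^ m * (- 2 * real N) ^ f)) =
    (- 2 * real N) powi (int m - int n + int f)"
proof -
  have two: "(- 2 * real N) ^ k = (-1) ^ k * 2 ^ k * real N ^ k" for k
  proof -
    have "- 2 * real N = (-1) * 2 * real N" by simp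
    then show ?thesis by (simp only: power_mult_distrib)
  qed
  have "(- 2 * real N) powi (int m - int n + int f) = (- 2 * real N) ^ m / (- 2 * real N) ^ n * (- 2 * real N) ^ f"
    using assms by (simp add: power_int_add power_int_diff)
  also have "(- 2 * real N) ^ m / (- 2 * real N) ^ n = ((-1) ^ m * 2 ^ m * real N ^ m) / ((-1) ^ n * 2 ^ n * real N ^ n)"
    by (simp only: two)
  finally have r: "(- 2 * real N) powi (int m - int n + int f) =
    ((-1) ^ m * 2 ^ m * real N ^ m) / ((-1) ^ n * 2 ^ n * real N ^ n) * (- 2 * real N) ^ f" .
  have four: "(4 * real N) ^ k = 2 ^ k * 2 ^ k * real N ^ k" for k
  proof -
    have "4 * real N = 2 * 2 * real N" by simp
    then show ?thesis by (simp only: power_mult_distrib)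
  qed
  have l: "(4 * real N) powi (int n - int m) = (2 ^ n * 2 ^ n * real N ^ n) / (2 ^ m * 2 ^ m * real N ^ m)"
  proof -
    have "4 * real N \<noteq> 0" using assms by simp
    then have "(4 * real N) powi (int n - int m) = (4 * real N) powi int n / (4 * real N) powi int m"
      by (intro power_int_diff disjI1)
    then show ?thesis by (simp only: power_int_of_nat four)
  qed
  have *: "1 / (p * p * a / (q * q * b)) * (p / q * (u * v * F)) = v * q * b / (u * p * a) * F"
    if "p \<noteq> 0" "q \<noteq> 0" "a \<noteq> 0" "b \<noteq> 0" "u = 1 \<or> u = -1" for p q a b u v F :: real
    using that(5) that(1-4) by (elim disjE) (simp_all add: field_simps)
  have "(-1 :: real) ^ n = 1 \<or> (-1 :: real) ^ n = -1" by (cases "even n") simp_all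
  then show ?thesis unfolding l r using assms by (intro *) simp_all
qed

lemma (in prob_space) expectation_trace_product_eq:
  fixes Z :: "nat \<Rightarrow> 'a \<Rightarrow> 'n::{finite,linorder} quat_matrix" and j :: "nat \<Rightarrow> nat"
  assumes pos: "\<forall>r\<in>{1..m}. 0 < j r" and sum: "(\<Sum>r=1..m. j r) = 2 * n"
    and t: "t ` {1..2*n} \<subseteq> {1..s}"
    and gse: "\<And>c. c \<in> {1..s} \<Longrightarrow> gse (Z c)"
    and mom: "\<And>k. integrable M (\<lambda>\<omega>. \<Prod>a\<in>gse_index s. gse_component Z a \<omega> ^ k a)"
      "\<And>k. expectation (\<lambda>\<omega>. \<Prod>a\<in>gse_index s. gse_component Z a \<omega> ^ k a) = (\<Prod>a\<in>gse_index s. gauss_moment (k a))"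
  defines "X \<equiv> \<lambda>\<omega>. \<Prod>k=1..m.
      qRe (trace (mat_prod_list (map (\<lambda>i. Z (t i) \<omega>) [first_he j k..<last_he j k + 1])))"
  shows "integrable M X"
    "1 / (4 * real CARD('n)) powi (int n - int m) * expectation X =
       (\<Sum>\<Gamma>\<in>{\<Gamma> \<in> moebius_graphs m j. color_preserving t \<Gamma>}. (- 2 * real CARD('n)) powi euler_char m j \<Gamma>)"
proof -
  let ?G = "{\<Gamma> \<in> moebius_graphs m j. color_preserving t \<Gamma>}"
  have sa: "Z c \<omega> $ k $ i = qcnj (Z c \<omega> $ i $ k)" if "c \<in> {1..s}" "\<omega> \<in> space M" for c \<omega> i k
    using gse[OF that(1)] that(2) unfolding gse_def by blast
  note etp = expectation_trace_product[OF pos sum t sa mom]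
  show "integrable M X" unfolding X_def by (rule etp(1))
  have n: "card (half_edges m j) = 2 * n" using sum by (simp add: half_edges_def)
  have "complex_of_real (expectation X) = 2 ^ n / 2 ^ m * (\<Sum>\<Gamma>\<in>?G. graph_state_sum TYPE('n) m j \<Gamma>)"
    unfolding X_def by (rule etp(2))
  also have "\<dots> = 2 ^ n / 2 ^ m * (\<Sum>\<Gamma>\<in>?G. (-1) ^ n * (-1) ^ m * (- 2 * of_nat CARD('n)) ^ card (faces m j \<Gamma>))"
    using graph_state_sum_eq[OF pos _ n, where ?'n = 'n]
    by (intro arg_cong[where f = "\<lambda>x. 2 ^ n / 2 ^ m * x"] sum.cong refl) auto
  also have "\<dots> = complex_of_real (\<Sum>\<Gamma>\<in>?G. 2 ^ n / 2 ^ m * ((-1) ^ n * (-1) ^ m * (- 2 * real CARD('n)) ^ card (faces m j \<Gamma>)))"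
    by (simp add: sum_distrib_left)
  finally have "expectation X = (\<Sum>\<Gamma>\<in>?G. 2 ^ n / 2 ^ m * ((-1) ^ n * (-1) ^ m * (- 2 * real CARD('n)) ^ card (faces m j \<Gamma>)))"
    by (simp only: of_real_eq_iff)
  then have "1 / (4 * real CARD('n)) powi (int n - int m) * expectation X =
    (\<Sum>\<Gamma>\<in>?G. 1 / (4 * real CARD('n)) powi (int n - int m) *
      (2 ^ n / 2 ^ m * ((-1) ^ n * (-1) ^ m * (- 2 * real CARD('n)) ^ card (faces m j \<Gamma>))))"
    by (simp only: sum_distrib_left)
  also have "\<dots> = (\<Sum>\<Gamma>\<in>?G. (- 2 * real CARD('n)) powi euler_char m j \<Gamma>)"
  proof (rule sum.cong[OF refl])
    fix \<Gamma> assume "\<Gamma> \<in> ?G"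
    then have "card (fst \<Gamma>) = n"
      using card_pairing(1)[OF finite_half_edges _ n] by (auto simp: moebius_graphs_eq_Sigma)
    then show "1 / (4 * real CARD('n)) powi (int n - int m) *
      (2 ^ n / 2 ^ m * ((-1) ^ n * (-1) ^ m * (- 2 * real CARD('n)) ^ card (faces m j \<Gamma>))) =
      (- 2 * real CARD('n)) powi euler_char m j \<Gamma>"
      unfolding euler_char_def by (subst normalized_state_sum) simp_all
  qed
  finally show "1 / (4 * real CARD('n)) powi (int n - int m) * expectation X =
       (\<Sum>\<Gamma>\<in>?G. (- 2 * real CARD('n)) powi euler_char m j \<Gamma>)" .
qed

theorem theorem4p1:
  fixes M :: "'w measure" and m n :: nat and j :: "nat \<Rightarrow> nat"
  assumes "prob_space M"
    and "\<forall>r\<in>{1..m}. 0 < j r"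
    and "(\<Sum>r=1..m. j r) = 2 * n"
  shows
    "(\<forall>Z :: 'w \<Rightarrow> 'n::{finite,linorder} quat_matrix.
        prob_space.gse M Z \<longrightarrow>
          integrable M (\<lambda>\<omega>. \<Prod>k=1..m. qRe (trace (mat_pow (Z \<omega>) (j k)))) \<and>
          1 / (4 * real CARD('n)) powi (int n - int m) *
            prob_space.expectation M (\<lambda>\<omega>. \<Prod>k=1..m. qRe (trace (mat_pow (Z \<omega>) (j k))))
          = (\<Sum>\<Gamma>\<in>moebius_graphs m j. (- 2 * real CARD('n)) powi euler_char m j \<Gamma>)) \<and>
     (\<forall>(s :: nat) (t :: nat \<Rightarrow> nat) (Z :: nat \<Rightarrow> 'w \<Rightarrow> 'n quat_matrix).
        (\<forall>c\<in>{1..s}. prob_space.gse M (Z c)) \<and>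
        prob_space.indep_vars M (\<lambda>_. borel) Z {1..s} \<and>
        t ` {1..2*n} \<subseteq> {1..s} \<longrightarrow>
          integrable M (\<lambda>\<omega>. \<Prod>k=1..m.
            qRe (trace (mat_prod_list (map (\<lambda>i. Z (t i) \<omega>) [first_he j k..<last_he j k + 1])))) \<and>
          1 / (4 * real CARD('n)) powi (int n - int m) *
            prob_space.expectation M (\<lambda>\<omega>. \<Prod>k=1..m.
              qRe (trace (mat_prod_list (map (\<lambda>i. Z (t i) \<omega>) [first_he j k..<last_he j k + 1]))))
          = (\<Sum>\<Gamma>\<in>{\<Gamma> \<in> moebius_graphs m j. color_preserving t \<Gamma>}.
              (- 2 * real CARD('n)) powi euler_char m j \<Gamma>))"
proof -
  interpret prob_space M by fact
  note pos = assms(2) and sum = assms(3)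
  show ?thesis
  proof (intro conjI[of "All _"] allI impI)
    fix Z :: "'w \<Rightarrow> 'n quat_matrix"
    assume Z: "gse Z"
    \<comment> \<open>The one-matrix case is the coloured case with a single colour.\<close>
    have t: "(\<lambda>_. 1) ` {1..2*n} \<subseteq> {1..1::nat}" by auto
    note ete = expectation_trace_product_eq[OF pos sum t, of "\<lambda>_. Z", OF Z gse_component_moments_single[OF Z]]
    have "length [first_he j k..<last_he j k + 1] = j k" if "k \<in> {1..m}" for k
      using that last_he_step[of k j] by (simp add: first_he_eq)
    then have pow: "mat_pow A (j k) = mat_prod_list (map (\<lambda>i. A) [first_he j k..<last_he j k + 1])"
      if "k \<in> {1..m}" for A :: "'n quat_matrix" and k
      using mat_pow_eq_mat_prod_list[of A "[first_he j k..<last_he j k + 1]"] that by metis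
    have X: "(\<lambda>\<omega>. \<Prod>k=1..m. qRe (trace (mat_pow (Z \<omega>) (j k)))) =
      (\<lambda>\<omega>. \<Prod>k=1..m. qRe (trace (mat_prod_list (map (\<lambda>i. Z \<omega>) [first_he j k..<last_he j k + 1]))))"
      by (intro ext prod.cong refl) (simp only: pow)
    have col: "{\<Gamma> \<in> moebius_graphs m j. color_preserving (\<lambda>_. 1) \<Gamma>} = moebius_graphs m j"
      by (auto simp: color_preserving_def)
    show "integrable M (\<lambda>\<omega>. \<Prod>k=1..m. qRe (trace (mat_pow (Z \<omega>) (j k)))) \<and>
          1 / (4 * real CARD('n)) powi (int n - int m) *
            expectation (\<lambda>\<omega>. \<Prod>k=1..m. qRe (trace (mat_pow (Z \<omega>) (j k))))
          = (\<Sum>\<Gamma>\<in>moebius_graphs m j. (- 2 * real CARD('n)) powi euler_char m j \<Gamma>)"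
      unfolding X using ete unfolding col by (rule conjI)
  next
    fix s :: nat and t :: "nat \<Rightarrow> nat" and Z :: "nat \<Rightarrow> 'w \<Rightarrow> 'n quat_matrix"
    assume "(\<forall>c\<in>{1..s}. gse (Z c)) \<and> indep_vars (\<lambda>_. borel) Z {1..s} \<and> t ` {1..2*n} \<subseteq> {1..s}"
    then have Z: "\<And>c. c \<in> {1..s} \<Longrightarrow> gse (Z c)" and iv: "indep_vars (\<lambda>_. borel) Z {1..s}"
      and t: "t ` {1..2*n} \<subseteq> {1..s}" by blast+
    show "integrable M (\<lambda>\<omega>. \<Prod>k=1..m.
            qRe (trace (mat_prod_list (map (\<lambda>i. Z (t i) \<omega>) [first_he j k..<last_he j k + 1])))) \<and>
          1 / (4 * real CARD('n)) powi (int n - int m) *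
            expectation (\<lambda>\<omega>. \<Prod>k=1..m.
              qRe (trace (mat_prod_list (map (\<lambda>i. Z (t i) \<omega>) [first_he j k..<last_he j k + 1]))))
          = (\<Sum>\<Gamma>\<in>{\<Gamma> \<in> moebius_graphs m j. color_preserving t \<Gamma>}.
              (- 2 * real CARD('n)) powi euler_char m j \<Gamma>)"
      using expectation_trace_product_eq[OF pos sum t Z gse_component_moments[OF Z iv]] by (rule conjI)
  qed
qed

end
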